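(* Let $\mathcal T$ be a $3$-dimensional manifold triangulation and let $S\in\mathcal T$. Then the local star $\mathrm{st}_{\mathcal T}(S)$ is shellable.
   Context: A triangulation (simplicial complex) is a finite family of simplices in a Euclidean space containing all subsimplices of its members and such that any non-empty intersection of two members is a common subsimplex of both; it is $n$-dimensional if every member is contained in an $n$-dimensional member. An $n$-dimensional manifold triangulation is an $n$-dimensional triangulation whose underlying set (union of its members) is an $n$-dimensional topological manifold, possibly with boundary. The local star $\mathrm{st}_{\mathcal T}(S)$ is the subcomplex consisting of all $n$-simplices of $\mathcal T$ containing $S$ together with all their subsimplices. An $n$-dimensional triangulation is shellable if its $n$-simplices can be enumerated as $T_0,\dots,T_M$ (a shelling) such that for each $1\le m\le M$ the interface set $(T_0\cup\dots\cup T_{m-1})\cap T_m$ is a triangulated manifold (possibly with boundary) of dimension $n-1$, equivalently a non-empty union of $(n-1)$-dimensional faces of $T_m$. *)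

theory Defs
  imports "HOL-Analysis.Analysis"
begin

(* Simplicial complexes are those of HOL-Analysis. There the empty set is a simplex (of dimension
   -1) and a face of every convex set, so every non-empty complex has {} as a member. Where only
   non-empty simplices are meant, this has to be said. *)

text \<open>The model space is the half-space \<open>x 0 \<ge> 0\<close> of n-dimensional Euclidean space; for
  \<open>n \<ge> 1\<close> it contains open balls, so interior points need no separate clause, and for
  \<open>n = 0\<close> it is a single point.\<close>

definition manifold_with_boundary :: "nat \<Rightarrow> 'a topology \<Rightarrow> bool" where
  "manifold_with_boundary n X \<longleftrightarrow>
     Hausdorff_space X \<and> second_countable X \<and>
     (\<forall>x \<in> topspace X. \<exists>U V.
        openin X U \<and> x \<in> U \<and>
        openin (subtopology (Euclidean_space n) {y. 0 \<le> y 0}) V \<and>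
        subtopology X U homeomorphic_space subtopology (Euclidean_space n) V)"

definition dimensional_complex :: "nat \<Rightarrow> 'a::euclidean_space set set \<Rightarrow> bool" where
  "dimensional_complex n \<T> \<longleftrightarrow>
     simplicial_complex \<T> \<and> (\<forall>S \<in> \<T>. \<exists>T \<in> \<T>. int n simplex T \<and> S \<subseteq> T)"

definition manifold_triangulation :: "nat \<Rightarrow> 'a::euclidean_space set set \<Rightarrow> bool" where
  "manifold_triangulation n \<T> \<longleftrightarrow>
     dimensional_complex n \<T> \<and> manifold_with_boundary n (top_of_set (\<Union>\<T>))"

definition local_star :: "nat \<Rightarrow> 'a::euclidean_space set set \<Rightarrow> 'a set \<Rightarrow> 'a set set" where
  "local_star n \<T> S = {F. \<exists>T \<in> \<T>. int n simplex T \<and> S \<subseteq> T \<and> F face_of T}"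

definition interface_set :: "'a set list \<Rightarrow> nat \<Rightarrow> 'a set" where
  "interface_set Ts m = \<Union>(set (take m Ts)) \<inter> Ts ! m"

text \<open>The interface set must be triangulated, as an (n-1)-manifold, by faces of \<open>Ts ! m\<close>;
  in particular it is a union of (n-1)-dimensional faces of \<open>Ts ! m\<close>. Non-emptiness is a separate
  clause because the empty set is vacuously a manifold of every dimension. The
  notion is meant for \<open>n \<ge> 1\<close>.\<close>

definition shelling :: "nat \<Rightarrow> 'a::euclidean_space set set \<Rightarrow> 'a set list \<Rightarrow> bool" where
  "shelling n \<T> Ts \<longleftrightarrow>
     Ts \<noteq> [] \<and> distinct Ts \<and> set Ts = {T \<in> \<T>. int n simplex T} \<and>
     (\<forall>m. 1 \<le> m \<and> m < length Ts \<longrightarrow>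
        interface_set Ts m \<noteq> {} \<and>
        (\<exists>\<K>. \<K> \<subseteq> {F. F face_of Ts ! m} \<and> manifold_triangulation (n - 1) \<K> \<and>
             \<Union>\<K> = interface_set Ts m))"

definition shellable :: "nat \<Rightarrow> 'a::euclidean_space set set \<Rightarrow> bool" where
  "shellable n \<T> \<longleftrightarrow> dimensional_complex n \<T> \<and> (\<exists>Ts. shelling n \<T> Ts)"

end

theory Submission
  imports Defs
begin

text \<open>A shelling of the star of S only has to attach each tetrahedron along a non-empty union of facets
  containing S, so only the dual graph and, if S is a vertex v, the link of v matter. Invariance of domain
  shows that a triangle lies in at most two tetrahedra. A point has a neighbourhood whose puncture is homeomorphic
  to a punctured convex set of dimension three and hence simply connected. At the midpoint of an edge this makes
  the dual graph of the star of the edge connected (otherwise there would be a map to the punctured plane without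
  a logarithm); at a vertex it makes the dual graph of the star connected and every cohomology class modulo 2 of
  the link trivial (a cocycle defines a double cover, which has a section).

  A surface with these properties is shelled backwards by removing triangles t whose removal leaves connected
  vertex stars. If all triangles with a boundary edge are bad, each of them separates the surface, by the
  vanishing of the cohomology; the smallest piece cut off by a bad triangle contains a triangle with a boundary
  edge, which cuts off an even smaller piece.\<close>

subsection \<open>Shelling simply connected triangulated surfaces\<close>

text \<open>The obstacle is that a surface cannot be dismantled from an arbitrary boundary triangle:
  if a triangle has a boundary edge and its opposite vertex is on the boundary too, its removal can
  pinch that vertex. Excluding this for all triangles at once takes a global property of the link,
  and the property has to survive each removal. The vanishing of the first cohomology modulo 2 does:
  a cocycle on the smaller surface extends over the removed triangle. It can also be read off from
  the manifold directly, without recognizing the link as a disc or a sphere, and closed links and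
  links with boundary go through the same induction.

  Facets containing S suffice because those of one tetrahedron share a vertex v of S. Their union
  therefore never contains the facet opposite to v, and is a disc rather than the whole boundary
  sphere. If S has at least two vertices, two tetrahedra of its star meet in a facet or exactly in
  S, so any order that keeps the dual graph connected is a shelling; only a vertex needs the theory
  of surfaces.\<close>

text \<open>Connectedness of the dual graph, where simplices sharing \<open>k\<close> vertices are
  adjacent. It is stated with closed subsets instead of paths, because the arguments either exhibit
  a closed subset or ask for an adjacency that leaves a subset. The empty family is linked.\<close>

definition linked :: "nat \<Rightarrow> 'a set set \<Rightarrow> bool" where
  "linked k A \<longleftrightarrow>
     (\<forall>B\<subseteq>A. B \<noteq> {} \<longrightarrow> (\<forall>s\<in>B. \<forall>t\<in>A. card (s \<inter> t) = k \<longrightarrow> t \<in> B) \<longrightarrow> B = A)"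

lemma linkedD:
  assumes "linked k A" "B \<subseteq> A" "x \<in> B"
    and "\<And>s t. s \<in> B \<Longrightarrow> t \<in> A \<Longrightarrow> card (s \<inter> t) = k \<Longrightarrow> t \<in> B"
  shows "B = A"
  using assms unfolding linked_def by (metis empty_iff)

lemma linked_cross:
  assumes "linked k A" "B \<subseteq> A" "x \<in> B" "y \<in> A" "y \<notin> B"
  obtains s t where "s \<in> B" "t \<in> A" "t \<notin> B" "card (s \<inter> t) = k"
  using linkedD[OF assms(1-3)] assms(5,4) by blast

text \<open>By \<open>nb\<close>, a closed subset of \<open>A - {t}\<close> with one neighbour of
  \<open>t\<close> contains all neighbours. A non-empty closed subset has such a neighbour because
  \<open>A\<close> is linked, and together with \<open>t\<close> it is then closed in
  \<open>A\<close>.\<close>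

lemma linked_remove:
  assumes A: "linked k A" and t: "t \<in> A"
    and nb: "\<And>B x y. B \<subseteq> A - {t} \<Longrightarrow>
               (\<And>s s'. s \<in> B \<Longrightarrow> s' \<in> A - {t} \<Longrightarrow> card (s \<inter> s') = k \<Longrightarrow> s' \<in> B) \<Longrightarrow>
               x \<in> B \<Longrightarrow> card (x \<inter> t) = k \<Longrightarrow> y \<in> A - {t} \<Longrightarrow> card (y \<inter> t) = k \<Longrightarrow> y \<in> B"
  shows "linked k (A - {t})"
  unfolding linked_def
proof (intro allI impI)
  fix B assume B: "B \<subseteq> A - {t}" "B \<noteq> {}"
    and cl: "\<forall>s\<in>B. \<forall>t\<in>A - {t}. card (s \<inter> t) = k \<longrightarrow> t \<in> B"
  obtain b where b: "b \<in> B" using B by blast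
  obtain x where x: "x \<in> B" "card (x \<inter> t) = k"
  proof -
    obtain s s' where "s \<in> B" "s' \<in> A" "s' \<notin> B" "card (s \<inter> s') = k"
      using linked_cross[OF A _ b t] B by blast
    with cl that show thesis by blast
  qed
  have "insert t B = A"
  proof (rule linkedD[OF A])
    show "insert t B \<subseteq> A" "t \<in> insert t B" using B t by auto
    fix s s' assume s: "s \<in> insert t B" "s' \<in> A" "card (s \<inter> s') = k"
    show "s' \<in> insert t B"
    proof (cases "s' = t \<or> s \<noteq> t")
      case True then show ?thesis using s cl by auto
    next
      case False
      then show ?thesis using nb[OF B(1), of x s'] cl x s by (simp add: Int_commute)
    qed
  qed
  then show "B = A - {t}" using B by blast
qed

lemma card_2_obtain:
  assumes "card e = 2" "w \<in> e"
  obtains z where "z \<noteq> w" "e = {w,z}"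
  using assms by (metis card_2_iff doubleton_eq_iff insertE singletonD)

lemma card3_edge:
  assumes "card t = 3" "e \<subseteq> t" "card e = 2"
  obtains a b c where "t = {a,b,c}" "e = {a,b}" "a \<noteq> b" "a \<noteq> c" "b \<noteq> c"
proof -
  obtain a b where ab: "e = {a,b}" "a \<noteq> b" using assms(3) by (meson card_2_iff)
  have "finite t" using assms(1) card.infinite by fastforce
  then have "card (t - e) = 1" using assms by (simp add: card_Diff_subset finite_subset)
  then obtain c where "t - e = {c}" by (meson card_1_singletonE)
  then have "t = {a,b,c}" "c \<notin> e" using ab assms by auto
  with ab that show thesis by auto
qed

lemma card3_Int:
  assumes "card s = 3" "card t = 3" "s \<noteq> t" "e \<subseteq> s" "e \<subseteq> t" "card e = 2"
  shows "s \<inter> t = e"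
proof -
  have fin: "finite s" "finite t" using assms card.infinite by fastforce+
  have "card (s \<inter> t) < 3"
  proof (rule ccontr)
    assume "\<not> card (s \<inter> t) < 3"
    then have "s \<inter> t = s" "s \<inter> t = t" using assms fin by (metis card_seteq inf_le1 inf_le2 not_less)+
    with assms show False by auto
  qed
  then show ?thesis using assms fin by (metis Int_greatest card_seteq finite_Int less_Suc_eq_le numeral_3_eq_3 numeral_2_eq_2)
qed

section \<open>Triangulated surfaces and the stars of their vertices\<close>

definition boundary_edge :: "'a set set \<Rightarrow> 'a set \<Rightarrow> bool" where
  "boundary_edge D e \<longleftrightarrow> card e = 2 \<and> (\<exists>!t. t \<in> D \<and> e \<subseteq> t)"

definition star :: "'a set set \<Rightarrow> 'a \<Rightarrow> 'a set set" where
  "star D v = {t\<in>D. v \<in> t}"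

text \<open>The cocycle condition modulo 2 for 1-cochains: inequality of truth values is addition,
  so the values of \<open>c\<close> on the three edges of each triangle add up to zero.\<close>

definition even_cochain :: "'a set set \<Rightarrow> ('a set \<Rightarrow> bool) \<Rightarrow> bool" where
  "even_cochain D c \<longleftrightarrow> (\<forall>x y z. {x,y,z} \<in> D \<longrightarrow> x \<noteq> y \<longrightarrow> x \<noteq> z \<longrightarrow> y \<noteq> z \<longrightarrow>
      c {x,y} = (c {x,z} \<noteq> c {y,z}))"

text \<open>The conditions are purely combinatorial and chosen to survive the removal of a suitable
  triangle, down to the empty family. By \<open>edge_le2\<close> and \<open>star_linked\<close> the
  triangles at a vertex form a path or a cycle; \<open>cohomology\<close> says that every cocycle
  modulo 2 is the coboundary of a vertex function \<open>f\<close>.\<close>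

locale simply_connected_surface =
  fixes D :: "'a set set"
  assumes finite_D: "finite D"
    and card3: "t \<in> D \<Longrightarrow> card t = 3"
    and edge_le2: "card e = 2 \<Longrightarrow> card {t\<in>D. e \<subseteq> t} \<le> 2"
    and star_linked: "linked 2 (star D v)"
    and linked: "linked 2 D"
    and cohomology: "even_cochain D c \<Longrightarrow>
      \<exists>f :: 'a \<Rightarrow> bool. \<forall>t\<in>D. \<forall>x\<in>t. \<forall>y\<in>t. x \<noteq> y \<longrightarrow> c {x,y} = (f x \<noteq> f y)"
begin

lemma edge_3:
  assumes "card e = 2" "r \<in> D" "s \<in> D" "t \<in> D" "e \<subseteq> r" "e \<subseteq> s" "e \<subseteq> t"
  shows "r = s \<or> r = t \<or> s = t"
proof (rule ccontr)
  assume "\<not> ?thesis"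
  then have "card {r,s,t} = 3" by auto
  moreover have "{r,s,t} \<subseteq> {t\<in>D. e \<subseteq> t}" using assms by auto
  ultimately have "3 \<le> card {t\<in>D. e \<subseteq> t}" by (metis card_mono finite_D finite_Collect_conjI Collect_mem_eq)
  with edge_le2[OF assms(1)] show False by simp
qed

lemma boundary_edgeD: "boundary_edge D e \<Longrightarrow> s \<in> D \<Longrightarrow> t \<in> D \<Longrightarrow> e \<subseteq> s \<Longrightarrow> e \<subseteq> t \<Longrightarrow> s = t"
  unfolding boundary_edge_def by blast

lemma shared_edge:
  assumes "t \<in> D" "e \<subseteq> t" "card e = 2" "\<not> boundary_edge D e"
  obtains s where "s \<in> D" "s \<noteq> t" "e \<subseteq> s" "s \<inter> t = e"
  using assms unfolding boundary_edge_def by (metis card3 card3_Int)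

text \<open>Adjacency is symmetric, and no set is adjacent to itself since its size is not 2; so the
  ordered pairs come in twos.\<close>

lemma adjacent_pairs_even:
  assumes "finite Q" "\<And>s. s \<in> Q \<Longrightarrow> card s \<noteq> 2"
  shows "even (card {(s,s'). s \<in> Q \<and> s' \<in> Q \<and> card (s \<inter> s') = 2})"
  using assms
proof (induction Q rule: finite_induct)
  case empty then show ?case by simp
next
  case (insert t Q)
  let ?P = "\<lambda>Q. {(s,s'). s \<in> Q \<and> s' \<in> Q \<and> card (s \<inter> s') = 2}"
  let ?N = "{s\<in>Q. card (s \<inter> t) = 2}"
  have fP: "finite (?P Q)" by (rule finite_subset[of _ "Q \<times> Q"]) (use insert in auto)
  have tt: "card t \<noteq> 2" using insert.prems(1)[of t] by simp
  have "?P (insert t Q) = ?P Q \<union> ((\<lambda>s. (s,t)) ` ?N \<union> (\<lambda>s. (t,s)) ` ?N)"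
  proof -
    have "x \<in> ?P (insert t Q) \<longleftrightarrow> x \<in> ?P Q \<union> ((\<lambda>s. (s,t)) ` ?N \<union> (\<lambda>s. (t,s)) ` ?N)" for x
    proof (cases x)
      case (Pair p q)
      show ?thesis unfolding Pair by (simp add: image_iff) (metis Int_commute Int_absorb tt)
    qed
    then show ?thesis by blast
  qed
  moreover have "card (\<dots>) = card (?P Q) + card ((\<lambda>s. (s,t)) ` ?N \<union> (\<lambda>s. (t,s)) ` ?N)"
    using insert.hyps fP by (intro card_Un_disjoint) auto
  moreover have "card ((\<lambda>s. (s,t)) ` ?N \<union> (\<lambda>s. (t,s)) ` ?N)
      = card ((\<lambda>s. (s,t)) ` ?N) + card ((\<lambda>s. (t,s)) ` ?N)"
    using insert.hyps by (intro card_Un_disjoint) auto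
  moreover have "card ((\<lambda>s. (s,t)) ` ?N) = card ?N" "card ((\<lambda>s. (t,s)) ` ?N) = card ?N"
    by (auto intro!: card_image inj_onI)
  moreover have "even (card (?P Q))" using insert.prems by (intro insert.IH) simp
  ultimately show ?case by simp
qed

text \<open>If \<open>Y\<close> were outside \<open>B\<close>, then \<open>X\<close> would be the
  only triangle of \<open>B\<close> adjacent to \<open>t\<close>. By \<open>nb\<close> each triangle
  of \<open>B\<close> has exactly two neighbours in the star, so \<open>2 * card B\<close> counts
  the ordered adjacent pairs inside \<open>B\<close>, an even number, and the one pair
  \<open>(X,t)\<close>.\<close>

lemma star_parity:
  assumes t: "t \<in> star D w" and B: "B \<subseteq> star D w - {t}"
    and cl: "\<And>s s'. s \<in> B \<Longrightarrow> s' \<in> star D w - {t} \<Longrightarrow> card (s \<inter> s') = 2 \<Longrightarrow> s' \<in> B"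
    and X: "X \<in> B" "card (X \<inter> t) = 2" and Y: "Y \<in> star D w - {t}" "card (Y \<inter> t) = 2"
    and nb: "\<And>s x. s \<in> B \<Longrightarrow> x \<in> s \<Longrightarrow> \<not> boundary_edge D {w,x}"
  shows "Y \<in> B"
proof (rule ccontr)
  assume YB: "Y \<notin> B"
  have star: "s \<in> D" "w \<in> s" if "s \<in> star D w" for s using that by (auto simp: star_def)
  have tD: "t \<in> D" "w \<in> t" using t by (auto simp: star_def)
  have XD: "X \<in> D" "w \<in> X" "X \<noteq> t" using X B by (auto simp: star_def)
  have YD: "Y \<in> D" "w \<in> Y" "Y \<noteq> t" using Y by (auto simp: star_def)
  have edge: "\<exists>x. s \<inter> s' = {w,x} \<and> x \<noteq> w"
    if "s \<in> star D w" "s' \<in> star D w" "card (s \<inter> s') = 2" for s s'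
    using that star by (metis (no_types, lifting) IntI card_2_iff doubleton_eq_iff insertE singletonD)
  obtain x where x: "X \<inter> t = {w,x}" "x \<noteq> w" using edge[OF _ t X(2)] X B by blast
  obtain y where y: "Y \<inter> t = {w,y}" "y \<noteq> w" using edge[OF _ t Y(2)] Y by blast
  have xy: "x \<noteq> y"
  proof
    assume "x = y"
    then have "X = Y \<or> X = t \<or> Y = t"
      using edge_3[of "{w,x}" X Y t] x y XD YD tD by auto
    with XD YD X YB show False by auto
  qed
  have "t = {w,x,y}"
  proof -
    have "{w,x,y} \<subseteq> t" using x y by blast
    moreover have "card {w,x,y} = 3" using x y xy by auto
    ultimately show ?thesis using card3[OF tD(1)]
      by (metis card.infinite card_subset_eq zero_neq_numeral)
  qed
  have fB: "finite B" by (rule finite_subset[OF _ finite_D]) (use B star in blast)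
  let ?P = "{(s,s'). s \<in> B \<and> s' \<in> B \<and> card (s \<inter> s') = 2}"
  let ?N = "\<lambda>s. {s'\<in>star D w. card (s \<inter> s') = 2}"
  have N2: "card (?N s) = 2" if sB: "s \<in> B" for s
  proof -
    have s: "s \<in> D" "w \<in> s" using sB B star by auto
    obtain p q where pq: "s = {w,p,q}" "w \<noteq> p" "w \<noteq> q" "p \<noteq> q"
    proof -
      obtain a b c where abc: "s = {a,b,c}" "a \<noteq> b" "b \<noteq> c" "a \<noteq> c"
        using card3[OF s(1)] by (metis card_3_iff)
      with s that show thesis by (auto simp: insert_commute)
    qed
    obtain sp where sp: "sp \<in> D" "sp \<noteq> s" "{w,p} \<subseteq> sp" "sp \<inter> s = {w,p}"
      using shared_edge[of s "{w,p}"] s pq nb[OF sB] by auto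
    obtain sq where sq: "sq \<in> D" "sq \<noteq> s" "{w,q} \<subseteq> sq" "sq \<inter> s = {w,q}"
      using shared_edge[of s "{w,q}"] s pq nb[OF sB] by auto
    have ne: "sp \<noteq> sq"
    proof
      assume "sp = sq"
      then have "{w,p} = {w,q}" using sp(4) sq(4) by simp
      then show False using pq(2-4) by (auto simp: doubleton_eq_iff)
    qed
    have "?N s = {sp,sq}"
    proof
      have "sp \<in> ?N s" "sq \<in> ?N s"
        using sp sq pq(2-4) by (simp_all add: star_def Int_commute[of s])
      then show "{sp,sq} \<subseteq> ?N s" by blast
      show "?N s \<subseteq> {sp,sq}"
      proof
        fix r assume r: "r \<in> ?N s"
        then obtain z where z: "s \<inter> r = {w,z}" "z \<noteq> w"
          using edge[of s r] sB B by blast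
        have rD: "r \<in> D" "r \<noteq> s" using r star card3[OF s(1)] by auto
        have zr: "{w,z} \<subseteq> r" "{w,z} \<subseteq> s" using z by blast+
        have "z = p \<or> z = q" using z pq by blast
        then show "r \<in> {sp,sq}"
        proof
          assume "z = p"
          then have "r = sp \<or> r = s \<or> sp = s"
            using zr sp(1,3) s(1) rD(1) pq(2) by (intro edge_3[of "{w,p}"]) auto
          with rD sp show ?thesis by blast
        next
          assume "z = q"
          then have "r = sq \<or> r = s \<or> sq = s"
            using zr sq(1,3) s(1) rD(1) pq(3) by (intro edge_3[of "{w,q}"]) auto
          with rD sq show ?thesis by blast
        qed
      qed
    qed
    then show ?thesis using ne by simp
  qed
  have "(SIGMA s:B. ?N s) = insert (X,t) ?P"
  proof
    show "insert (X,t) ?P \<subseteq> (SIGMA s:B. ?N s)" using X t B by auto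
    show "(SIGMA s:B. ?N s) \<subseteq> insert (X,t) ?P"
    proof clarsimp
      fix s s' assume s: "s \<in> B" "s' \<in> star D w" "card (s \<inter> s') = 2" "s = X \<longrightarrow> s' \<noteq> t"
      show "s' \<in> B"
      proof (cases "s' = t")
        case True
        then obtain z where z: "s \<inter> t = {w,z}" "z \<noteq> w"
          using edge[of s t] s t B by blast
        have zs: "{w,z} \<subseteq> t" "{w,z} \<subseteq> s" using z by blast+
        have sD: "s \<in> D" "s \<noteq> t" using s B star by auto
        have "z = x \<or> z = y" using z \<open>t = {w,x,y}\<close> by blast
        then have "s = X \<or> s = Y"
        proof
          assume "z = x"
          then have "s = X \<or> s = t \<or> X = t"
            using zs sD(1) XD(1) tD(1) x by (intro edge_3[of "{w,x}"]) auto
          with sD XD show ?thesis by blast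
        next
          assume "z = y"
          then have "s = Y \<or> s = t \<or> Y = t"
            using zs sD(1) YD(1) tD(1) y by (intro edge_3[of "{w,y}"]) auto
          with sD YD show ?thesis by blast
        qed
        then show ?thesis using s True B YB by auto
      next
        case False
        then show ?thesis using cl s by auto
      qed
    qed
  qed
  moreover have "(X,t) \<notin> ?P" using B by auto
  moreover have "finite ?P" by (rule finite_subset[of _ "B \<times> B"]) (use fB in auto)
  moreover have "card (SIGMA s:B. ?N s) = (\<Sum>s\<in>B. card (?N s))"
    by (rule card_SigmaI) (use fB finite_D in \<open>auto simp: star_def\<close>)
  ultimately have "Suc (card ?P) = 2 * card B" using N2 by simp
  moreover have odd: "Suc n = 2 * m \<Longrightarrow> odd n" for n m :: nat by presburger
  moreover have "even (card ?P)"
  proof (rule adjacent_pairs_even[OF fB])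
    fix s assume "s \<in> B"
    then have "card s = 3" using B star card3 by auto
    then show "card s \<noteq> 2" by simp
  qed
  ultimately show False using odd[of "card ?P" "card B"] by blast
qed

text \<open>If \<open>t\<close> has a boundary edge at \<open>w\<close>, it is an end of the path of
  triangles around \<open>w\<close> and has at most one neighbour there. If \<open>w\<close> has no
  boundary edge, the star is a cycle and \<open>star_parity\<close> joins the two neighbours of
  \<open>t\<close>.\<close>

lemma star_remove:
  assumes t: "t \<in> star D w"
    and w: "(\<exists>x\<in>t. boundary_edge D {w,x}) \<or> (\<forall>x. \<not> boundary_edge D {w,x})"
  shows "linked 2 (star D w - {t})"
proof (rule linked_remove[OF star_linked t])
  fix B X Y
  assume B: "B \<subseteq> star D w - {t}"
    and cl: "\<And>s s'. s \<in> B \<Longrightarrow> s' \<in> star D w - {t} \<Longrightarrow> card (s \<inter> s') = 2 \<Longrightarrow> s' \<in> B"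
    and X: "X \<in> B" "card (X \<inter> t) = 2" and Y: "Y \<in> star D w - {t}" "card (Y \<inter> t) = 2"
  have tD: "t \<in> D" "w \<in> t" using t by (auto simp: star_def)
  show "Y \<in> B"
  proof (cases "\<exists>x. boundary_edge D {w,x}")
    case False
    then show ?thesis by (intro star_parity[OF t B _ X Y]) (use cl in blast)+
  next
    case True
    then obtain x where x: "x \<in> t" "boundary_edge D {w,x}" using w by blast
    then have "x \<noteq> w" by (auto simp: boundary_edge_def)
    have "card (t - {w,x}) = 1"
      using card3[OF tD(1)] x tD \<open>x \<noteq> w\<close> by (subst card_Diff_subset) auto
    then obtain y where y: "t - {w,x} = {y}" by (meson card_1_singletonE)
    have "S \<inter> t = {w,y}" if "S \<in> star D w" "S \<noteq> t" "card (S \<inter> t) = 2" for S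
    proof -
      have S: "S \<in> D" "w \<in> S" using that by (auto simp: star_def)
      then have "x \<notin> S" using boundary_edgeD[OF x(2), of S t] tD x that by auto
      then have "S \<inter> t \<subseteq> {w,y}" using y by blast
      moreover have "card {w,y} = 2" using y by (simp add: card_insert_if) blast
      ultimately show ?thesis using that by (metis card.infinite card_subset_eq zero_neq_numeral)
    qed
    then have "X \<inter> t = {w,y}" "Y \<inter> t = {w,y}" using B X Y by auto
    moreover have "card {w,y} = 2" using calculation X by simp
    ultimately have "X = Y \<or> X = t \<or> Y = t"
      using B X Y tD by (intro edge_3[of "{w,y}"]) (auto simp: star_def)
    then show ?thesis using B X Y by auto
  qed
qed

text \<open>Two edges of the triangle \<open>t\<close> have a common vertex \<open>w\<close>, so any
  two neighbours of \<open>t\<close> lie in one star, where they stay connected after the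
  removal.\<close>

lemma remove_linked:
  assumes t: "t \<in> D" and st: "\<And>w. w \<in> t \<Longrightarrow> linked 2 (star D w - {t})"
  shows "linked 2 (D - {t})"
proof (rule linked_remove[OF linked t])
  fix B X Y
  assume B: "B \<subseteq> D - {t}"
    and cl: "\<And>s s'. s \<in> B \<Longrightarrow> s' \<in> D - {t} \<Longrightarrow> card (s \<inter> s') = 2 \<Longrightarrow> s' \<in> B"
    and X: "X \<in> B" "card (X \<inter> t) = 2" and Y: "Y \<in> D - {t}" "card (Y \<inter> t) = 2"
  obtain w where w: "w \<in> t" "w \<in> X" "w \<in> Y"
  proof -
    have ft: "finite t" using card3[OF t] card.infinite by fastforce
    have "card ((X \<inter> t) \<union> (Y \<inter> t)) \<le> 3" using card3[OF t] ft by (metis card_mono Int_lower2 Un_least)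
    then have "X \<inter> t \<inter> (Y \<inter> t) \<noteq> {}"
      using card_Un_disjoint[of "X \<inter> t" "Y \<inter> t"] ft X Y by auto
    then show thesis using that by blast
  qed
  have "B \<inter> star D w = star D w - {t}"
  proof (rule linkedD[OF st[OF w(1)]])
    show "B \<inter> star D w \<subseteq> star D w - {t}" using B by auto
    show "X \<in> B \<inter> star D w" using X w B by (auto simp: star_def)
  qed (use cl in \<open>auto simp: star_def\<close>)
  then show "Y \<in> B" using Y w by (auto simp: star_def)
qed

end

section \<open>Removing a triangle from a surface\<close>

text \<open>In a closed surface every triangle qualifies. Otherwise \<open>t\<close> needs a
  boundary edge, over which cocycles can be extended, and the last clause is the hypothesis of
  \<open>star_remove\<close>: no vertex of \<open>t\<close> gets pinched.\<close>

definition removable :: "'a set set \<Rightarrow> 'a set \<Rightarrow> bool" where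
  "removable D t \<longleftrightarrow> t \<in> D \<and>
     ((\<forall>e. \<not> boundary_edge D e) \<or> (\<exists>e\<subseteq>t. boundary_edge D e)) \<and>
     (\<forall>w\<in>t. (\<exists>x\<in>t. boundary_edge D {w,x}) \<or> (\<forall>x. \<not> boundary_edge D {w,x}))"

definition cuts :: "('a set \<Rightarrow> bool) \<Rightarrow> 'a set \<Rightarrow> nat" where
  "cuts c t = card {e. e \<subseteq> t \<and> card e = 2 \<and> c e}"

lemma edges_of_triangle:
  assumes "x \<noteq> y" "x \<noteq> z" "y \<noteq> z"
  shows "{e. e \<subseteq> {x,y,z} \<and> card e = 2} = {{x,y},{x,z},{y,z}}"
proof (intro set_eqI iffI)
  fix e assume "e \<in> {e. e \<subseteq> {x,y,z} \<and> card e = 2}"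
  then obtain a b where "e = {a,b}" "a \<noteq> b" "a \<in> {x,y,z}" "b \<in> {x,y,z}"
    by (auto simp: card_2_iff)
  then show "e \<in> {{x,y},{x,z},{y,z}}" by (auto simp: insert_commute)
qed (use assms in auto)

text \<open>The parity of \<open>cuts\<close> is symmetric in the three vertices, so the cocycle
  condition at a triangle need only be checked for one naming of its vertices.\<close>

lemma even_cuts_iff:
  assumes "x \<noteq> y" "x \<noteq> z" "y \<noteq> z"
  shows "even (cuts c {x,y,z}) \<longleftrightarrow> (c {x,y} = (c {x,z} \<noteq> c {y,z}))"
proof -
  have "{e. e \<subseteq> {x,y,z} \<and> card e = 2 \<and> c e} = {e\<in>{{x,y},{x,z},{y,z}}. c e}"
    using edges_of_triangle[OF assms] by blast
  also have "\<dots> = (if c {x,y} then {{x,y}} else {}) \<union> (if c {x,z} then {{x,z}} else {}) \<union>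
      (if c {y,z} then {{y,z}} else {})" by auto
  finally show ?thesis using assms unfolding cuts_def
    by (simp add: doubleton_eq_iff split: if_splits)
qed

context simply_connected_surface
begin

text \<open>Without boundary edges every edge lies in exactly two triangles, so the edges of an even
  cochain on the complement of t are counted twice in total and t carries an even number too.\<close>

lemma even_cuts_closed:
  assumes nb: "\<And>e. \<not> boundary_edge D e" and t: "t \<in> D"
    and ev: "\<And>s. s \<in> D \<Longrightarrow> s \<noteq> t \<Longrightarrow> even (cuts c s)"
  shows "even (cuts c t)"
proof -
  have fin: "finite s" if "s \<in> D" for s using card3[OF that] card.infinite by fastforce
  let ?E = "{e. e \<subseteq> \<Union>D \<and> card e = 2 \<and> c e}"
  have fE: "finite ?E" using finite_D fin by simp
  have "even (\<Sum>e\<in>?E. card {s\<in>D. e \<subseteq> s})"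
  proof (rule dvd_sum)
    fix e assume e: "e \<in> ?E"
    show "2 dvd card {s\<in>D. e \<subseteq> s}"
    proof (cases "{s\<in>D. e \<subseteq> s} = {}")
      case False
      then obtain s where s: "s \<in> D" "e \<subseteq> s" by blast
      have "card e = 2" using e by simp
      then obtain s' where s': "s' \<in> D" "s' \<noteq> s" "e \<subseteq> s'" using shared_edge[OF s _ nb] by metis
      have "2 = card {s,s'}" using s' by simp
      also have "\<dots> \<le> card {s\<in>D. e \<subseteq> s}" by (rule card_mono) (use finite_D s s' in auto)
      finally have "card {s\<in>D. e \<subseteq> s} = 2" using edge_le2[of e] e by (intro antisym) auto
      then show ?thesis by simp
    next
      case True
      show ?thesis unfolding True by simp
    qed
  qed
  also have "(\<Sum>e\<in>?E. card {s\<in>D. e \<subseteq> s}) = (\<Sum>s\<in>D. card {e\<in>?E. e \<subseteq> s})"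
    using sum_multicount_gen[OF fE finite_D, of "\<lambda>e s. e \<subseteq> s" "\<lambda>s. card {e\<in>?E. e \<subseteq> s}"] by simp
  also have "\<dots> = (\<Sum>s\<in>D. cuts c s)"
    by (rule sum.cong) (auto simp: cuts_def intro!: arg_cong[where f=card])
  also have "\<dots> = cuts c t + (\<Sum>s\<in>D-{t}. cuts c s)" using sum.remove[OF finite_D t] .
  finally have "even (cuts c t + (\<Sum>s\<in>D-{t}. cuts c s))" .
  moreover have "even (\<Sum>s\<in>D-{t}. cuts c s)" by (rule dvd_sum) (use ev in auto)
  ultimately show ?thesis by simp
qed

text \<open>For \<open>cohomology\<close>, a cocycle on \<open>D - {t}\<close> is extended over
  \<open>t\<close>. A boundary edge of \<open>t\<close> lies in no other triangle, so its value may
  be reset to what the other two edges of \<open>t\<close> force; without boundary edges,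
  \<open>even_cuts_closed\<close> gives the condition at \<open>t\<close> for free.\<close>

lemma surface_remove:
  assumes "removable D t"
  shows "simply_connected_surface (D - {t})"
proof
  have t: "t \<in> D" using assms by (simp add: removable_def)
  have st: "linked 2 (star D w - {t})" if "w \<in> t" for w
    using star_remove[of t w] assms that by (auto simp: removable_def star_def)
  show "linked 2 (D - {t})" using remove_linked[OF t st] .
  show "linked 2 (star (D - {t}) v)" for v
  proof (cases "v \<in> t")
    case True
    have "star (D - {t}) v = star D v - {t}" by (auto simp: star_def)
    then show ?thesis using st[OF True] by simp
  next
    case False
    then have "star (D - {t}) v = star D v" by (auto simp: star_def)
    then show ?thesis using star_linked by simp
  qed
  show "finite (D - {t})" using finite_D by simp
  show "card s = 3" if "s \<in> D - {t}" for s using that card3 by simp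
  show "card {s\<in>D - {t}. e \<subseteq> s} \<le> 2" if "card e = 2" for e
    by (rule order_trans[OF card_mono edge_le2[OF that]]) (use finite_D in auto)
  fix c assume c: "even_cochain (D - {t}) c"
  show "\<exists>f :: 'a \<Rightarrow> bool. \<forall>s\<in>D - {t}. \<forall>x\<in>s. \<forall>y\<in>s. x \<noteq> y \<longrightarrow> c {x,y} = (f x \<noteq> f y)"
  proof (cases "\<exists>e\<subseteq>t. boundary_edge D e")
    case True
    then obtain e where e: "e \<subseteq> t" "boundary_edge D e" "card e = 2" unfolding boundary_edge_def by blast
    then obtain p q r where pqr: "t = {p,q,r}" "e = {p,q}" "p \<noteq> q" "p \<noteq> r" "q \<noteq> r"
      using card3_edge[OF card3[OF t] e(1,3)] by blast
    define c' where "c' = c(e := (c {p,r} \<noteq> c {q,r}))"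
    have c': "c' {x,y} = c {x,y}" if "s \<in> D" "s \<noteq> t" "x \<in> s" "y \<in> s" for s x y
      using boundary_edgeD[OF e(2), of s t] that t e(1) by (auto simp: c'_def)
    have "even_cochain D c'" unfolding even_cochain_def
    proof (intro allI impI)
      fix x y z assume xyz: "{x,y,z} \<in> D" "x \<noteq> y" "x \<noteq> z" "y \<noteq> z"
      show "c' {x,y} = (c' {x,z} \<noteq> c' {y,z})"
      proof (cases "{x,y,z} = t")
        case False
        then show ?thesis using c xyz c'[of "{x,y,z}"] by (simp add: even_cochain_def)
      next
        case True
        have "even (cuts c' {p,q,r})"
          using pqr by (subst even_cuts_iff) (auto simp: c'_def doubleton_eq_iff)
        then have "even (cuts c' {x,y,z})" using True pqr by simp
        then show ?thesis using even_cuts_iff[OF xyz(2-4)] by simp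
      qed
    qed
    from cohomology[OF this] obtain f :: "'a \<Rightarrow> bool"
      where "\<forall>t\<in>D. \<forall>x\<in>t. \<forall>y\<in>t. x \<noteq> y \<longrightarrow> c' {x,y} = (f x \<noteq> f y)" by (rule exE)
    then show ?thesis using c' by (metis Diff_iff singletonI)
  next
    case False
    then have nb: "\<not> boundary_edge D e" for e using assms by (auto simp: removable_def)
    have ev: "even (cuts c s)" if sD: "s \<in> D" "s \<noteq> t" for s
    proof -
      obtain x y z where xyz: "s = {x,y,z}" "x \<noteq> y" "y \<noteq> z" "x \<noteq> z"
        using card3[OF sD(1)] by (metis card_3_iff)
      have "c {x,y} = (c {x,z} \<noteq> c {y,z})"
        using c[unfolded even_cochain_def, rule_format, of x y z] sD xyz by simp
      then show ?thesis using even_cuts_iff[OF xyz(2,4,3), of c] xyz(1) by simp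
    qed
    then have "even (cuts c s)" if "s \<in> D" for s using even_cuts_closed[OF nb t, of c] that by blast
    then have "c {x,y} = (c {x,z} \<noteq> c {y,z})"
      if "{x,y,z} \<in> D" "x \<noteq> y" "x \<noteq> z" "y \<noteq> z" for x y z
      using even_cuts_iff[OF that(2-4), of c] that(1) by simp
    then have "even_cochain D c" by (simp add: even_cochain_def)
    from cohomology[OF this] show ?thesis by (metis DiffD1)
  qed
qed

end

section \<open>Triangles that separate the surface\<close>

text \<open>\<open>B\<close> may be any proper non-empty union of components of the dual graph of
  \<open>D - {t}\<close>, so it can be replaced by its complement.\<close>

definition separates :: "'a set set \<Rightarrow> 'a set set \<Rightarrow> 'a set \<Rightarrow> bool" where
  "separates D B t \<longleftrightarrow> B \<subseteq> D - {t} \<and> B \<noteq> {} \<and> B \<noteq> D - {t} \<and>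
     (\<forall>s\<in>B. \<forall>s'\<in>D - {t}. card (s \<inter> s') = 2 \<longrightarrow> s' \<in> B)"

lemma separates_complement:
  assumes "separates D B t"
  shows "separates D (D - {t} - B) t"
proof -
  note B = assms[unfolded separates_def]
  show ?thesis unfolding separates_def
  proof (intro conjI ballI impI)
    fix s s' assume s: "s \<in> D - {t} - B" "s' \<in> D - {t}" "card (s \<inter> s') = 2"
    then have "card (s' \<inter> s) = 2" by (simp add: Int_commute)
    then show "s' \<in> D - {t} - B" using B s by blast
  qed (use B in blast)+
qed

context simply_connected_surface
begin

text \<open>In the star of a vertex w with a boundary edge, t has two neighbours; the star is a path, and A
  is the part of it on one side of t.\<close>

lemma star_split:
  assumes t: "t \<in> star D w" and nb: "\<And>x. x \<in> t \<Longrightarrow> \<not> boundary_edge D {w,x}"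
    and bd: "boundary_edge D {w,x0}"
  obtains A X Y where "A \<subseteq> star D w - {t}" "X \<in> A" "card (X \<inter> t) = 2"
    "Y \<in> star D w - {t} - A" "card (Y \<inter> t) = 2"
    "\<And>s s'. s \<in> A \<Longrightarrow> s' \<in> star D w - {t} \<Longrightarrow> card (s \<inter> s') = 2 \<Longrightarrow> s' \<in> A"
proof -
  have starD: "s \<in> D" "w \<in> s" if "s \<in> star D w" for s using that by (auto simp: star_def)
  let ?N = "\<lambda>s. {s'\<in>star D w. card (s \<inter> s') = 2}"
  let ?out = "\<lambda>A. {(s,s'). s \<in> A \<and> s' \<in> star D w - A \<and> card (s \<inter> s') = 2}"
  have fs: "finite (star D w)" using finite_D by (simp add: star_def)
  have fout: "finite (?out A)" if "A \<subseteq> star D w" for A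
    by (rule finite_subset[of _ "star D w \<times> star D w"]) (use that fs in auto)
  have tri: "\<exists>p q. s = {w,p,q} \<and> w \<noteq> p \<and> w \<noteq> q \<and> p \<noteq> q" if sw: "s \<in> star D w" for s
  proof -
    obtain a b c where "s = {a,b,c}" "a \<noteq> b" "b \<noteq> c" "a \<noteq> c"
      using card3[OF starD(1)[OF sw]] by (metis card_3_iff)
    with starD(2)[OF sw] show ?thesis by (auto simp: insert_commute)
  qed
  have nbr: "r \<inter> s = {w,z} \<Longrightarrow> r' \<inter> s = {w,z} \<Longrightarrow> w \<noteq> z \<Longrightarrow> r = r'"
    if "s \<in> star D w" "r \<in> star D w" "r' \<in> star D w" "r \<noteq> s" "r' \<noteq> s" for r r' s z
    using edge_3[of "{w,z}" r r' s] that starD by auto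
  have N: "\<exists>p q. s = {w,p,q} \<and> w \<noteq> p \<and> w \<noteq> q \<and> p \<noteq> q \<and>
      (\<forall>r\<in>?N s. r \<inter> s = {w,p} \<or> r \<inter> s = {w,q})" if s: "s \<in> star D w" for s
  proof -
    obtain p q where pq: "s = {w,p,q}" "w \<noteq> p" "w \<noteq> q" "p \<noteq> q" using tri[OF s] by blast
    have "r \<inter> s = {w,p} \<or> r \<inter> s = {w,q}" if "r \<in> ?N s" for r
    proof -
      have rs: "card (r \<inter> s) = 2" "w \<in> r \<inter> s" using that starD s by (auto simp: Int_commute)
      then obtain z where "z \<noteq> w" "r \<inter> s = {w,z}" by (rule card_2_obtain)
      moreover then have "z = p \<or> z = q" using pq(1) by blast
      ultimately show ?thesis by blast
    qed
    with pq show ?thesis by blast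
  qed
  have neq: "r \<noteq> s" if "r \<in> ?N s" "s \<in> star D w" for r s
    using that card3[of s] starD(1)[of s] by auto
  have N2: "card (?N s) \<le> 2" if s: "s \<in> star D w" for s
  proof -
    obtain p q where pq: "s = {w,p,q}" "w \<noteq> p" "w \<noteq> q" "p \<noteq> q"
      "\<forall>r\<in>?N s. r \<inter> s = {w,p} \<or> r \<inter> s = {w,q}" using N[OF s] by blast
    have "inj_on (\<lambda>r. r \<inter> s) (?N s)"
    proof (rule inj_onI)
      fix r r' assume r: "r \<in> ?N s" "r' \<in> ?N s" "r \<inter> s = r' \<inter> s"
      then show "r = r'" using nbr[OF s, of r r'] neq[OF _ s] pq by (metis (no_types, lifting) mem_Collect_eq)
    qed
    then have "card (?N s) \<le> card {{w,p},{w,q}}"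
      by (rule card_inj_on_le) (use pq in auto)
    also have "\<dots> \<le> 2" by (simp add: card_insert_if)
    finally show ?thesis .
  qed
  have "w \<noteq> x0" using bd by (auto simp: boundary_edge_def)
  then obtain s0 where s0: "s0 \<in> D" "{w,x0} \<subseteq> s0" "w \<noteq> x0"
    using bd unfolding boundary_edge_def by blast
  have s0w: "s0 \<in> star D w" using s0 by (auto simp: star_def)
  have "s0 \<noteq> t" using nb[of x0] s0 bd by auto
  have N1: "card (?N s0) \<le> 1"
  proof -
    obtain p q where pq: "s0 = {w,p,q}" "w \<noteq> p" "w \<noteq> q" "p \<noteq> q"
      "\<forall>r\<in>?N s0. r \<inter> s0 = {w,p} \<or> r \<inter> s0 = {w,q}" using N[OF s0w] by blast
    have no: "r \<inter> s0 \<noteq> {w,x0}" if "r \<in> ?N s0" for r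
    proof
      assume "r \<inter> s0 = {w,x0}"
      then have "r = s0" using boundary_edgeD[OF bd, of r s0] s0 that starD by blast
      with neq[OF that s0w] show False by simp
    qed
    have "r = r'" if r: "r \<in> ?N s0" "r' \<in> ?N s0" for r r'
    proof -
      have "x0 = p \<or> x0 = q" using pq(1) s0 by blast
      moreover have "r \<inter> s0 = {w,p} \<or> r \<inter> s0 = {w,q}" "r' \<inter> s0 = {w,p} \<or> r' \<inter> s0 = {w,q}"
        using pq(5) r by simp_all
      moreover have "r \<inter> s0 \<noteq> {w,x0}" "r' \<inter> s0 \<noteq> {w,x0}" using no r by simp_all
      ultimately obtain z where z: "w \<noteq> z" "r \<inter> s0 = {w,z}" "r' \<inter> s0 = {w,z}" using pq(2,3) by auto
      have "r \<in> star D w" "r' \<in> star D w" "r \<noteq> s0" "r' \<noteq> s0" using neq[OF _ s0w] r by simp_all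
      then show ?thesis using nbr[OF s0w _ _ _ _ z(2,3,1)] by simp
    qed
    then have "\<forall>r\<in>?N s0. \<forall>r'\<in>?N s0. r = r'" by blast
    then show ?thesis using fs by (subst One_nat_def, subst card_le_Suc0_iff_eq) auto
  qed
  \<comment> \<open>Initial segments of the path are described without an enumeration: they contain
    the end \<open>s0\<close> and have at most one adjacency leading out. A largest one that avoids
    \<open>t\<close> stops next to \<open>t\<close>; otherwise the triangle behind its exit, which
    has at most two neighbours, could be added.\<close>
  define good where "good A \<longleftrightarrow> A \<subseteq> star D w - {t} \<and> s0 \<in> A \<and> card (?out A) \<le> 1" for A
  have "good {s0}"
    unfolding good_def
  proof (intro conjI)
    have "?out {s0} \<subseteq> Pair s0 ` ?N s0" by auto
    then have "card (?out {s0}) \<le> card (Pair s0 ` ?N s0)" by (rule card_mono[rotated]) (use fs in auto)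
    also have "\<dots> \<le> card (?N s0)" by (rule card_image_le) (use fs in auto)
    finally show "card (?out {s0}) \<le> 1" using N1 by simp
  qed (use s0w \<open>s0 \<noteq> t\<close> in auto)
  moreover have "\<forall>A. good A \<longrightarrow> card A < Suc (card (star D w))"
    using fs by (auto simp: good_def less_Suc_eq_le intro!: card_mono)
  ultimately obtain A where gA: "good A" and mx: "\<And>B. good B \<Longrightarrow> card B \<le> card A"
    using ex_has_greatest_nat[of good "{s0}" card] by blast
  note A = gA[unfolded good_def]
  have fA: "finite A" using A fs by (meson Diff_subset finite_subset)
  have A_star: "A \<subseteq> star D w" using A by auto
  obtain s s' where ss: "s \<in> A" "s' \<in> star D w" "s' \<notin> A" "card (s \<inter> s') = 2"
    using linked_cross[OF star_linked A_star, of s0 t] A t by blast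
  have out: "?out A = {(s,s')}"
  proof -
    have "(s,s') \<in> ?out A" using ss by auto
    then show ?thesis using A card_seteq[OF fout[OF A_star], of "{(s,s')}"] by simp
  qed
  have "s' = t"
  proof (rule ccontr)
    assume "s' \<noteq> t"
    have "?out (insert s' A) \<subseteq> Pair s' ` (?N s' - {s})" using out ss(1) by auto
    then have "card (?out (insert s' A)) \<le> card (Pair s' ` (?N s' - {s}))"
      by (rule card_mono[rotated]) (use fs in auto)
    also have "\<dots> \<le> card (?N s' - {s})" by (rule card_image_le) (use fs in auto)
    also have "\<dots> = card (?N s') - 1" using ss A by (subst card_Diff_singleton) (auto simp: Int_commute)
    finally have "good (insert s' A)" using N2[OF ss(2)] A ss \<open>s' \<noteq> t\<close> by (auto simp: good_def)
    from mx[OF this] show False using ss fA by simp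
  qed
  obtain p q where pq: "t = {w,p,q}" "w \<noteq> p" "w \<noteq> q" "p \<noteq> q"
      "\<forall>r\<in>?N t. r \<inter> t = {w,p} \<or> r \<inter> t = {w,q}" using N[OF t] by blast
  have tD: "t \<in> D" using starD t by blast
  have "\<exists>Y\<in>star D w. Y \<noteq> t \<and> Y \<noteq> s \<and> card (Y \<inter> t) = 2"
  proof -
    obtain P where P: "P \<in> D" "P \<noteq> t" "{w,p} \<subseteq> P" "P \<inter> t = {w,p}"
      using shared_edge[OF tD, of "{w,p}"] nb[of p] pq by auto
    obtain Q where Q: "Q \<in> D" "Q \<noteq> t" "{w,q} \<subseteq> Q" "Q \<inter> t = {w,q}"
      using shared_edge[OF tD, of "{w,q}"] nb[of q] pq by auto
    have "P \<noteq> Q"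
    proof
      assume "P = Q"
      then have "{w,p} = {w,q}" using P(4) Q(4) by simp
      then show False using pq(2-4) by (auto simp: doubleton_eq_iff)
    qed
    moreover have "P \<in> star D w" "Q \<in> star D w" using P Q by (auto simp: star_def)
    moreover have "card (P \<inter> t) = 2" "card (Q \<inter> t) = 2" using P(4) Q(4) pq by auto
    ultimately show ?thesis using P Q by metis
  qed
  then obtain Y where Y: "Y \<in> star D w" "Y \<noteq> t" "Y \<noteq> s" "card (Y \<inter> t) = 2" by blast
  show thesis
  proof (rule that[of A s Y])
    show "card (s \<inter> t) = 2" using ss \<open>s' = t\<close> by simp
    have "Y \<notin> A"
    proof
      assume "Y \<in> A"
      then have "(Y,t) \<in> ?out A" using Y ss \<open>s' = t\<close> by auto
      with out Y show False by auto
    qed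
    then show "Y \<in> star D w - {t} - A" using Y by simp
    show "r' \<in> A" if "r \<in> A" "r' \<in> star D w - {t}" "card (r \<inter> r') = 2" for r r'
    proof (rule ccontr)
      assume "r' \<notin> A"
      then have "(r,r') \<in> ?out A" using that by auto
      with out \<open>s' = t\<close> that show False by auto
    qed
  qed (use A Y ss in auto)
qed

text \<open>The cochain consists of the edges that cross an arc running from the edge pq through t to w and
  around w on the side A. Its primitive f takes different values on the two sides of the arc.\<close>

lemma separation:
  assumes t: "t \<in> D" and e: "e \<subseteq> t" "boundary_edge D e" and nr: "\<not> removable D t"
  obtains B where "separates D B t"
proof -
  \<comment> \<open>Because of \<open>e\<close> only the last clause of \<open>removable\<close> can
    fail: \<open>w\<close> lies on the boundary, but no edge of \<open>t\<close> at \<open>w\<close>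
    is a boundary edge. So \<open>e\<close> is the side of \<open>t\<close> opposite to
    \<open>w\<close>.\<close>
  obtain w x0 where w: "w \<in> t" "\<And>x. x \<in> t \<Longrightarrow> \<not> boundary_edge D {w,x}" "boundary_edge D {w,x0}"
    using nr t e unfolding removable_def by blast
  have tw: "t \<in> star D w" using t w by (simp add: star_def)
  obtain A X Y where A: "A \<subseteq> star D w - {t}" and X: "X \<in> A" "card (X \<inter> t) = 2"
    and Y: "Y \<in> star D w - {t} - A" "card (Y \<inter> t) = 2"
    and cl: "\<And>s s'. s \<in> A \<Longrightarrow> s' \<in> star D w - {t} \<Longrightarrow> card (s \<inter> s') = 2 \<Longrightarrow> s' \<in> A"
    using star_split[OF tw w(2,3)] by metis
  have AD: "s \<in> D" "w \<in> s" "s \<noteq> t" if "s \<in> A" for s using that A by (auto simp: star_def)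
  have YD: "Y \<in> D" "w \<in> Y" "Y \<noteq> t" "Y \<notin> A" using Y by (auto simp: star_def)
  have e2: "card e = 2" using e(2) by (simp add: boundary_edge_def)
  have we: "w \<notin> e"
  proof
    assume "w \<in> e"
    then obtain x where "e = {w,x}" using card_2_obtain[OF e2] by blast
    then show False using w(2)[of x] e by auto
  qed
  have other: "\<exists>p. S \<inter> t = {w,p} \<and> p \<in> e" if S: "w \<in> S" "card (S \<inter> t) = 2" for S
  proof -
    obtain p q r where pqr: "t = {p,q,r}" "e = {p,q}" by (rule card3_edge[OF card3[OF t] e(1) e2])
    then have "w = r" using we w(1) by auto
    moreover obtain z where "z \<noteq> w" "S \<inter> t = {w,z}"
      using card_2_obtain[OF S(2), of w] S(1) w(1) by blast
    moreover have "z \<in> t" using calculation(3) by blast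
    ultimately have "z \<in> e" using pqr by auto
    with \<open>S \<inter> t = {w,z}\<close> show ?thesis by blast
  qed
  obtain p where p: "X \<inter> t = {w,p}" "p \<in> e" using other[OF AD(2)[OF X(1)] X(2)] by blast
  obtain q where q: "Y \<inter> t = {w,q}" "q \<in> e" using other[OF YD(2) Y(2)] by blast
  have wp: "w \<noteq> p" "w \<noteq> q" using p q we by auto
  have edge_at: "s \<inter> s' = {w,z}" if "s \<in> D" "s' \<in> D" "s \<noteq> s'" "w \<noteq> z" "{w,z} \<subseteq> s" "{w,z} \<subseteq> s'" for s s' z
    using card3_Int[of s s' "{w,z}"] card3 that by auto
  have pq: "p \<noteq> q"
  proof
    assume "p = q"
    then have "X = Y \<or> X = t \<or> Y = t"
      using edge_3[of "{w,p}" X Y t] p q wp AD[OF X(1)] YD t by auto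
    then show False using AD[OF X(1)] YD X by auto
  qed
  have epq: "e = {p,q}" 
  proof -
    obtain z where "e = {p,z}" by (rule card_2_obtain[OF e2 p(2)])
    with q(2) pq show ?thesis by auto
  qed
  have teq: "t = {w,p,q}"
  proof -
    have "{w,p,q} \<subseteq> t" using w(1) e(1) epq by auto
    moreover have "card {w,p,q} = 3" using wp pq by auto
    ultimately show ?thesis using card3[OF t] by (metis card.infinite card_subset_eq zero_neq_numeral)
  qed
  define c where "c = (\<lambda>e'. e' = e \<or> (w \<in> e' \<and> (\<exists>s\<in>A. e' \<subseteq> s)))"
  have c_sides: "c {w,x} \<longleftrightarrow> s \<in> A" if "s \<in> star D w" "s \<noteq> t" "x \<in> s" "x \<noteq> w" for s x
  proof
    assume "c {w,x}"
    then obtain s' where s': "s' \<in> A" "{w,x} \<subseteq> s'" using we unfolding c_def by auto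
    have sD: "s \<in> D" "w \<in> s" using that by (auto simp: star_def)
    show "s \<in> A"
    proof (cases "s' = s")
      case False
      have "s' \<inter> s = {w,x}" using edge_at[of s' s x] s' sD that False AD by auto
      then have "card (s' \<inter> s) = 2" using that by simp
      then show ?thesis using cl[OF s'(1)] that by auto
    qed (use s' in simp)
  next
    assume "s \<in> A"
    then show "c {w,x}" using that AD unfolding c_def by auto
  qed
  have c_away: "\<not> c e'" if "w \<notin> e'" "e' \<subseteq> s" "s \<in> D" "s \<noteq> t" for e' s
    using that boundary_edgeD[OF e(2), of s t] t e(1) unfolding c_def by auto
  have cp: "c {w,p}" using X p AD[OF X(1)] unfolding c_def by auto
  have cq: "\<not> c {w,q}"
    using c_sides[of Y q] Y YD q wp by auto
  have cpq: "c {p,q}" unfolding c_def epq by simp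
  have "even_cochain D c"
    unfolding even_cochain_def
  proof (intro allI impI)
    fix x y z assume xyz: "{x,y,z} \<in> D" "x \<noteq> y" "x \<noteq> z" "y \<noteq> z"
    consider "{x,y,z} = t" | "{x,y,z} \<noteq> t" "w \<in> {x,y,z}" | "{x,y,z} \<noteq> t" "w \<notin> {x,y,z}" by blast
    then have "even (cuts c {x,y,z})"
    proof cases
      case 1
      have "even (cuts c {w,p,q})" using cp cq cpq wp pq by (subst even_cuts_iff) auto
      then show ?thesis using 1 teq by simp
    next
      case 2
      obtain x' y' where xy': "{x,y,z} = {w,x',y'}" "w \<noteq> x'" "w \<noteq> y'" "x' \<noteq> y'"
      proof -
        consider "w = x" | "w = y" | "w = z" using 2(2) by blast
        then show thesis
        proof cases
          case 1 then show thesis using that[of y z] xyz by blast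
        next
          case 2 then show thesis using that[of x z] xyz by (metis insert_commute)
        next
          case 3 then show thesis using that[of x y] xyz by (metis insert_commute)
        qed
      qed
      have st: "{x,y,z} \<in> star D w" using xyz 2 by (simp add: star_def)
      have m: "x' \<in> {x,y,z}" "y' \<in> {x,y,z}" unfolding xy'(1) by simp_all
      have "c {w,x'} = c {w,y'}"
        using c_sides[OF st 2(1) m(1)] c_sides[OF st 2(1) m(2)] xy'(2,3) by simp
      moreover have "\<not> c {x',y'}"
        by (rule c_away[OF _ _ xyz(1) 2(1)]) (use m xy'(2,3) in auto)
      ultimately have "even (cuts c {w,x',y'})" using xy' by (subst even_cuts_iff) auto
      then show ?thesis using xy' by simp
    next
      case 3
      have "\<not> c {x,y}" "\<not> c {x,z}" "\<not> c {y,z}" using c_away[OF _ _ xyz(1) 3(1)] 3(2) by simp_all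
      then show ?thesis using xyz by (subst even_cuts_iff) auto
    qed
    then show "c {x,y} = (c {x,z} \<noteq> c {y,z})" using even_cuts_iff[OF xyz(2-4)] by simp
  qed
  from cohomology[OF this] obtain f :: "'a \<Rightarrow> bool"
    where "\<forall>t\<in>D. \<forall>x\<in>t. \<forall>y\<in>t. x \<noteq> y \<longrightarrow> c {x,y} = (f x \<noteq> f y)" by (rule exE)
  note f = this[rule_format]
  have const: "f x = f y" if "s \<in> D" "s \<noteq> t" "x \<in> s" "y \<in> s" "x \<noteq> w" "y \<noteq> w" for s x y
    using f[OF that(1,3,4)] c_away[of "{x,y}" s] that by (cases "x = y") auto
  have fpq: "f p \<noteq> f q" using f[OF t, of p q] cpq teq pq by auto
  \<comment> \<open>By \<open>const\<close>, \<open>f\<close> takes a single value on the vertices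
    other than \<open>w\<close> of each triangle other than \<open>t\<close>, and adjacent triangles
    share such a vertex. This value is therefore constant on components of \<open>D - {t}\<close>,
    and it differs at \<open>X\<close> and \<open>Y\<close>.\<close>
  define B where "B = {s\<in>D - {t}. \<exists>x\<in>s - {w}. f x = f p}"
  have "separates D B t" unfolding separates_def
  proof (intro conjI ballI impI)
    show "B \<subseteq> D - {t}" by (auto simp: B_def)
    have "X \<in> B" using AD[OF X(1)] p wp by (auto simp: B_def)
    then show "B \<noteq> {}" by blast
    have "Y \<notin> B" using const[OF YD(1,3), of q] q wp fpq by (auto simp: B_def)
    then show "B \<noteq> D - {t}" using YD by blast
    fix s s' assume s: "s \<in> B" "s' \<in> D - {t}" "card (s \<inter> s') = 2"
    have "\<not> s \<inter> s' \<subseteq> {w}"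
    proof
      assume "s \<inter> s' \<subseteq> {w}"
      then have "card (s \<inter> s') \<le> card {w}" by (rule card_mono[rotated]) simp
      with s show False by simp
    qed
    then obtain x where x: "x \<in> s" "x \<in> s'" "x \<noteq> w" by blast
    obtain x' where "x' \<in> s" "x' \<noteq> w" "f x' = f p" using s by (auto simp: B_def)
    then have "f x = f p" using const[of s x x'] x s by (auto simp: B_def)
    then show "s' \<in> B" using x s by (auto simp: B_def)
  qed
  then show thesis by (rule that)
qed

text \<open>\<open>B\<close> has a triangle \<open>X\<close> adjacent to \<open>t\<close>,
  necessarily across an edge at \<open>w\<close>, as the opposite side \<open>e\<close> is a
  boundary edge. If \<open>B\<close> had no boundary edge, \<open>star_parity\<close> would put all
  neighbours of \<open>t\<close> at \<open>w\<close> into \<open>B\<close>. The rest of the star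
  would then be cut off from \<open>t\<close>, so connectedness of the star forces \<open>s0\<close>
  into \<open>B\<close>; but \<open>s0\<close> carries the boundary edge
  \<open>{w,x0}\<close>.\<close>

lemma separates_boundary:
  assumes t: "t \<in> D" and e: "e \<subseteq> t" "boundary_edge D e" and nr: "\<not> removable D t"
    and B: "separates D B t"
  obtains s e' where "s \<in> B" "e' \<subseteq> s" "boundary_edge D e'"
proof -
  obtain w x0 where w: "w \<in> t" "\<And>x. x \<in> t \<Longrightarrow> \<not> boundary_edge D {w,x}" "boundary_edge D {w,x0}"
    using nr t e unfolding removable_def by blast
  note B' = B[unfolded separates_def]
  obtain b where b: "b \<in> B" using B' by blast
  obtain X s' where X: "X \<in> B" "s' \<in> D" "s' \<notin> B" "card (X \<inter> s') = 2"
    using linked_cross[OF linked _ b t] B' by blast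
  then have [simp]: "s' = t" using B' by blast
  have "w \<in> X"
  proof (rule ccontr)
    assume "w \<notin> X"
    have "e \<subseteq> X"
    proof -
      have e2: "card e = 2" using e(2) by (simp add: boundary_edge_def)
      obtain p q r where pqr: "t = {p,q,r}" "e = {p,q}" by (rule card3_edge[OF card3[OF t] e(1) e2])
      have "w \<noteq> p" "w \<noteq> q"
        using w(2)[of p] w(2)[of q] e(2) pqr by (auto simp: insert_commute)
      then have "w = r" using w(1) pqr by auto
      then have "X \<inter> t \<subseteq> e" using \<open>w \<notin> X\<close> pqr by auto
      moreover have "finite e" using e2 card.infinite by fastforce
      ultimately have "X \<inter> t = e" using X e2 by (metis \<open>s' = t\<close> card_subset_eq)
      then show ?thesis by blast
    qed
    then have "X = t" using boundary_edgeD[OF e(2), of X t] X B' t e by auto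
    then show False using X B' by auto
  qed
  have tw: "t \<in> star D w" using t w by (simp add: star_def)
  show thesis
  proof (rule ccontr)
    assume "\<not> thesis"
    with that have nb: "\<not> boundary_edge D e'" if "s \<in> B" "e' \<subseteq> s" for s e' using that by blast
    have Xw: "X \<in> star D w" using X B' \<open>w \<in> X\<close> by (auto simp: star_def)
    have nbrs: "Y \<in> B" if Y: "Y \<in> star D w - {t}" "card (Y \<inter> t) = 2" for Y
    proof -
      have "Y \<in> B \<inter> star D w"
      proof (rule star_parity[OF tw])
        show "X \<in> B \<inter> star D w" "card (X \<inter> t) = 2" using X Xw by auto
        show "\<not> boundary_edge D {w,x}" if "s \<in> B \<inter> star D w" "x \<in> s" for s x
          using that by (intro nb[of s]) (auto simp: star_def)
      qed (use B' Y in \<open>auto simp: star_def\<close>)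
      then show ?thesis by blast
    qed
    obtain s0 where s0: "s0 \<in> D" "{w,x0} \<subseteq> s0" using w(3) unfolding boundary_edge_def by auto
    have s0w: "s0 \<in> star D w - {t}" using s0 w by (auto simp: star_def)
    have "s0 \<in> B"
    proof (rule ccontr)
      assume "s0 \<notin> B"
      have "star D w - {t} - B = star D w"
      proof (rule linkedD[OF star_linked])
        show "s0 \<in> star D w - {t} - B" using s0w \<open>s0 \<notin> B\<close> by simp
        fix s s' assume s: "s \<in> star D w - {t} - B" "s' \<in> star D w" "card (s \<inter> s') = 2"
        have "s' \<noteq> t" using nbrs[of s] s by auto
        moreover have "s' \<notin> B" using s B' by (auto simp: star_def Int_commute)
        ultimately show "s' \<in> star D w - {t} - B" using s by simp
      qed blast
      then show False using tw by blast
    qed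
    then show False using nb[OF _ s0(2)] w(3) by blast
  qed
qed

lemma exists_removable:
  assumes "D \<noteq> {}"
  obtains t where "removable D t"
proof (cases "\<exists>e. boundary_edge D e")
  case False
  then show ?thesis using assms that unfolding removable_def by blast
next
  case True
  show ?thesis
  proof (rule ccontr)
    assume "\<not> thesis"
    with that have nr: "\<not> removable D t" for t by blast
    let ?P = "\<lambda>n. \<exists>t e B. t \<in> D \<and> e \<subseteq> t \<and> boundary_edge D e \<and> separates D B t \<and> card B = n"
    obtain t0 e0 where "t0 \<in> D" "e0 \<subseteq> t0" "boundary_edge D e0"
      using True unfolding boundary_edge_def by blast
    with separation[OF this nr] have "\<exists>n. ?P n" by metis
    then have "?P (LEAST n. ?P n)" by (rule LeastI_ex)
    then obtain t e B where t: "t \<in> D" "e \<subseteq> t" "boundary_edge D e" and B: "separates D B t"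
      and cB: "card B = (LEAST n. ?P n)" by blast
    have mn: "card B \<le> card B'" if "t' \<in> D" "e' \<subseteq> t'" "boundary_edge D e'" "separates D B' t'" for t' e' B'
      unfolding cB by (rule Least_le) (use that in blast)
    note B' = B[unfolded separates_def]
    obtain s e' where s: "s \<in> B" "e' \<subseteq> s" "boundary_edge D e'"
      by (rule separates_boundary[OF t nr B])
    have sD: "s \<in> D" "s \<noteq> t" using s B' by auto
    obtain C0 where C0: "separates D C0 s" using separation[OF sD(1) s(2,3) nr] by blast
    \<comment> \<open>\<open>C\<close> is the side of \<open>s\<close> that avoids \<open>t\<close>.
      Hence triangles of \<open>C\<close> lie in \<open>D - {t}\<close>, where \<open>B\<close> is
      closed under adjacency: this makes the intersection of \<open>B\<close> and \<open>C\<close>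
      closed, and it contains the neighbours of \<open>s\<close> in \<open>C\<close>. It is smaller
      than \<open>B\<close> because it misses \<open>s\<close>.\<close>
    obtain C where C: "separates D C s" "t \<notin> C"
    proof (cases "t \<in> C0")
      case True
      then show thesis using that[OF separates_complement[OF C0]] by blast
    next
      case False then show thesis using that C0 by blast
    qed
    note C' = C(1)[unfolded separates_def]
    have "separates D (B \<inter> C) s" unfolding separates_def
    proof (intro conjI ballI impI)
      show "B \<inter> C \<subseteq> D - {s}" using C' by blast
      show "B \<inter> C \<noteq> D - {s}" using C(2) t(1) sD by blast
      obtain c where "c \<in> C" using C' by blast
      then obtain x y where xy: "x \<in> C" "y \<in> D" "y \<notin> C" "card (x \<inter> y) = 2"
        using linked_cross[OF linked, of C c s] C' sD by blast
      then have "y = s" using C' by blast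
      with xy have "card (s \<inter> x) = 2" by (simp add: Int_commute)
      moreover have "x \<in> D - {t}" using xy C' C(2) by blast
      ultimately have "x \<in> B" using B' s(1) by blast
      then show "B \<inter> C \<noteq> {}" using xy(1) by blast
      fix u v assume uv: "u \<in> B \<inter> C" "v \<in> D - {s}" "card (u \<inter> v) = 2"
      then have "v \<in> C" using C' by blast
      moreover have "v \<in> D - {t}" using uv \<open>v \<in> C\<close> C(2) by blast
      ultimately show "v \<in> B \<inter> C" using B' uv by blast
    qed
    then have "card B \<le> card (B \<inter> C)" using mn[OF sD(1) s(2,3)] by blast
    moreover have "finite B" using B' finite_D by (meson finite_Diff finite_subset)
    moreover have "B \<inter> C \<subset> B" using s C' by blast
    ultimately show False by (meson psubset_card_mono not_le)
  qed
qed

end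

section \<open>Attaching orders\<close>

text \<open>The shelling condition in terms of vertex sets: faces with \<open>k\<close> vertices are
  the facets, there is at least one along which \<open>t\<close> is attached, and every other
  intersection lies inside such a facet.\<close>

definition attachable :: "nat \<Rightarrow> 'a set set \<Rightarrow> 'a set \<Rightarrow> bool" where
  "attachable k A t \<longleftrightarrow> (\<exists>s\<in>A. card (s \<inter> t) = k) \<and>
     (\<forall>s\<in>A. \<exists>s'\<in>A. card (s' \<inter> t) = k \<and> s \<inter> t \<subseteq> s' \<inter> t)"

definition attaching_order :: "nat \<Rightarrow> 'a set list \<Rightarrow> bool" where
  "attaching_order k ts \<longleftrightarrow> distinct ts \<and>
     (\<forall>m. 1 \<le> m \<and> m < length ts \<longrightarrow> attachable k (set (take m ts)) (ts ! m))"

lemma attaching_order_snoc: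
  assumes "attaching_order k ts" "t \<notin> set ts" "ts \<noteq> [] \<Longrightarrow> attachable k (set ts) t"
  shows "attaching_order k (ts @ [t])"
  unfolding attaching_order_def
proof (intro conjI allI impI)
  show "distinct (ts @ [t])" using assms by (simp add: attaching_order_def)
  fix m assume m: "1 \<le> m \<and> m < length (ts @ [t])"
  show "attachable k (set (take m (ts @ [t]))) ((ts @ [t]) ! m)"
  proof (cases "m < length ts")
    case True
    then show ?thesis using assms(1) m by (simp add: attaching_order_def nth_append)
  next
    case False
    then have "m = length ts" using m by simp
    moreover from this have "ts \<noteq> []" using m by auto
    ultimately show ?thesis using assms(3) by simp
  qed
qed

text \<open>The critical case is an intersection in a single vertex \<open>x\<close>: the star of
  \<open>x\<close> is connected, so \<open>t\<close> has a neighbour across an edge at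
  \<open>x\<close>.\<close>

lemma (in simply_connected_surface) attachable_last:
  assumes t: "t \<in> D" and ne: "D - {t} \<noteq> {}"
  shows "attachable 2 (D - {t}) t"
proof -
  have nbr: "\<exists>s\<in>E - {t}. card (s \<inter> t) = 2" if E: "linked 2 E" "t \<in> E" "r \<in> E" "r \<noteq> t" for E r
  proof -
    obtain x y where xy: "x \<in> {t}" "y \<in> E" "y \<notin> {t}" "card (x \<inter> y) = 2"
      using linked_cross[OF E(1), of "{t}" t r] E by blast
    then show ?thesis by (auto simp: Int_commute)
  qed
  obtain r where "r \<in> D" "r \<noteq> t" using ne by blast
  then obtain s0 where s0: "s0 \<in> D - {t}" "card (s0 \<inter> t) = 2" using nbr[OF linked t] by blast
  have "\<exists>s'\<in>D - {t}. card (s' \<inter> t) = 2 \<and> s \<inter> t \<subseteq> s' \<inter> t" if s: "s \<in> D - {t}" for s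
  proof -
    have ft: "finite t" using card3[OF t] card.infinite by fastforce
    have "card (s \<inter> t) \<noteq> 3"
    proof
      assume c: "card (s \<inter> t) = 3"
      have "finite s" using card3[of s] s card.infinite by fastforce
      have "s \<inter> t = s" by (rule card_subset_eq) (use \<open>finite s\<close> c card3[of s] s in auto)
      moreover have "s \<inter> t = t" by (rule card_subset_eq) (use ft c card3[OF t] in auto)
      ultimately have "s = t" by simp
      then show False using s by auto
    qed
    moreover have "card (s \<inter> t) \<le> 3" using card3[OF t] ft by (metis card_mono Int_lower2)
    ultimately consider "card (s \<inter> t) = 0" | "card (s \<inter> t) = 1" | "card (s \<inter> t) = 2" by linarith
    then show ?thesis
    proof cases
      case 1
      then have "s \<inter> t = {}" using ft by simp
      then show ?thesis using s0 by blast
    next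
      case 2
      then obtain x where x: "s \<inter> t = {x}" by (meson card_1_singletonE)
      then have "\<exists>s'\<in>star D x - {t}. card (s' \<inter> t) = 2"
        using s t by (intro nbr[where r=s] star_linked) (auto simp: star_def)
      then show ?thesis using x by (auto simp: star_def)
    next
      case 3
      then show ?thesis using s by blast
    qed
  qed
  with s0 show ?thesis unfolding attachable_def by blast
qed

theorem surface_attaching_order:
  assumes "simply_connected_surface D"
  shows "\<exists>ts. set ts = D \<and> attaching_order 2 ts"
  using assms
proof (induction "card D" arbitrary: D)
  case 0
  then interpret simply_connected_surface D by simp
  have "D = {}" using 0 finite_D by simp
  then show ?case by (intro exI[of _ "[]"]) (simp add: attaching_order_def)
next
  case (Suc n)
  then interpret simply_connected_surface D by simp
  have "D \<noteq> {}" using Suc by auto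
  then obtain t where t: "removable D t" using exists_removable by blast
  then have tD: "t \<in> D" by (simp add: removable_def)
  obtain ts where ts: "set ts = D - {t}" "attaching_order 2 ts"
  proof -
    have "n = card (D - {t})" using Suc.hyps(2) tD finite_D by simp
    from Suc.hyps(1)[OF this surface_remove[OF t]] show thesis using that by blast
  qed
  have "attaching_order 2 (ts @ [t])"
  proof (rule attaching_order_snoc[OF ts(2)])
    show "attachable 2 (set ts) t" if "ts \<noteq> []"
      unfolding ts(1) using that ts(1) by (intro attachable_last[OF tD]) (metis set_empty)
  qed (use ts in simp)
  moreover have "set (ts @ [t]) = D" using ts tD by auto
  ultimately show ?case by blast
qed

subsection \<open>Barycentric coordinates in a simplicial complex\<close>

text \<open>Relative to another vertex \<open>a\<close>, the differences \<open>c - a\<close> are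
  linearly independent, so a linear functional can be 1 at \<open>w - a\<close> and 0 at the others.
  For a single vertex the coordinate is the constant 1.\<close>

lemma barycentric_functional:
  fixes C :: "'a::euclidean_space set"
  assumes C: "\<not> affine_dependent C" and w: "w \<in> C"
  obtains f :: "'a \<Rightarrow> real" where "continuous_on UNIV f"
    "\<And>u. sum u C = 1 \<Longrightarrow> f (\<Sum>c\<in>C. u c *\<^sub>R c) = u w"
proof (cases "C = {w}")
  case True
  show thesis by (rule that[of "\<lambda>_. 1"]) (auto simp: True)
next
  case False
  then obtain a where a: "a \<in> C" "a \<noteq> w" using w by blast
  have fin: "finite C" using C aff_independent_finite by blast
  let ?B = "(\<lambda>x. -a + x) ` (C - {a})"
  have "independent ?B" using C affine_dependent_iff_dependent2[OF a(1)] by blast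
  then obtain g where g: "linear g" "\<And>x. x \<in> ?B \<Longrightarrow> g x = (if x = -a + w then 1 else (0::real))"
    using linear_independent_extend[of ?B "\<lambda>x. if x = -a + w then 1 else (0::real)"] by blast
  have gc: "g (c - a) = (if c = w then 1 else 0)" if "c \<in> C" for c
    using g(2)[of "-a + c"] that a linear_0[OF g(1)] by (cases "c = a") auto
  show thesis
  proof (rule that[of "\<lambda>y. g (y - a)"])
    show "continuous_on UNIV (\<lambda>y. g (y - a))"
      by (intro continuous_on_compose2[OF linear_continuous_on[OF linear_conv_bounded_linear[THEN iffD1, OF g(1)], of UNIV]]
          continuous_intros) auto
    fix u :: "'a \<Rightarrow> real" assume u: "sum u C = 1"
    have "(\<Sum>c\<in>C. u c *\<^sub>R c) - a = (\<Sum>c\<in>C. u c *\<^sub>R (c - a))"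
      using u by (simp add: scaleR_diff_right sum_subtractf flip: scaleR_left.sum)
    then have "g ((\<Sum>c\<in>C. u c *\<^sub>R c) - a) = (\<Sum>c\<in>C. u c * g (c - a))"
      using g(1) by (simp add: linear_sum linear_scale)
    also have "\<dots> = (\<Sum>c\<in>C. if c = w then u c else 0)" by (rule sum.cong) (auto simp: gc)
    also have "\<dots> = u w" using w fin by simp
    finally show "g ((\<Sum>c\<in>C. u c *\<^sub>R c) - a) = u w" .
  qed
qed

lemma barycentric_unique:
  fixes C :: "'a::euclidean_space set"
  assumes "\<not> affine_dependent C" "sum u C = 1" "sum v C = 1"
    "(\<Sum>c\<in>C. u c *\<^sub>R c) = (\<Sum>c\<in>C. v c *\<^sub>R c)" "w \<in> C"
  shows "u w = v w"
proof -
  obtain f :: "'a \<Rightarrow> real" where "\<And>u. sum u C = 1 \<Longrightarrow> f (\<Sum>c\<in>C. u c *\<^sub>R c) = u w"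
    using barycentric_functional[OF assms(1,5)] by blast
  from this[of u] this[of v] show ?thesis using assms by simp
qed

definition barycentric :: "'a::euclidean_space set \<Rightarrow> 'a \<Rightarrow> 'a \<Rightarrow> real" where
  "barycentric C y = (SOME u. (\<forall>c\<in>C. 0 \<le> u c) \<and> sum u C = 1 \<and> (\<Sum>c\<in>C. u c *\<^sub>R c) = y)"

lemma barycentric:
  assumes "finite C" "y \<in> convex hull C"
  shows "\<And>c. c \<in> C \<Longrightarrow> 0 \<le> barycentric C y c" "sum (barycentric C y) C = 1"
    "(\<Sum>c\<in>C. barycentric C y c *\<^sub>R c) = y"
proof -
  have "\<exists>u. (\<forall>c\<in>C. 0 \<le> u c) \<and> sum u C = 1 \<and> (\<Sum>c\<in>C. u c *\<^sub>R c) = y"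
    using assms by (simp add: convex_hull_finite)
  from someI_ex[OF this] show "\<And>c. c \<in> C \<Longrightarrow> 0 \<le> barycentric C y c"
    "sum (barycentric C y) C = 1" "(\<Sum>c\<in>C. barycentric C y c *\<^sub>R c) = y"
    unfolding barycentric_def by blast+
qed

text \<open>A complex is represented by the vertex sets of its top simplices. The instances are the
  tetrahedra of a triangulation and, in \<open>homeomorphic_facets\<close>, a single
  simplex.\<close>

locale simplicial_family =
  fixes \<K> :: "'a::euclidean_space set set"
  assumes finite_K: "finite \<K>"
    and independent: "C \<in> \<K> \<Longrightarrow> \<not> affine_dependent C"
    and hull_Int: "C \<in> \<K> \<Longrightarrow> C' \<in> \<K> \<Longrightarrow> convex hull C \<inter> convex hull C' = convex hull (C \<inter> C')"
begin

definition body :: "'a set" where "body = (\<Union>C\<in>\<K>. convex hull C)"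

definition carrier_simplex :: "'a \<Rightarrow> 'a set" where
  "carrier_simplex y = (SOME C. C \<in> \<K> \<and> y \<in> convex hull C)"

text \<open>The piecewise linear hat function of the vertex \<open>w\<close>, extended by 0 to the
  simplices without \<open>w\<close>. The carrier is an arbitrary choice; \<open>coord_eq\<close>
  shows that it does not matter.\<close>

definition coord :: "'a \<Rightarrow> 'a \<Rightarrow> real" where
  "coord w y = (if w \<in> carrier_simplex y then barycentric (carrier_simplex y) y w else 0)"

lemma finite_C: "C \<in> \<K> \<Longrightarrow> finite C"
  using independent aff_independent_finite by blast

text \<open>A point of two simplices lies in the hull of their common vertices. Its coordinates
  there, extended by 0, are coordinates in both simplices, and these are unique.\<close>

lemma coord_eq:
  assumes C: "C \<in> \<K>" and u: "\<And>c. c \<in> C \<Longrightarrow> 0 \<le> u c" "sum u C = 1"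
  shows "coord w (\<Sum>c\<in>C. u c *\<^sub>R c) = (if w \<in> C then u w else 0)"
proof -
  define y where "y = (\<Sum>c\<in>C. u c *\<^sub>R c)"
  have yC: "y \<in> convex hull C"
    using u finite_C[OF C] by (auto simp: convex_hull_finite y_def)
  then have "\<exists>C. C \<in> \<K> \<and> y \<in> convex hull C" using C by blast
  from someI_ex[OF this] obtain C0 where C0: "C0 = carrier_simplex y" "C0 \<in> \<K>" "y \<in> convex hull C0"
    unfolding carrier_simplex_def by blast
  define I where "I = C \<inter> C0"
  have fin: "finite C" "finite C0" "finite I" using finite_C C C0 by (auto simp: I_def)
  have "y \<in> convex hull I" using hull_Int[OF C C0(2)] yC C0(3) unfolding I_def by blast
  note v = barycentric[OF fin(3) this]
  define v' where "v' = (\<lambda>c. if c \<in> I then barycentric I y c else 0)"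
  have ext: "sum v' E = 1" "(\<Sum>c\<in>E. v' c *\<^sub>R c) = y" if "I \<subseteq> E" "finite E" for E
  proof -
    have "sum v' E = sum v' I" by (rule sum.mono_neutral_right) (use that in \<open>auto simp: v'_def\<close>)
    then show "sum v' E = 1" using v by (simp add: v'_def)
    have "(\<Sum>c\<in>E. v' c *\<^sub>R c) = (\<Sum>c\<in>I. v' c *\<^sub>R c)"
      by (rule sum.mono_neutral_right) (use that in \<open>auto simp: v'_def\<close>)
    then show "(\<Sum>c\<in>E. v' c *\<^sub>R c) = y" using v by (simp add: v'_def)
  qed
  have 1: "u w = v' w" if "w \<in> C"
    using barycentric_unique[OF independent[OF C] u(2), of v' w] ext[of C] that fin by (simp add: I_def y_def)
  have 2: "barycentric C0 y w = v' w" if "w \<in> C0"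
    using barycentric_unique[OF independent[OF C0(2)] barycentric(2)[OF fin(2) C0(3)], of v' w]
      ext[of C0] that fin barycentric(3)[OF fin(2) C0(3)] by (simp add: I_def)
  show ?thesis
    using 1 2 unfolding y_def[symmetric] coord_def C0(1)[symmetric] by (auto simp: v'_def I_def)
qed

lemma coord_hull:
  assumes "C \<in> \<K>" "y \<in> convex hull C"
  shows "\<And>w. 0 \<le> coord w y" "(\<Sum>c\<in>C. coord c y) = 1" "(\<Sum>c\<in>C. coord c y *\<^sub>R c) = y"
    "\<And>w. w \<notin> C \<Longrightarrow> coord w y = 0"
proof -
  note b = barycentric[OF finite_C[OF assms(1)] assms(2)]
  have eq: "coord w y = (if w \<in> C then barycentric C y w else 0)" for w
    using coord_eq[OF assms(1), of "barycentric C y" w] b by simp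
  show "\<And>w. 0 \<le> coord w y" "(\<Sum>c\<in>C. coord c y) = 1" "(\<Sum>c\<in>C. coord c y *\<^sub>R c) = y"
    "\<And>w. w \<notin> C \<Longrightarrow> coord w y = 0" using b by (auto simp: eq)
qed

lemma hull_mono_coord:
  assumes "C \<in> \<K>" "y \<in> convex hull C" "E \<subseteq> C" "\<And>w. w \<in> C - E \<Longrightarrow> coord w y = 0"
  shows "y \<in> convex hull E"
proof -
  note c = coord_hull[OF assms(1,2)]
  have fin: "finite C" using finite_C assms by blast
  have "(\<Sum>c\<in>E. coord c y) = 1" "(\<Sum>c\<in>E. coord c y *\<^sub>R c) = y"
    using c(2,3) sum.mono_neutral_left[OF fin assms(3), of "\<lambda>c. coord c y"]
      sum.mono_neutral_left[OF fin assms(3), of "\<lambda>c. coord c y *\<^sub>R c"] assms(4) by simp_all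
  moreover have "finite E" using fin assms finite_subset by blast
  ultimately show ?thesis
    using c(1) by (simp add: convex_hull_finite, intro exI[of _ "\<lambda>c. coord c y"]) simp
qed

text \<open>Pasting over finitely many closed simplices, on each of which the coordinate is zero or
  agrees with a continuous functional.\<close>

lemma continuous_coord: "continuous_on body (coord w)"
  unfolding body_def
proof (rule continuous_on_closed_Union)
  show "finite \<K>" by (rule finite_K)
  fix C assume C: "C \<in> \<K>"
  show "closed (convex hull C)"
    using finite_C[OF C] by (simp add: compact_imp_closed finite_imp_compact_convex_hull)
  show "continuous_on (convex hull C) (coord w)"
  proof (cases "w \<in> C")
    case True
    obtain f :: "'a \<Rightarrow> real" where f: "continuous_on UNIV f"
      "\<And>u. sum u C = 1 \<Longrightarrow> f (\<Sum>c\<in>C. u c *\<^sub>R c) = u w"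
      using barycentric_functional[OF independent[OF C] True] by blast
    have "coord w y = f y" if "y \<in> convex hull C" for y
      using f(2)[of "\<lambda>c. coord c y"] coord_hull[OF C that] by simp
    then show ?thesis using continuous_on_subset[OF f(1)] by (metis continuous_on_cong subset_UNIV)
  next
    case False
    then have "coord w y = 0" if "y \<in> convex hull C" for y using coord_hull(4)[OF C that] by blast
    then show ?thesis by (simp cong: continuous_on_cong)
  qed
qed

lemma hull_body: "C \<in> \<K> \<Longrightarrow> convex hull C \<subseteq> body"
  by (auto simp: body_def)

lemma local_simplices:
  assumes "x \<in> body"
  obtains N where "open N" "x \<in> N" "\<And>y C. y \<in> N \<Longrightarrow> C \<in> \<K> \<Longrightarrow> y \<in> convex hull C \<Longrightarrow> x \<in> convex hull C"
proof -
  let ?F = "\<Union>((\<lambda>C. convex hull C) ` {C\<in>\<K>. x \<notin> convex hull C})"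
  show thesis
  proof (rule that[of "- ?F"])
    show "open (- ?F)"
      using finite_K finite_C
      by (intro open_Compl closed_Union) (auto intro!: compact_imp_closed finite_imp_compact_convex_hull)
  qed auto
qed

end

subsection \<open>Charts and double covers\<close>

text \<open>Transports the model space, whose points are functions on \<open>nat\<close>, to a
  Euclidean space type, where convexity, \<open>aff_dim\<close> and invariance of domain
  apply.\<close>

definition of_triple :: "real \<times> real \<times> real \<Rightarrow> nat \<Rightarrow> real" where
  "of_triple p = (\<lambda>i. if i = 0 then fst p else if i = 1 then fst (snd p) else if i = 2 then snd (snd p) else 0)"

lemma continuous_on_of_triple: "continuous_on S of_triple"
proof (rule continuous_on_coordinatewise_then_product)
  fix i :: nat
  show "continuous_on S (\<lambda>p. of_triple p i)"
    unfolding of_triple_def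
    by (cases "i = 0"; cases "i = 1"; cases "i = 2") (auto intro!: continuous_intros)
qed

lemma Euclidean_space_top_of_set: "Euclidean_space n = top_of_set {y. \<forall>i\<ge>n. y i = 0}"
  by (simp add: Euclidean_space_def euclidean_product_topology)

lemma homeomorphism_if_homeomorphic_space:
  assumes "top_of_set S homeomorphic_space top_of_set T"
  obtains f g where "homeomorphism S T f g"
proof -
  obtain f g where fg: "continuous_map (top_of_set S) (top_of_set T) f"
    "continuous_map (top_of_set T) (top_of_set S) g"
    "\<forall>x\<in>S. g (f x) = x" "\<forall>y\<in>T. f (g y) = y"
    using assms unfolding homeomorphic_space_def homeomorphic_maps_def by auto
  then have "continuous_on S f" "f ` S \<subseteq> T" "continuous_on T g" "g ` T \<subseteq> S"
    by (auto simp: continuous_map_subtopology_eu image_subset_iff_funcset)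
  with fg(3,4) show thesis by (intro that[of f g] homeomorphismI) auto
qed

text \<open>Cutting the image of a chart down to a ball intersected with the half-space makes it
  convex and three-dimensional, no matter whether \<open>x\<close> is an interior or a boundary
  point.\<close>

lemma manifold_chart:
  fixes M :: "'a::euclidean_space set"
  assumes M: "manifold_with_boundary 3 (top_of_set M)" and x: "x \<in> M" and N: "open N" "x \<in> N"
  obtains U and W :: "(real \<times> real \<times> real) set" and f g
  where "openin (top_of_set M) U" "x \<in> U" "U \<subseteq> N" "homeomorphism U W f g" "convex W" "aff_dim W = 3"
proof -
  let ?E = "{y::nat \<Rightarrow> real. \<forall>i\<ge>3. y i = 0}"
  let ?H = "{p::real \<times> real \<times> real. 0 \<le> fst p}"
  obtain U0 V where U0: "openin (top_of_set M) U0" "x \<in> U0"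
    and V: "openin (subtopology (Euclidean_space 3) {y. 0 \<le> y 0}) V"
    and UV: "subtopology (top_of_set M) U0 homeomorphic_space subtopology (Euclidean_space 3) V"
    using M x unfolding manifold_with_boundary_def by (metis topspace_euclidean_subtopology)
  obtain T where T: "open T" "V = ?E \<inter> {y. 0 \<le> y 0} \<inter> T"
    using V by (auto simp: Euclidean_space_top_of_set subtopology_subtopology openin_open)
  have "M \<inter> U0 = U0" "?E \<inter> V = V" using U0 T by (auto dest: openin_imp_subset)
  then have "top_of_set U0 homeomorphic_space top_of_set V"
    using UV by (simp add: Euclidean_space_top_of_set subtopology_subtopology)
  then obtain h k where hk: "homeomorphism U0 V h k" by (rule homeomorphism_if_homeomorphic_space)
  define e where "e = (\<lambda>y::nat \<Rightarrow> real. (y 0, y 1, y 2))"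
  have ce: "continuous_on S e" for S
    unfolding e_def by (intro continuous_on_Pair continuous_on_subset[OF continuous_on_product_coordinates]) auto
  have de: "of_triple (e y) = y" if "y \<in> ?E" for y
  proof
    fix i show "of_triple (e y) i = y i"
      using that by (cases "i < 3") (auto simp: of_triple_def e_def less_Suc_eq numeral_eq_Suc)
  qed
  have ed: "e (of_triple p) = p" for p by (simp add: e_def of_triple_def)
  have dE: "of_triple p \<in> ?E" for p by (auto simp: of_triple_def)
  have eV: "e ` V = ?H \<inter> of_triple -` T"
  proof
    show "e ` V \<subseteq> ?H \<inter> of_triple -` T" using de T(2) by (auto simp: e_def)
    show "?H \<inter> of_triple -` T \<subseteq> e ` V"
    proof
      fix p assume "p \<in> ?H \<inter> of_triple -` T"
      then have "of_triple p \<in> V" using dE[of p] by (auto simp: T(2) of_triple_def)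
      then show "p \<in> e ` V" by (metis ed imageI)
    qed
  qed
  have "homeomorphism V (e ` V) e of_triple"
    unfolding homeomorphism_def using ce de ed T(2) continuous_on_of_triple
    by (auto simp: image_iff)
  from homeomorphism_compose[OF hk this]
  have \<phi>: "homeomorphism U0 (e ` V) (e \<circ> h) (k \<circ> of_triple)" (is "homeomorphism _ _ ?f ?g") .
  have "openin (top_of_set (e ` V)) (?f ` (U0 \<inter> N))"
    by (rule homeomorphism_imp_open_map[OF \<phi>]) (simp add: N openin_open_Int)
  then obtain T2 where T2: "open T2" "?f ` (U0 \<inter> N) = e ` V \<inter> T2" by (auto simp: openin_open)
  define Q where "Q = of_triple -` T \<inter> T2"
  have "open Q" unfolding Q_def
    using T T2 continuous_on_of_triple[of UNIV] by (auto intro!: open_Int open_vimage)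
  moreover have fU: "?f ` (U0 \<inter> N) = ?H \<inter> Q" using T2 eV by (auto simp: Q_def)
  moreover have fx: "?f x \<in> ?f ` (U0 \<inter> N)" using U0 N by blast
  ultimately obtain r where r: "0 < r" "ball (?f x) r \<subseteq> Q" by (metis IntE openE)
  define W where "W = ?H \<inter> ball (?f x) r"
  define U where "U = (U0 \<inter> ?f -` ball (?f x) r) \<inter> N"
  have fU': "?f ` (U0 \<inter> N) \<inter> ball (?f x) r = W" using fU r by (auto simp: W_def)
  have img: "?f ` U = W"
    unfolding U_def fU'[symmetric] by auto
  show thesis
  proof (rule that[of U W ?f ?g])
    have "openin (top_of_set U0) (U0 \<inter> ?f -` ball (?f x) r)"
      using \<phi> by (intro continuous_openin_preimage_gen) (auto simp: homeomorphism_def)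
    then have "openin (top_of_set U0) U"
      unfolding U_def using N(1) by (metis Int_commute openin_Int_open)
    then show "openin (top_of_set M) U" using U0(1) openin_trans by blast
    show "x \<in> U" using U0 N r by (simp add: U_def)
    show "U \<subseteq> N" by (auto simp: U_def)
    have "W \<subseteq> e ` V" using fU' T2 by blast
    then show "homeomorphism U W ?f ?g"
      by (rule homeomorphism_of_subsets[OF \<phi> _ _ img, rotated]) (auto simp: U_def)
    have "convex ?H" by (rule convexI) auto
    then show "convex W" unfolding W_def by (simp add: convex_Int)
    have "open {p::real \<times> real \<times> real. 0 < fst p}"
      by (intro open_Collect_less continuous_intros)
    then have "open ({p. 0 < fst p} \<inter> ball (?f x) r)" by auto
    moreover have "{p. 0 < fst p} \<inter> ball (?f x) r \<subseteq> W" by (auto simp: W_def)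
    \<comment> \<open>Even if the centre is on the boundary plane, moving it by half the radius in
      the first coordinate gives an interior point of \<open>W\<close>.\<close>
    moreover have "?f x + (r/2, 0, 0) \<in> {p. 0 < fst p} \<inter> ball (?f x) r"
    proof -
      have "?f x \<in> ?H" using fx fU by blast
      moreover have "dist (?f x) (?f x + (r/2,0,0)) = r/2"
        using r by (simp add: dist_norm norm_prod_def)
      ultimately show ?thesis using r by (auto simp: mem_ball)
    qed
    ultimately have "interior W \<noteq> {}" by (metis empty_iff interior_maximal subsetD)
    then show "aff_dim W = 3" using aff_dim_nonempty_interior[of W] by simp
  qed
qed

lemma punctured_chart:
  fixes W :: "(real \<times> real \<times> real) set" and U :: "'a::euclidean_space set"
  assumes h: "homeomorphism U W f g" and W: "convex W" "aff_dim W = 3" and x: "x \<in> U"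
  shows "simply_connected (U - {x})" "locally path_connected (U - {x})"
proof -
  have "inj_on f U" by (rule inj_on_inverseI[of U g]) (rule homeomorphism_apply1[OF h])
  then have "f ` (U - {x}) = W - {f x}"
    using x homeomorphism_image1[OF h] by (simp add: inj_on_image_set_diff)
  then have "homeomorphism (U - {x}) (W - {f x}) f g"
    using homeomorphism_of_subsets[OF h Diff_subset subset_refl] by blast
  then have hom: "(U - {x}) homeomorphic (W - {f x})" unfolding homeomorphic_def by blast
  have "simply_connected (W - {f x})" using W by (intro simply_connected_punctured_convex) auto
  then show "simply_connected (U - {x})" using homeomorphic_simply_connected_eq[OF hom] by blast
  have "locally path_connected W" using W(1) by (rule convex_imp_locally_path_connected)
  moreover have "openin (top_of_set W) (W - {f x})" by (metis openin_delete openin_subtopology_self)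
  ultimately have "locally path_connected (W - {f x})" by (rule locally_open_subset)
  then show "locally path_connected (U - {x})"
    using homeomorphic_locally[OF hom, of path_connected path_connected]
      homeomorphic_path_connectedness by blast
qed

text \<open>The sets where \<open>s = r\<close> and where \<open>s = - r\<close> are closed,
  disjoint as \<open>r\<close> has no zero, and cover the connected set \<open>X\<close>.\<close>

lemma constant_sign:
  fixes r s :: "'a::topological_space \<Rightarrow> 'b::real_normed_vector"
  assumes X: "connected X" and c: "continuous_on X r" "continuous_on X s"
    and r: "\<And>x. x \<in> X \<Longrightarrow> r x \<noteq> 0" and rs: "\<And>x. x \<in> X \<Longrightarrow> s x = r x \<or> s x = - r x"
    and xy: "x \<in> X" "y \<in> X" "s x = r x"
  shows "s y = r y"
proof (rule ccontr)
  assume "s y \<noteq> r y"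
  let ?A = "{z\<in>X. s z = r z}" and ?B = "{z\<in>X. s z = - r z}"
  have "closedin (top_of_set X) ?A" "closedin (top_of_set X) ?B"
    using continuous_closedin_preimage_constant[OF continuous_on_diff[OF c(2,1)], of 0]
      continuous_closedin_preimage_constant[OF continuous_on_add[OF c(2,1)], of 0]
    by (simp_all add: eq_neg_iff_add_eq_0)
  moreover have "X \<subseteq> ?A \<union> ?B" using rs by blast
  moreover have "?A \<inter> ?B = {}"
  proof -
    have "r z = 0" if "r z = - r z" for z using that by (simp add: eq_neg_iff_add_eq_0 flip: scaleR_2)
    with r show ?thesis by fastforce
  qed
  moreover have "x \<in> ?A" "y \<in> ?B" using xy rs \<open>s y \<noteq> r y\<close> by auto
  ultimately show False using X unfolding connected_closedin by blast
qed

text \<open>The cover needs no abstract gluing: by \<open>compat\<close> the pairs of opposite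
  vectors agree on overlaps, so their points form a subset \<open>E\<close> of the product, and
  \<open>fst\<close> is a twofold covering of \<open>X\<close>. Lifting the identity of the simply
  connected \<open>X\<close> gives a section, which is a consistent choice of sign.\<close>

lemma simply_connected_choose_sign:
  fixes X :: "'a::real_normed_vector set" and s :: "'i \<Rightarrow> 'a \<Rightarrow> 'b::real_normed_vector"
  assumes X: "simply_connected X" "locally path_connected X"
    and op: "\<And>i. i \<in> I \<Longrightarrow> openin (top_of_set X) (U i)" and cover: "X \<subseteq> (\<Union>i\<in>I. U i)"
    and cont: "\<And>i. i \<in> I \<Longrightarrow> continuous_on (U i) (s i)"
    and nz: "\<And>i x. i \<in> I \<Longrightarrow> x \<in> U i \<Longrightarrow> s i x \<noteq> 0"
    and compat: "\<And>i j x. i \<in> I \<Longrightarrow> j \<in> I \<Longrightarrow> x \<in> U i \<Longrightarrow> x \<in> U j \<Longrightarrow> s i x = s j x \<or> s i x = - s j x"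
  obtains g where "continuous_on X g"
    "\<And>i x. i \<in> I \<Longrightarrow> x \<in> U i \<Longrightarrow> g x = s i x \<or> g x = - s i x"
proof -
  define E where "E = {(x,z). \<exists>i\<in>I. x \<in> U i \<and> (z = s i x \<or> z = - s i x)}"
  have UX: "U i \<subseteq> X" if "i \<in> I" for i using op[OF that] openin_imp_subset by blast
  have E_over: "z = s i x \<or> z = - s i x" if z: "(x,z) \<in> E" "i \<in> I" "x \<in> U i" for x z i
  proof -
    obtain j where j: "j \<in> I" "x \<in> U j" "z = s j x \<or> z = - s j x"
      using z(1) unfolding E_def by blast
    then show ?thesis using compat[OF j(1) z(2) j(2) z(3)] by (metis minus_minus)
  qed
  define G where "G = (\<lambda>i (\<sigma>::real). {(x,z)\<in>E. x \<in> U i \<and> z = \<sigma> *\<^sub>R s i x})"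
  have cov: "covering_space E fst X"
  proof
    show "continuous_on E fst" by (intro continuous_intros)
    show "fst ` E = X"
    proof
      show "fst ` E \<subseteq> X" by (auto simp: E_def) (use UX in blast)+
      show "X \<subseteq> fst ` E"
      proof
        fix x assume "x \<in> X"
        then obtain i where "i \<in> I" "x \<in> U i" using cover by blast
        then have "(x, s i x) \<in> E" unfolding E_def by blast
        then show "x \<in> fst ` E" by force
      qed
    qed
    fix x assume "x \<in> X"
    then obtain i where i: "i \<in> I" "x \<in> U i" using cover by blast
    have over: "E \<inter> fst -` U i = G i 1 \<union> G i (-1)"
    proof -
      have "p \<in> E \<inter> fst -` U i \<longleftrightarrow> p \<in> G i 1 \<union> G i (-1)" for p
        using E_over[OF _ i(1), of "fst p" "snd p"] by (cases p) (auto simp: G_def)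
      then show ?thesis by blast
    qed
    have disj: "G i 1 \<inter> G i (-1) = {}"
    proof -
      have "False" if "x \<in> U i" "s i x = - s i x" for x
        using nz[OF i(1) that(1)] that(2) by (simp add: eq_neg_iff_add_eq_0 flip: scaleR_2)
      then show ?thesis by (auto simp: G_def)
    qed
    have opE: "openin (top_of_set E) (E \<inter> fst -` U i)"
      using continuous_openin_preimage[of E fst X "U i"] op[OF i(1)] \<open>fst ` E = X\<close>
        continuous_on_fst[OF continuous_on_id, of E] by auto
    have clG: "closedin (top_of_set (E \<inter> fst -` U i)) (G i \<sigma>)" for \<sigma>
    proof -
      have "G i \<sigma> = {p \<in> E \<inter> fst -` U i. snd p = \<sigma> *\<^sub>R s i (fst p)}" by (auto simp: G_def)
      moreover have "continuous_on (E \<inter> fst -` U i) (\<lambda>p. s i (fst p))"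
        by (rule continuous_on_compose2[OF cont[OF i(1)]]) (auto intro!: continuous_intros)
      ultimately have "continuous_on (E \<inter> fst -` U i) (\<lambda>p. snd p - \<sigma> *\<^sub>R s i (fst p))"
        by (intro continuous_intros)
      from continuous_closedin_preimage_constant[OF this, of 0] show ?thesis
        by (simp add: \<open>G i \<sigma> = _\<close>)
    qed
    have opG: "openin (top_of_set E) (G i \<sigma>)" if "\<sigma> = 1 \<or> \<sigma> = -1" for \<sigma>
    proof -
      \<comment> \<open>Each sheet over \<open>U i\<close> is closed in the preimage, so its
        complement, the other sheet, is open.\<close>
      have "G i \<sigma> = (E \<inter> fst -` U i) - G i (- \<sigma>)" using over disj that by auto
      then have "openin (top_of_set (E \<inter> fst -` U i)) (G i \<sigma>)"
        using clG[of "- \<sigma>"] by (metis openin_diff openin_subtopology_self)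
      then show ?thesis using opE openin_trans by blast
    qed
    have hom: "homeomorphism (G i \<sigma>) (U i) fst (\<lambda>x. (x, \<sigma> *\<^sub>R s i x))" if \<sigma>: "\<sigma> = 1 \<or> \<sigma> = -1" for \<sigma>
    proof (rule homeomorphismI)
      show "continuous_on (G i \<sigma>) fst" by (intro continuous_intros)
      show "continuous_on (U i) (\<lambda>x. (x, \<sigma> *\<^sub>R s i x))" using cont[OF i(1)] by (intro continuous_intros)
      have "(x, \<sigma> *\<^sub>R s i x) \<in> E" if "x \<in> U i" for x
        using that \<sigma> i(1) by (auto simp: E_def)
      then show "(\<lambda>x. (x, \<sigma> *\<^sub>R s i x)) ` U i \<subseteq> G i \<sigma>" by (auto simp: G_def)
    qed (auto simp: G_def)
    have "\<exists>q. homeomorphism (G i 1) (U i) fst q" "\<exists>q. homeomorphism (G i (-1)) (U i) fst q"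
      using hom[of 1] hom[of "-1"] by blast+
    then show "\<exists>T. x \<in> T \<and> openin (top_of_set X) T \<and>
        (\<exists>v. \<Union> v = E \<inter> fst -` T \<and> (\<forall>u\<in>v. openin (top_of_set E) u) \<and> pairwise disjnt v \<and>
             (\<forall>u\<in>v. \<exists>q. homeomorphism u T fst q))"
      using i op[OF i(1)] over disj opG
      by (intro exI[of _ "U i"] conjI exI[of _ "{G i 1, G i (-1)}"])
        (auto simp: pairwise_insert disjnt_def)
  qed
  obtain h where h: "continuous_on X h" "h \<in> X \<rightarrow> E" "\<And>y. y \<in> X \<Longrightarrow> fst (h y) = id y"
    by (rule covering_space_lift[OF cov X, of id]) auto
  show thesis
  proof (rule that[of "snd \<circ> h"])
    show "continuous_on X (snd \<circ> h)" using h(1) by (simp add: continuous_on_snd comp_def)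
    fix i x assume i: "i \<in> I" "x \<in> U i"
    then have "x \<in> X" using UX by blast
    then have "h x \<in> E" "fst (h x) = x" using h(2,3) by auto
    then have "(x, snd (h x)) \<in> E" by (metis prod.collapse)
    then show "(snd \<circ> h) x = s i x \<or> (snd \<circ> h) x = - s i x" using E_over i by simp
  qed
qed

subsection \<open>Links in a triangulated 3-manifold\<close>

locale tetrahedral_manifold = simplicial_family +
  assumes card4: "C \<in> \<K> \<Longrightarrow> card C = 4"
    and manifold: "manifold_with_boundary 3 (top_of_set body)"
begin

text \<open>The neighbourhood \<open>U\<close> is controlled from both sides: its points lie only in
  simplices through \<open>x\<close>, and explicit points of the body are shown to be in
  \<open>U\<close> by their distance from \<open>x\<close>.\<close>

lemma local_chart:
  assumes "x \<in> body"
  obtains U r and W :: "(real \<times> real \<times> real) set" and f g where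
    "openin (top_of_set body) U" "x \<in> U" "homeomorphism U W f g" "convex W" "aff_dim W = 3"
    "\<And>y C. y \<in> U \<Longrightarrow> C \<in> \<K> \<Longrightarrow> y \<in> convex hull C \<Longrightarrow> x \<in> convex hull C"
    "0 < r" "body \<inter> ball x r \<subseteq> U"
proof -
  obtain N where N: "open N" "x \<in> N"
    "\<And>y C. y \<in> N \<Longrightarrow> C \<in> \<K> \<Longrightarrow> y \<in> convex hull C \<Longrightarrow> x \<in> convex hull C"
    using local_simplices[OF assms] by blast
  obtain U and W :: "(real \<times> real \<times> real) set" and f g where U:
    "openin (top_of_set body) U" "x \<in> U" "U \<subseteq> N" "homeomorphism U W f g" "convex W" "aff_dim W = 3"
    by (rule manifold_chart[OF manifold assms N(1,2)])
  obtain r where "0 < r" "ball x r \<inter> body \<subseteq> U" using U(1,2) unfolding openin_contains_ball by blast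
  then show thesis using that[OF U(1,2,4-6)] N(3) U(3) by (metis inf_commute subsetD)
qed

lemma in_body:
  assumes "y \<in> body"
  obtains C where "C \<in> \<K>" "y \<in> convex hull C"
  using assms unfolding body_def by blast

lemma coord_4:
  assumes C: "{a,b,c,d} \<in> \<K>" and dist: "a \<noteq> b" "a \<noteq> c" "a \<noteq> d" "b \<noteq> c" "b \<noteq> d" "c \<noteq> d"
    and nn: "0 \<le> \<alpha>" "0 \<le> \<beta>" "0 \<le> \<gamma>" "0 \<le> \<delta>" "\<alpha> + \<beta> + \<gamma> + \<delta> = 1"
    and y: "y = \<alpha> *\<^sub>R a + \<beta> *\<^sub>R b + \<gamma> *\<^sub>R c + \<delta> *\<^sub>R d"
  shows "y \<in> convex hull {a,b,c,d}" "coord a y = \<alpha>" "coord b y = \<beta>" "coord c y = \<gamma>" "coord d y = \<delta>"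
    "\<And>w. w \<notin> {a,b,c,d} \<Longrightarrow> coord w y = 0"
proof -
  define u where "u = (\<lambda>w. if w = a then \<alpha> else if w = b then \<beta> else if w = c then \<gamma> else \<delta>)"
  have u: "sum u {a,b,c,d} = 1" "(\<Sum>w\<in>{a,b,c,d}. u w *\<^sub>R w) = y" "\<And>w. 0 \<le> u w"
    using dist nn by (auto simp: u_def y add.assoc)
  show "y \<in> convex hull {a,b,c,d}"
    using u by (subst convex_hull_finite) auto
  have eq: "coord w y = (if w \<in> {a,b,c,d} then u w else 0)" for w
    using coord_eq[OF C, of u w] u by simp
  show "coord a y = \<alpha>" "coord b y = \<beta>" "coord c y = \<gamma>" "coord d y = \<delta>"
    "\<And>w. w \<notin> {a,b,c,d} \<Longrightarrow> coord w y = 0" unfolding eq using dist by (auto simp: u_def)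
qed

text \<open>A flat ball in the union of the first two tetrahedra around the barycentre x of the common triangle
  is open in the body by invariance of domain, so the third tetrahedron has no room left.\<close>

lemma triangle_le_2:
  assumes F: "card F = 3" "F \<subseteq> C1" "F \<subseteq> C2" "F \<subseteq> C3" and K: "C1 \<in> \<K>" "C2 \<in> \<K>" "C3 \<in> \<K>"
  shows "C1 = C2 \<or> C1 = C3 \<or> C2 = C3"
proof (rule ccontr)
  assume "\<not> ?thesis"
  then have ne: "C1 \<noteq> C2" "C1 \<noteq> C3" "C2 \<noteq> C3" by auto
  obtain a b c where abc: "F = {a,b,c}" "a \<noteq> b" "b \<noteq> c" "a \<noteq> c" using F(1) by (metis card_3_iff)
  have ex: "\<exists>p. p \<notin> F \<and> C = {a,b,c,p}" if "F \<subseteq> C" "C \<in> \<K>" for C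
  proof -
    have "card (C - F) = 1" using card4[OF that(2)] F(1) abc(1) that(1) by (subst card_Diff_subset) auto
    then obtain p where "C - F = {p}" by (meson card_1_singletonE)
    then have "p \<notin> F" "C = insert p F" using that(1) by auto
    then show ?thesis unfolding abc by (auto simp: insert_commute)
  qed
  obtain p1 where p1: "p1 \<notin> F" "C1 = {a,b,c,p1}" using ex[OF F(2) K(1)] by blast
  obtain p2 where p2: "p2 \<notin> F" "C2 = {a,b,c,p2}" using ex[OF F(3) K(2)] by blast
  obtain p3 where p3: "p3 \<notin> F" "C3 = {a,b,c,p3}" using ex[OF F(4) K(3)] by blast
  have pp: "p1 \<noteq> p2" "p1 \<noteq> p3" "p2 \<noteq> p3" using ne p1 p2 p3 by auto
  note c4 = coord_4[OF _ abc(2,4) _ abc(3)]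
  define x where "x = (1/3) *\<^sub>R (a + b + c)"
  \<comment> \<open>\<open>r\<close> and \<open>s\<close> are coordinates in the plane of the
    triangle; positive \<open>h\<close> moves towards \<open>p1\<close> and negative
    \<open>h\<close> towards \<open>p2\<close>, so two half-balls are glued along the triangle. Norm
    at most 1/12 keeps the coordinates at \<open>a\<close>, \<open>b\<close>, \<open>c\<close>
    non-negative, starting from 1/3.\<close>
  define \<psi> where "\<psi> = (\<lambda>(r,s,h). x + r *\<^sub>R (a - c) + s *\<^sub>R (b - c) + max h 0 *\<^sub>R (p1 - x) + max (-h) 0 *\<^sub>R (p2 - x))"
  have c\<psi>: "continuous_on S \<psi>" for S
    unfolding \<psi>_def case_prod_beta by (intro continuous_intros)
  have \<psi>: "\<psi> (r,s,h) \<in> body \<and> coord a (\<psi> (r,s,h)) = 1/3 + r - \<bar>h\<bar>/3 \<and> coord b (\<psi> (r,s,h)) = 1/3 + s - \<bar>h\<bar>/3 \<and>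
      coord p1 (\<psi> (r,s,h)) = max h 0 \<and> coord p2 (\<psi> (r,s,h)) = max (-h) 0 \<and> coord p3 (\<psi> (r,s,h)) = 0"
    if "norm (r,s,h) \<le> 1/12" for r s h
  proof -
    have "norm r \<le> 1/12" "norm (s,h) \<le> 1/12" using that norm_fst_le[of r "(s,h)"] norm_snd_le[of "(s,h)" r] by simp_all
    moreover from this(2) have "norm s \<le> 1/12" "norm h \<le> 1/12"
      using norm_fst_le[of s h] norm_snd_le[of h s] by simp_all
    ultimately have b: "\<bar>r\<bar> \<le> 1/12" "\<bar>s\<bar> \<le> 1/12" "\<bar>h\<bar> \<le> 1/12" by simp_all
    show ?thesis
    proof (cases "h \<ge> 0")
      case True
      have y: "\<psi> (r,s,h) = (1/3 + r - h/3) *\<^sub>R a + (1/3 + s - h/3) *\<^sub>R b + (1/3 - r - s - h/3) *\<^sub>R c + h *\<^sub>R p1"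
        using True by (simp add: \<psi>_def x_def algebra_simps)
      have nn: "0 \<le> 1/3 + r - h/3" "0 \<le> 1/3 + s - h/3" "0 \<le> 1/3 - r - s - h/3" using b by auto
      have "a \<noteq> p1" "b \<noteq> p1" "c \<noteq> p1" using p1 abc by auto
      note cc = c4[OF K(1)[unfolded p1(2)] this nn True _ y]
      show ?thesis
        using cc(1-3,5) cc(6)[of p2] cc(6)[of p3] p2(1) p3(1) pp abc(1) hull_body[OF K(1)] True p1(2)
        by (auto simp: max_def)
    next
      case False
      then have h: "0 \<le> - h" by simp
      have y: "\<psi> (r,s,h) = (1/3 + r + h/3) *\<^sub>R a + (1/3 + s + h/3) *\<^sub>R b + (1/3 - r - s + h/3) *\<^sub>R c + (-h) *\<^sub>R p2"
        using False by (simp add: \<psi>_def x_def algebra_simps)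
      have nn: "0 \<le> 1/3 + r + h/3" "0 \<le> 1/3 + s + h/3" "0 \<le> 1/3 - r - s + h/3" using b by auto
      have "a \<noteq> p2" "b \<noteq> p2" "c \<noteq> p2" using p2 abc by auto
      note cc = c4[OF K(2)[unfolded p2(2)] this nn h _ y]
      show ?thesis
        using cc(1-3,5) cc(6)[of p1] cc(6)[of p3] p1(1) p3(1) pp abc(1) hull_body[OF K(2)] False p2(2)
        by (auto simp: max_def)
    qed
  qed
  have \<psi>0: "\<psi> (0,0,0) = x" by (simp add: \<psi>_def)
  have "x \<in> body" using \<psi>[of 0 0 0] \<psi>0 by (simp add: norm_prod_def)
  obtain U r0 and W :: "(real \<times> real \<times> real) set" and f g where U:
    "openin (top_of_set body) U" "x \<in> U" "homeomorphism U W f g" "convex W" "aff_dim W = 3"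
    "\<And>y C. y \<in> U \<Longrightarrow> C \<in> \<K> \<Longrightarrow> y \<in> convex hull C \<Longrightarrow> x \<in> convex hull C"
    "0 < r0" "body \<inter> ball x r0 \<subseteq> U"
    by (rule local_chart[OF \<open>x \<in> body\<close>]) (rule that)
  have "open (\<psi> -` ball x r0)" using c\<psi>[of UNIV] by (simp add: open_vimage)
  moreover have "(0,0,0) \<in> \<psi> -` ball x r0" using \<psi>0 U(7) by simp
  ultimately obtain \<eta>0 where \<eta>0: "0 < \<eta>0" "ball (0,0,0) \<eta>0 \<subseteq> \<psi> -` ball x r0" by (rule openE)
  define N where "N = ball (0::real,0::real,0::real) (min \<eta>0 (1/12))"
  have N: "norm p \<le> 1/12" "\<psi> p \<in> ball x r0" if "p \<in> N" for p
    using that \<eta>0(2) by (auto simp: N_def dist_norm zero_prod_def[symmetric])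
  have \<psi>U: "\<psi> ` N \<subseteq> U"
  proof clarify
    fix r s h assume "(r,s,h) \<in> N"
    with N[of "(r,s,h)"] \<psi>[of r s h] U(8) show "\<psi> (r,s,h) \<in> U" by blast
  qed
  have "inj_on \<psi> N"
  proof (rule inj_onI)
    fix p q assume pq: "p \<in> N" "q \<in> N" "\<psi> p = \<psi> q"
    obtain r s h where p: "p = (r,s,h)" by (cases p)
    obtain r' s' h' where q: "q = (r',s',h')" by (cases q)
    note rsh = pq[unfolded p q]
    note 1 = \<psi>[OF N(1)[OF rsh(1)]] and 2 = \<psi>[OF N(1)[OF rsh(2)]]
    have "max h 0 = max h' 0" "max (-h) 0 = max (-h') 0" using 1 2 rsh(3) by metis+
    then have "h = h'" by (auto simp: max_def split: if_splits)
    moreover have "1/3 + r - \<bar>h\<bar>/3 = 1/3 + r' - \<bar>h'\<bar>/3" "1/3 + s - \<bar>h\<bar>/3 = 1/3 + s' - \<bar>h'\<bar>/3"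
      using 1 2 rsh(3) by metis+
    ultimately show "p = q" by (simp add: p q)
  qed
  moreover have injf: "inj_on f U" by (rule inj_on_inverseI[of U g]) (rule homeomorphism_apply1[OF U(3)])
  ultimately have "inj_on (f \<circ> \<psi>) N" using \<psi>U by (meson comp_inj_on inj_on_subset)
  moreover have cf: "continuous_on U f" using U(3) by (simp add: homeomorphism_def)
  then have "continuous_on N (f \<circ> \<psi>)" using c\<psi> \<psi>U continuous_on_compose continuous_on_subset by blast
  ultimately have op: "open ((f \<circ> \<psi>) ` N)" using invariance_of_domain[of N "f \<circ> \<psi>"] by (simp add: N_def)
  have "openin (top_of_set U) (U \<inter> f -` ((f \<circ> \<psi>) ` N))"
    using continuous_openin_preimage_gen[OF cf op] .
  moreover have "U \<inter> f -` ((f \<circ> \<psi>) ` N) = \<psi> ` N"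
    using \<psi>U inj_onD[OF injf] by (auto simp: image_iff) blast
  ultimately have "openin (top_of_set body) (\<psi> ` N)" using U(1) openin_trans by metis
  moreover have "x \<in> \<psi> ` N" using \<psi>0 \<eta>0(1) by (auto simp: N_def intro!: image_eqI[of _ _ "(0,0,0)"])
  ultimately obtain \<rho> where \<rho>: "0 < \<rho>" "ball x \<rho> \<inter> body \<subseteq> \<psi> ` N"
    unfolding openin_contains_ball by blast
  \<comment> \<open>The point \<open>y\<close> below lies on the way from \<open>x\<close> to
    \<open>p3\<close>, within \<open>\<rho>\<close> of \<open>x\<close>; adding 1 keeps the
    denominator positive. Its coordinate at \<open>p3\<close> is \<open>t > 0\<close>, while it is 0
    on the image of \<open>\<psi>\<close>.\<close>
  define t where "t = min 1 (\<rho> / (2 * (norm (p3 - x) + 1)))"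
  have t: "0 < t" "t \<le> 1" using \<rho> by (auto simp: t_def intro!: divide_pos_pos add_nonneg_pos)
  define y where "y = x + t *\<^sub>R (p3 - x)"
  have y: "y = ((1-t)/3) *\<^sub>R a + ((1-t)/3) *\<^sub>R b + ((1-t)/3) *\<^sub>R c + t *\<^sub>R p3"
    by (simp add: y_def x_def algebra_simps diff_divide_distrib)
  have "a \<noteq> p3" "b \<noteq> p3" "c \<noteq> p3" using p3 abc by auto
  moreover have nn: "0 \<le> (1-t)/3" "(1-t)/3 + (1-t)/3 + (1-t)/3 + t = 1"
    using t by (auto simp: field_simps)
  ultimately have cc: "y \<in> convex hull {a,b,c,p3}" "coord p3 y = t"
    using c4(1,5)[OF K(3)[unfolded p3(2)] _ _ _ nn(1) nn(1) nn(1) less_imp_le[OF t(1)] nn(2) y] by simp_all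
  have "y \<in> body" "coord p3 y = t" using cc hull_body[OF K(3)] p3(2) by auto
  moreover have "y \<in> ball x \<rho>"
  proof -
    have "dist x y = t * norm (p3 - x)" using t by (simp add: y_def dist_norm)
    also have "\<dots> \<le> \<rho> / (2 * (norm (p3 - x) + 1)) * norm (p3 - x)"
      by (intro mult_right_mono) (auto simp: t_def)
    also have "\<dots> < \<rho>"
    proof -
      have "\<rho> * norm (p3 - x) < \<rho> * (2 * (norm (p3 - x) + 1))"
        using \<rho>(1) by (intro mult_strict_left_mono) (auto simp: add_nonneg_pos)
      then show ?thesis by (simp add: divide_simps add_nonneg_pos add_pos_nonneg)
    qed
    finally show ?thesis by simp
  qed
  ultimately obtain p where p: "p \<in> N" "y = \<psi> p" using \<rho>(2) by blast
  obtain r s h where "p = (r,s,h)" by (cases p)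
  then have "coord p3 y = 0" using \<psi>[of r s h] N(1)[OF p(1)] p(2) by simp
  with \<open>coord p3 y = t\<close> t show False by simp
qed

section \<open>Connectedness of the stars of edges and vertices\<close>

lemma card_Int_3:
  assumes "C \<in> \<K>" "C' \<in> \<K>" "C \<noteq> C'" "E \<subseteq> C" "E \<subseteq> C'" "card E = 3"
  shows "C \<inter> C' = E"
proof -
  have fin: "finite (C \<inter> C')" using finite_C assms by blast
  have "card (C \<inter> C') < 4"
  proof (rule ccontr)
    assume "\<not> card (C \<inter> C') < 4"
    then have "C \<inter> C' = C" "C \<inter> C' = C'"
      using assms(1,2) card4 finite_C by (metis card_seteq inf_le1 inf_le2 not_less)+
    with assms(3) show False by simp
  qed
  then show ?thesis
    using assms fin card_seteq[of "C \<inter> C'" E] by simp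
qed

lemma card4_obtain:
  assumes "C \<in> \<K>" "a \<in> C" "b \<in> C" "w \<in> C" "a \<noteq> b" "a \<noteq> w" "b \<noteq> w"
  obtains d where "C = {a,b,w,d}" "d \<noteq> a" "d \<noteq> b" "d \<noteq> w"
proof -
  have "card (C - {a,b,w}) = 1" using card4[OF assms(1)] assms by (subst card_Diff_subset) auto
  then obtain d where "C - {a,b,w} = {d}" by (meson card_1_singletonE)
  then have "C = {a,b,w,d}" "d \<notin> {a,b,w}" using assms by auto
  then show thesis using that by simp
qed

text \<open>A disconnected link would split the tetrahedra at the edge into two groups. The map f takes one group
  to the upper and the other to the lower half plane and is positive on one side of the midpoint x of the edge
  and negative on the other; so f has no logarithm on the simply connected punctured neighbourhood of x.\<close>

lemma edge_star_linked:
  assumes "a \<noteq> b"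
  shows "linked 3 {C\<in>\<K>. a \<in> C \<and> b \<in> C}"
  unfolding linked_def
proof (intro allI impI, rule ccontr)
  let ?S = "{C\<in>\<K>. a \<in> C \<and> b \<in> C}"
  fix B assume B: "B \<subseteq> ?S" "B \<noteq> {}" and cl: "\<forall>s\<in>B. \<forall>t\<in>?S. card (s \<inter> t) = 3 \<longrightarrow> t \<in> B" and ne: "B \<noteq> ?S"
  obtain C1 where C1: "C1 \<in> B" using B by blast
  obtain C2 where C2: "C2 \<in> ?S" "C2 \<notin> B" using B ne by blast
  \<comment> \<open>The sign of a third vertex is well defined on both groups: tetrahedra of
    different groups sharing \<open>w\<close> besides \<open>a\<close> and \<open>b\<close> would be
    adjacent across the triangle \<open>a\<close>, \<open>b\<close>, \<open>w\<close>.\<close>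
  define \<sigma> where "\<sigma> = (\<lambda>w. if \<exists>C\<in>B. w \<in> C then 1 else (-1::real))"
  have \<sigma>1: "\<sigma> w = 1" if "C \<in> B" "w \<in> C" for C w using that by (auto simp: \<sigma>_def)
  have \<sigma>2: "\<sigma> w = -1" if C: "C \<in> ?S" "C \<notin> B" "w \<in> C" "w \<noteq> a" "w \<noteq> b" for C w
  proof -
    have False if C': "C' \<in> B" "w \<in> C'" for C'
    proof -
      have "C' \<inter> C = {a,b,w}" by (rule card_Int_3) (use C C' B assms in auto)
      then have "card (C' \<inter> C) = 3" using C assms by simp
      with cl C C' show False by blast
    qed
    then show ?thesis by (auto simp: \<sigma>_def)
  qed
  have third: "\<exists>w\<in>C. w \<noteq> a \<and> w \<noteq> b" if "C \<in> ?S" for C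
  proof (rule ccontr)
    assume "\<not> ?thesis"
    then have "C \<subseteq> {a,b}" by blast
    then have "card C \<le> card {a,b}" by (rule card_mono[rotated]) simp
    then show False using that card4 assms by simp
  qed
  define V where "V = \<Union>\<K> - {a,b}"
  have fV: "finite V" using finite_K finite_C by (auto simp: V_def)
  \<comment> \<open>The real part measures the position along the edge, the imaginary part the
    distance from it, with the sign of the group. On the tetrahedra at the edge \<open>f\<close>
    vanishes only at the midpoint.\<close>
  define f where "f = (\<lambda>y. Complex (coord a y - coord b y) (\<Sum>w\<in>V. \<sigma> w * coord w y))"
  have cf: "continuous_on body f" unfolding f_def
    by (intro continuous_intros continuous_coord)
  define x where "x = (1/2) *\<^sub>R (a + b)"
  have x_coord: "x \<in> convex hull C \<and> coord a x = 1/2 \<and> coord b x = 1/2" if C: "C \<in> ?S" for C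
  proof -
    obtain c where c: "c \<in> C" "c \<noteq> a" "c \<noteq> b" using third[OF C] by blast
    then obtain d where d: "C = {a,b,c,d}" "d \<noteq> a" "d \<noteq> b" "d \<noteq> c" using card4_obtain[of C a b c] C assms by auto
    have "x = (1/2) *\<^sub>R a + (1/2) *\<^sub>R b + 0 *\<^sub>R c + 0 *\<^sub>R d" by (simp add: x_def scaleR_add_right)
    from coord_4(1-3)[OF _ _ _ _ _ _ _ _ _ _ _ _ this] show ?thesis using C d assms c by auto
  qed
  have xC: "C \<in> ?S" if "C \<in> \<K>" "x \<in> convex hull C" for C
    using x_coord[OF C2(1)] coord_hull(4)[OF that, of a] coord_hull(4)[OF that, of b] that(1) by auto
  have "x \<in> body" using x_coord[OF C2(1)] C2(1) hull_body by blast
  obtain U r and W :: "(real \<times> real \<times> real) set" and \<phi> \<psi> where U: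
    "openin (top_of_set body) U" "x \<in> U" "homeomorphism U W \<phi> \<psi>" "convex W" "aff_dim W = 3"
    "\<And>y C. y \<in> U \<Longrightarrow> C \<in> \<K> \<Longrightarrow> y \<in> convex hull C \<Longrightarrow> x \<in> convex hull C"
    "0 < r" "body \<inter> ball x r \<subseteq> U"
    by (rule local_chart[OF \<open>x \<in> body\<close>]) (rule that)
  have Ub: "U \<subseteq> body" using U(1) openin_imp_subset by blast
  have f_hull: "f y = Complex (coord a y - coord b y) (s * (1 - coord a y - coord b y))"
    if C: "C \<in> ?S" "y \<in> convex hull C" "s = (if C \<in> B then 1 else -1)" for C y s
  proof -
    have CK: "C \<in> \<K>" using C by simp
    note c = coord_hull[OF CK C(2)]
    have "(\<Sum>w\<in>V. \<sigma> w * coord w y) = (\<Sum>w\<in>C-{a,b}. \<sigma> w * coord w y)"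
      by (rule sum.mono_neutral_right) (use fV C c(4) in \<open>auto simp: V_def\<close>)
    also have "\<dots> = (\<Sum>w\<in>C-{a,b}. s * coord w y)"
      by (rule sum.cong) (use \<sigma>1 \<sigma>2[OF C(1)] C(3) in auto)
    also have "\<dots> = s * (\<Sum>w\<in>C-{a,b}. coord w y)" by (simp add: sum_distrib_left)
    also have "(\<Sum>w\<in>C-{a,b}. coord w y) = (\<Sum>w\<in>C. coord w y) - (\<Sum>w\<in>{a,b}. coord w y)"
      by (rule sum_diff) (use finite_C[OF CK] C in auto)
    finally show ?thesis using c(2) assms by (simp add: f_def algebra_simps)
  qed
  have f0: "f y \<noteq> 0" if y: "y \<in> U - {x}" for y
  proof
    assume f0: "f y = 0"
    obtain C where C: "C \<in> \<K>" "y \<in> convex hull C" using in_body y Ub by blast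
    then have CS: "C \<in> ?S" using xC U(6) y by blast
    have "coord a y = coord b y" "1 - coord a y - coord b y = 0"
      using f0 f_hull[OF CS C(2) refl] by (auto simp: complex_eq_iff split: if_splits)
    then have ab: "coord a y = 1/2" "coord b y = 1/2" by auto
    note c = coord_hull[OF C]
    have fC: "finite C" using finite_C C by blast
    have z: "coord w y = 0" if "w \<in> C - {a,b}" for w
    proof -
      have "(\<Sum>w\<in>C-{a,b}. coord w y) = (\<Sum>w\<in>C. coord w y) - (\<Sum>w\<in>{a,b}. coord w y)"
        by (rule sum_diff) (use fC CS in auto)
      also have "\<dots> = 0" using c(2) ab assms by simp
      finally show ?thesis using that c(1) fC sum_nonneg_eq_0_iff[of "C-{a,b}" "\<lambda>w. coord w y"] by auto
    qed
    have "y = (\<Sum>w\<in>C. coord w y *\<^sub>R w)" using c(3) by simp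
    also have "\<dots> = (\<Sum>w\<in>{a,b}. coord w y *\<^sub>R w)"
      by (rule sum.mono_neutral_right) (use fC CS z in auto)
    also have "\<dots> = coord a y *\<^sub>R a + coord b y *\<^sub>R b" using assms by simp
    also have "\<dots> = x" unfolding ab x_def by (simp add: scaleR_add_right)
    finally show False using y by simp
  qed
  obtain g where g: "continuous_on (U - {x}) g" "\<And>y. y \<in> U - {x} \<Longrightarrow> f y = exp (g y)"
    using continuous_logarithm_on_simply_connected[OF continuous_on_subset[OF cf] punctured_chart[OF U(3-5,2)] f0]
      Ub by blast
  have half: "g (x - (\<delta>/2) *\<^sub>R (a - b)) - g (x + (\<delta>/2) *\<^sub>R (a - b)) = \<i> * of_real (s * pi)"
    if C: "C \<in> ?S" "w \<in> C" "w \<noteq> a" "w \<noteq> b" and s: "s = (if C \<in> B then 1 else -1)"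
      and \<delta>: "0 < \<delta>" "\<delta> \<le> 1/2" "\<delta> * (norm (a - b) + norm (w - x)) < r" for C w s \<delta>
  proof -
    \<comment> \<open>A half ellipse in the tetrahedron \<open>C\<close> between two points of the
      edge. The factor 1/2 compensates that adding \<open>a - b\<close> changes the difference of
      the coordinates at \<open>a\<close> and \<open>b\<close> by 2, so \<open>f\<close> runs over a
      half circle of radius \<open>\<delta>\<close>, and uniqueness of lifts fixes the increment of
      \<open>g\<close>.\<close>
    define y where "y = (\<lambda>\<theta>::real. x + (\<delta>/2 * cos \<theta>) *\<^sub>R (a - b) + (\<delta> * sin \<theta>) *\<^sub>R (w - x))"
    obtain d where d: "C = {a,b,w,d}" "d \<noteq> a" "d \<noteq> b" "d \<noteq> w" using card4_obtain[of C a b w] C assms by auto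
    have y: "y \<theta> \<in> U - {x} \<and> f (y \<theta>) = of_real \<delta> * exp (\<i> * of_real (s * \<theta>))" if \<theta>: "\<theta> \<in> {0..pi}" for \<theta>
    proof -
      have sn: "0 \<le> sin \<theta>" using \<theta> by (simp add: sin_ge_zero)
      have bd: "\<delta> * \<bar>cos \<theta>\<bar> \<le> 1/2" "\<delta> * sin \<theta> \<le> 1/2"
        using \<delta> mult_mono[of \<delta> "1/2" "\<bar>cos \<theta>\<bar>" 1] mult_mono[of \<delta> "1/2" "sin \<theta>" 1] sn by auto
      then have "\<bar>\<delta> * cos \<theta>\<bar> \<le> 1/2" using \<delta>(1) by (simp add: abs_mult)
      then have bd': "- (1/2) \<le> \<delta> * cos \<theta>" "\<delta> * cos \<theta> \<le> 1/2"
        by linarith+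
      define A where "A = 1/2 + \<delta> * cos \<theta> / 2 - \<delta> * sin \<theta> / 2"
      define A' where "A' = 1/2 - \<delta> * cos \<theta> / 2 - \<delta> * sin \<theta> / 2"
      have nn: "0 \<le> A" "0 \<le> A'" "0 \<le> \<delta> * sin \<theta>" "A + A' + \<delta> * sin \<theta> + 0 = 1"
        using bd' bd(2) \<delta>(1) sn by (auto simp: A_def A'_def)
      have eq: "y \<theta> = A *\<^sub>R a + A' *\<^sub>R b + (\<delta> * sin \<theta>) *\<^sub>R w + 0 *\<^sub>R d"
        by (simp add: y_def x_def A_def A'_def algebra_simps flip: scaleR_add_left)
      have CK: "{a,b,w,d} \<in> \<K>" using C d by simp
      have co: "y \<theta> \<in> convex hull C" "coord a (y \<theta>) = A" "coord b (y \<theta>) = A'" "coord w (y \<theta>) = \<delta> * sin \<theta>"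
        using coord_4(1-4)[OF CK assms _ _ _ _ _ nn(1-3) order_refl nn(4) eq] d C by auto
      have "y \<theta> \<in> body" using co(1) hull_body C by blast
      moreover have "dist x (y \<theta>) < r"
      proof -
        have "dist x (y \<theta>) = norm ((\<delta>/2 * cos \<theta>) *\<^sub>R (a - b) + (\<delta> * sin \<theta>) *\<^sub>R (w - x))"
          unfolding dist_commute[of x] by (simp add: y_def dist_norm add.assoc)
        also have "\<dots> \<le> norm ((\<delta>/2 * cos \<theta>) *\<^sub>R (a - b)) + norm ((\<delta> * sin \<theta>) *\<^sub>R (w - x))"
          by (rule norm_triangle_ineq)
        also have "\<dots> = \<delta>/2 * \<bar>cos \<theta>\<bar> * norm (a - b) + \<delta> * sin \<theta> * norm (w - x)"
          using \<delta> sn by (simp add: abs_mult)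
        also have "\<dots> \<le> \<delta> * norm (a - b) + \<delta> * norm (w - x)"
        proof (intro add_mono mult_right_mono)
          have "\<delta> / 2 * \<bar>cos \<theta>\<bar> \<le> \<delta> / 2 * 1" using \<delta> by (intro mult_left_mono) auto
          then show "\<delta> / 2 * \<bar>cos \<theta>\<bar> \<le> \<delta>" using \<delta>(1) by linarith
          have "\<delta> * sin \<theta> \<le> \<delta> * 1" using \<delta> by (intro mult_left_mono) auto
          then show "\<delta> * sin \<theta> \<le> \<delta>" by simp
        qed auto
        finally show ?thesis using \<delta>(3) by (simp add: distrib_left)
      qed
      ultimately have "y \<theta> \<in> U" using U(8) by auto
      moreover have feq: "f (y \<theta>) = of_real \<delta> * exp (\<i> * of_real (s * \<theta>))"
      proof -
        have "f (y \<theta>) = Complex (\<delta> * cos \<theta>) (s * (\<delta> * sin \<theta>))"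
          using f_hull[OF C(1) co(1) s] co by (simp add: A_def A'_def)
        also have "\<dots> = of_real \<delta> * exp (\<i> * of_real (s * \<theta>))"
          using s by (auto simp: complex_eq_iff Re_exp Im_exp)
        finally show ?thesis .
      qed
      moreover have "y \<theta> \<noteq> x"
      proof
        assume "y \<theta> = x"
        then have "f (y \<theta>) = 0"
          using f_hull[OF C(1), of x s] x_coord[OF C(1)] s by (simp add: complex_eq_iff)
        with feq \<delta>(1) show False by simp
      qed
      ultimately show ?thesis by simp
    qed
    have yU: "y ` {0..pi} \<subseteq> U - {x}" using y by blast
    have cy: "continuous_on {0..pi} y" unfolding y_def by (intro continuous_intros)
    have "(g \<circ> y) pi = (\<lambda>\<theta>. g (y 0) + \<i> * of_real (s * \<theta>)) pi"
    proof (rule covering_space_lift_unique[OF covering_space_exp_punctured_plane, where a = 0 and T = "{0..pi}" and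
          f = "f \<circ> y" and x = pi and ?g1.0 = "g \<circ> y" and ?g2.0 = "\<lambda>\<theta>. g (y 0) + \<i> * of_real (s * \<theta>)"])
      show "continuous_on {0..pi} (f \<circ> y)"
        using yU Ub by (intro continuous_on_compose cy continuous_on_subset[OF cf]) blast
      show "f \<circ> y \<in> {0..pi} \<rightarrow> - {0}" using y \<delta> by auto
      show "continuous_on {0..pi} (g \<circ> y)"
        by (intro continuous_on_compose cy continuous_on_subset[OF g(1) yU])
      show "continuous_on {0..pi} (\<lambda>\<theta>. g (y 0) + \<i> * of_real (s * \<theta>))" by (intro continuous_intros)
      show "(f \<circ> y) \<theta> = exp ((g \<circ> y) \<theta>)" if "\<theta> \<in> {0..pi}" for \<theta> using g(2)[of "y \<theta>"] y[OF that] by fastforce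
      show "(f \<circ> y) \<theta> = exp (g (y 0) + \<i> * of_real (s * \<theta>))" if "\<theta> \<in> {0..pi}" for \<theta>
        using g(2)[of "y 0"] y[OF that] y[of 0] by (simp add: exp_add)
    qed auto
    moreover have "y pi = x - (\<delta>/2) *\<^sub>R (a - b)" "y 0 = x + (\<delta>/2) *\<^sub>R (a - b)" by (simp_all add: y_def)
    ultimately show ?thesis by simp
  qed
  have C1S: "C1 \<in> ?S" using B C1 by blast
  obtain w1 where w1: "w1 \<in> C1" "w1 \<noteq> a" "w1 \<noteq> b" using third[OF C1S] by blast
  obtain w2 where w2: "w2 \<in> C2" "w2 \<noteq> a" "w2 \<noteq> b" using third[OF C2(1)] by blast
  define m where "m = norm (a - b) + norm (w1 - x) + norm (w2 - x) + 1"
  \<comment> \<open>One \<open>\<delta>\<close> serves both groups, so the two half ellipses have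
    the same end points, yet \<open>g\<close> changes by opposite non-zero amounts. The bound 1/2
    keeps the coordinates at \<open>a\<close> and \<open>b\<close> non-negative.\<close>
  define \<delta> where "\<delta> = min (1/2) (r / (2 * m))"
  have m: "1 \<le> m" by (simp add: m_def)
  have \<delta>: "0 < \<delta>" "\<delta> \<le> 1/2" using m U(7) by (auto simp: \<delta>_def)
  have "\<delta> * m \<le> r / (2 * m) * m" using m by (intro mult_right_mono) (auto simp: \<delta>_def)
  also have "\<dots> = r / 2" using m by simp
  finally have \<delta>m: "\<delta> * m < r" using U(7) by simp
  have lt: "\<delta> * (norm (a - b) + norm (w1 - x)) < r" "\<delta> * (norm (a - b) + norm (w2 - x)) < r"
  proof -
    have "\<delta> * (norm (a - b) + norm (w1 - x)) \<le> \<delta> * m" "\<delta> * (norm (a - b) + norm (w2 - x)) \<le> \<delta> * m"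
      using \<delta> by (auto intro!: mult_left_mono simp: m_def)
    then show "\<delta> * (norm (a - b) + norm (w1 - x)) < r" "\<delta> * (norm (a - b) + norm (w2 - x)) < r"
      using \<delta>m by linarith+
  qed
  have "\<i> * of_real (1 * pi) = \<i> * of_real ((-1) * pi)"
    using half[OF C1S w1 _ \<delta> lt(1), of 1] half[OF C2(1) w2 _ \<delta> lt(2), of "-1"] C1 C2(2) by simp
  then show False by simp
qed

lemma coord_vertex:
  assumes "C \<in> \<K>" "v \<in> C"
  shows "coord v v = 1"
proof -
  have "(\<Sum>c\<in>C. (if c = v then 1 else 0) *\<^sub>R c) = (\<Sum>c\<in>C. if c = v then c else 0)"
    by (rule sum.cong) auto
  also have "\<dots> = v" using assms finite_C by simp
  finally show ?thesis
    using coord_eq[OF assms(1), of "\<lambda>c. if c = v then 1 else 0" v] assms finite_C by simp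
qed

text \<open>If tetrahedra of two groups shared an edge at \<open>v\<close>, the connected star of
  that edge would merge the groups. So they meet in \<open>v\<close> only, and the two unions would
  be disjoint closed sets covering the connected punctured neighbourhood of
  \<open>v\<close>.\<close>

lemma vertex_star_linked: "linked 3 {C\<in>\<K>. v \<in> C}"
  unfolding linked_def
proof (intro allI impI, rule ccontr)
  let ?S = "{C\<in>\<K>. v \<in> C}"
  fix B assume B: "B \<subseteq> ?S" "B \<noteq> {}" and cl: "\<forall>s\<in>B. \<forall>t\<in>?S. card (s \<inter> t) = 3 \<longrightarrow> t \<in> B" and ne: "B \<noteq> ?S"
  obtain C1 where C1: "C1 \<in> B" using B by blast
  obtain C2 where C2: "C2 \<in> ?S" "C2 \<notin> B" using B ne by blast
  have Int: "C \<inter> C' = {v}" if C: "C \<in> B" "C' \<in> ?S - B" for C C'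
  proof (rule ccontr)
    assume "C \<inter> C' \<noteq> {v}"
    then obtain w where w: "w \<in> C" "w \<in> C'" "w \<noteq> v" using C B by blast
    have "B \<inter> {C\<in>\<K>. v \<in> C \<and> w \<in> C} = {C\<in>\<K>. v \<in> C \<and> w \<in> C}"
    proof (rule linkedD[OF edge_star_linked[OF w(3)[symmetric]]])
      show "C \<in> B \<inter> {C\<in>\<K>. v \<in> C \<and> w \<in> C}" using C w B by blast
    qed (use cl in blast)+
    then show False using C w by blast
  qed
  have vC: "C \<in> ?S" if "C \<in> \<K>" "v \<in> convex hull C" for C
  proof -
    have vC2: "v \<in> C2" "C2 \<in> \<K>" using C2 by auto
    have "coord v v = 1" by (rule coord_vertex[OF vC2(2,1)])
    then show ?thesis using coord_hull(4)[OF that, of v] that by auto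
  qed
  have vb: "v \<in> body" by (rule subsetD[OF hull_body[of C2]]) (use C2 in \<open>auto intro: hull_inc\<close>)
  obtain U r and W :: "(real \<times> real \<times> real) set" and \<phi> \<psi> where U:
    "openin (top_of_set body) U" "v \<in> U" "homeomorphism U W \<phi> \<psi>" "convex W" "aff_dim W = 3"
    "\<And>y C. y \<in> U \<Longrightarrow> C \<in> \<K> \<Longrightarrow> y \<in> convex hull C \<Longrightarrow> v \<in> convex hull C"
    "0 < r" "body \<inter> ball v r \<subseteq> U"
    by (rule local_chart[OF vb]) (rule that)
  have Ub: "U \<subseteq> body" using U(1) openin_imp_subset by blast
  let ?A = "\<lambda>X. \<Union>C\<in>X. convex hull C"
  have "connected (U - {v})"
    using punctured_chart(1)[OF U(3-5,2)] by (rule simply_connected_imp_connected)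
  moreover have "closed (?A B)" "closed (?A (?S - B))"
  proof -
    have clA: "closed (?A X)" if "X \<subseteq> \<K>" for X
    proof (rule closed_UN)
      show "finite X" using that finite_K finite_subset by blast
      show "\<forall>C\<in>X. closed (convex hull C)"
        using that finite_C by (auto intro!: compact_imp_closed finite_imp_compact_convex_hull)
    qed
    have "B \<subseteq> \<K>" "?S - B \<subseteq> \<K>" using B by auto
    from this[THEN clA] show "closed (?A B)" "closed (?A (?S - B))" .
  qed
  moreover have "U - {v} \<subseteq> ?A B \<union> ?A (?S - B)"
  proof
    fix y assume y: "y \<in> U - {v}"
    obtain C where "C \<in> \<K>" "y \<in> convex hull C" using in_body y Ub by blast
    then show "y \<in> ?A B \<union> ?A (?S - B)" using vC U(6) y by blast
  qed
  moreover have "?A B \<inter> ?A (?S - B) \<inter> (U - {v}) = {}"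
  proof -
    have "y = v" if "C \<in> B" "C' \<in> ?S - B" "y \<in> convex hull C" "y \<in> convex hull C'" for C C' y
    proof -
      have "y \<in> convex hull (C \<inter> C')" using hull_Int[of C C'] that B by blast
      then show ?thesis using Int[OF that(1,2)] by simp
    qed
    then show ?thesis by blast
  qed
  moreover have hit: "convex hull C \<inter> (U - {v}) \<noteq> {}" if C: "C \<in> ?S" for C
  proof -
    have "card (C - {v}) = 3" using C card4 finite_C by simp
    then obtain w where w: "w \<in> C" "w \<noteq> v" by (metis Diff_iff card.empty equals0I insertCI zero_neq_numeral)
    define t where "t = min 1 (r / (2 * norm (w - v)))"
    have n: "0 < norm (w - v)" using w by simp
    have t: "0 < t" "t \<le> 1" using U(7) n by (auto simp: t_def)
    define y where "y = (1 - t) *\<^sub>R v + t *\<^sub>R w"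
    have yC: "y \<in> convex hull C"
      unfolding y_def by (rule convexD[OF convex_convex_hull]) (use t w C hull_inc in auto)
    have yv: "y - v = t *\<^sub>R (w - v)" by (simp add: y_def algebra_simps)
    have ny: "norm (y - v) = t * norm (w - v)" unfolding yv using t by simp
    have "t * norm (w - v) \<le> r / (2 * norm (w - v)) * norm (w - v)"
      by (intro mult_right_mono) (auto simp: t_def)
    also have "\<dots> < r" using U(7) n by simp
    finally have "dist v y < r" by (metis ny dist_commute dist_norm)
    moreover have "y \<noteq> v" using yv t n by auto
    moreover have "y \<in> body" by (rule subsetD[OF hull_body yC]) (use C in simp)
    ultimately have "y \<in> U - {v}" using U(8) by auto
    then show ?thesis using yC by blast
  qed
  moreover have "?A B \<inter> (U - {v}) \<noteq> {}" using hit[of C1] C1 B by blast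
  moreover have "?A (?S - B) \<inter> (U - {v}) \<noteq> {}" using hit[OF C2(1)] C2 by blast
  ultimately show False unfolding connected_closed by metis
qed


section \<open>The link of a vertex as a simply connected surface\<close>

definition vertex_link :: "'a \<Rightarrow> 'a set set" where
  "vertex_link v = (\<lambda>C. C - {v}) ` {C\<in>\<K>. v \<in> C}"

text \<open>A vanishing combination of the differences \<open>u - v\<close> would give
  \<open>v\<close> a second set of barycentric coordinates.\<close>

lemma link_independent:
  assumes C: "C \<in> \<K>" "v \<in> C" and 0: "(\<Sum>u\<in>C-{v}. \<kappa> u *\<^sub>R (u - v)) = 0" and w: "w \<in> C - {v}"
  shows "\<kappa> w = 0"
proof -
  have fC: "finite C" using finite_C C by blast
  define u1 where "u1 = (\<lambda>c. if c = v then 1 - sum \<kappa> (C - {v}) else \<kappa> c)"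
  define u2 where "u2 = (\<lambda>c. if c = v then 1 else (0::real))"
  have s1: "sum u1 C = 1"
  proof -
    have "sum u1 C = u1 v + sum u1 (C - {v})" using fC C by (simp add: sum.remove)
    also have "sum u1 (C - {v}) = sum \<kappa> (C - {v})" by (rule sum.cong) (auto simp: u1_def)
    finally show ?thesis by (simp add: u1_def)
  qed
  have s2: "sum u2 C = 1" using fC C by (simp add: u2_def)
  have e2: "(\<Sum>c\<in>C. u2 c *\<^sub>R c) = v"
  proof -
    have "(\<Sum>c\<in>C. u2 c *\<^sub>R c) = (\<Sum>c\<in>C. if c = v then c else 0)"
      by (rule sum.cong) (auto simp: u2_def)
    then show ?thesis using fC C by simp
  qed
  have e1: "(\<Sum>c\<in>C. u1 c *\<^sub>R c) = v"
  proof -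
    have "(\<Sum>c\<in>C. u1 c *\<^sub>R c) = u1 v *\<^sub>R v + (\<Sum>c\<in>C-{v}. u1 c *\<^sub>R c)" using fC C by (simp add: sum.remove)
    also have "(\<Sum>c\<in>C-{v}. u1 c *\<^sub>R c) = (\<Sum>c\<in>C-{v}. \<kappa> c *\<^sub>R c)" by (rule sum.cong) (auto simp: u1_def)
    also have "\<dots> = (\<Sum>u\<in>C-{v}. \<kappa> u *\<^sub>R (u - v)) + sum \<kappa> (C-{v}) *\<^sub>R v"
      by (simp add: scaleR_diff_right sum_subtractf scaleR_left.sum)
    finally show ?thesis using 0 by (simp add: u1_def algebra_simps)
  qed
  have "u1 w = u2 w" using barycentric_unique[OF independent[OF C(1)] s1 s2] e1 e2 w by simp
  then show ?thesis using w by (simp add: u1_def u2_def)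
qed

lemma link_third:
  assumes "C \<in> \<K>" "v \<in> C" "u \<in> C - {v}" "w \<in> C - {v}" "z \<in> C - {v}" "u \<noteq> w" "u \<noteq> z" "w \<noteq> z"
  shows "C - {v} = {u,w,z}"
proof -
  have "C - {v} = {w,u,z}"
    by (rule card4_obtain[of C v w u]) (use assms in auto)
  then show ?thesis by (simp add: insert_commute)
qed

text \<open>An even cochain c on the link defines a double cover of the punctured neighbourhood of v: over the
  open star of w, the two points above y are plus and minus the vector obtained from y - v by changing the
  sign of the coordinates at the u with c {w,u}.\<close>

lemma link_cohomology:
  assumes v: "v \<in> body" and c: "even_cochain (vertex_link v) c"
  shows "\<exists>f::'a \<Rightarrow> bool. \<forall>t\<in>vertex_link v. \<forall>x\<in>t. \<forall>y\<in>t. x \<noteq> y \<longrightarrow> c {x,y} = (f x \<noteq> f y)"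
proof -
  define V where "V = \<Union>\<K> - {v}"
  have fV: "finite V" using finite_K finite_C by (auto simp: V_def)
  \<comment> \<open>\<open>w \<noteq> u\<close> keeps the coordinate at \<open>w\<close> itself
    unchanged, since \<open>c\<close> carries no information on one-point sets. This positive
    coordinate makes \<open>s w\<close> non-zero on \<open>S w\<close>.\<close>
  define sg where "sg = (\<lambda>w u. if w \<noteq> u \<and> c {w,u} then -1 else (1::real))"
  define s where "s = (\<lambda>w y. \<Sum>u\<in>V. (sg w u * coord u y) *\<^sub>R (u - v))"
  obtain U r and W :: "(real \<times> real \<times> real) set" and \<phi> \<psi> where U:
    "openin (top_of_set body) U" "v \<in> U" "homeomorphism U W \<phi> \<psi>" "convex W" "aff_dim W = 3"
    "\<And>y C. y \<in> U \<Longrightarrow> C \<in> \<K> \<Longrightarrow> y \<in> convex hull C \<Longrightarrow> v \<in> convex hull C"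
    "0 < r" "body \<inter> ball v r \<subseteq> U"
    by (rule local_chart[OF v]) (rule that)
  have Ub: "U \<subseteq> body" using U(1) openin_imp_subset by blast
  define X where "X = U - {v}"
  define S where "S = (\<lambda>w. {y\<in>X. 0 < coord w y})"
  show ?thesis
  proof (cases "\<exists>C\<in>\<K>. v \<in> C")
    case False
    then show ?thesis by (intro exI[of _ "\<lambda>_. True"]) (auto simp: vertex_link_def)
  next
    case True
    have star_v: "v \<in> C" if "C \<in> \<K>" "v \<in> convex hull C" for C
      using True coord_hull(4)[OF that, of v] coord_vertex by force
    have X_hull: "\<exists>C\<in>\<K>. v \<in> C \<and> y \<in> convex hull C" if "y \<in> X" for y
      using in_body[of y] that Ub U(6) star_v unfolding X_def by (metis Diff_iff subsetD)
    have s_eq: "s w y = (\<Sum>u\<in>C-{v}. (sg w u * coord u y) *\<^sub>R (u - v))"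
      if "C \<in> \<K>" "y \<in> convex hull C" for w y C
      unfolding s_def
      by (rule sum.mono_neutral_right) (use fV coord_hull(4)[OF that] that(1) in \<open>auto simp: V_def\<close>)
    have s_nz: "s w y \<noteq> 0" if "w \<in> V" "y \<in> S w" for w y
    proof
      assume 0: "s w y = 0"
      obtain C where C: "C \<in> \<K>" "v \<in> C" "y \<in> convex hull C" using X_hull \<open>y \<in> S w\<close> unfolding S_def by blast
      have "0 < coord w y" using that by (simp add: S_def)
      then have "w \<in> C - {v}" using coord_hull(4)[OF C(1,3), of w] that by (force simp: V_def)
      then have "sg w w * coord w y = 0"
        using link_independent[OF C(1,2), of "\<lambda>u. sg w u * coord u y"] 0 s_eq[OF C(1,3)] by simp
      with \<open>0 < coord w y\<close> show False by (simp add: sg_def)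
    qed
    \<comment> \<open>The cocycle condition in multiplicative form: changing the reference vertex
      from \<open>w\<close> to \<open>w'\<close> multiplies all signs by one factor, so
      \<open>s w\<close> and \<open>s w'\<close> agree up to sign. Coinciding vertices are separate
      cases because \<open>even_cochain\<close> speaks of distinct ones only.\<close>
    have sg_rel: "sg w' u = sg w w' * sg w u" if C: "C \<in> \<K>" "v \<in> C" and m: "w \<in> C - {v}" "w' \<in> C - {v}" "u \<in> C - {v}" for C w w' u
    proof -
      consider "w = w'" | "w \<noteq> w'" "u = w" | "w \<noteq> w'" "u = w'" | "w \<noteq> w'" "u \<noteq> w" "u \<noteq> w'" by blast
      then show ?thesis
      proof cases
        case 4
        have "{w,w',u} \<in> vertex_link v"
          using link_third[OF C m] 4 C by (auto simp: vertex_link_def image_iff)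
        then have "c {w,w'} = (c {w,u} \<noteq> c {w',u})" using c 4 unfolding even_cochain_def by metis
        then show ?thesis using 4 by (auto simp: sg_def)
      qed (auto simp: sg_def insert_commute)
    qed
    have s_rel: "s w' y = sg w w' *\<^sub>R s w y"
      if C: "C \<in> \<K>" "v \<in> C" "y \<in> convex hull C" "w \<in> C - {v}" "w' \<in> C - {v}" for C w w' y
      unfolding s_eq[OF C(1,3)] scaleR_sum_right
      by (rule sum.cong) (use sg_rel[OF C(1,2,4,5)] in auto)
    have simply: "simply_connected X" "locally path_connected X"
      unfolding X_def by (rule punctured_chart[OF U(3-5,2)])+
    obtain h where h: "continuous_on X h" "\<And>w y. w \<in> V \<Longrightarrow> y \<in> S w \<Longrightarrow> h y = s w y \<or> h y = - s w y"
    proof (rule simply_connected_choose_sign[OF simply, of V S s])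
      show "openin (top_of_set X) (S w)" for w
      proof -
        have "openin (top_of_set X) (X \<inter> coord w -` {0<..})"
          by (rule continuous_openin_preimage_gen[OF continuous_on_subset[OF continuous_coord]])
            (use Ub in \<open>auto simp: X_def\<close>)
        moreover have "S w = X \<inter> coord w -` {0<..}" by (auto simp: S_def)
        ultimately show ?thesis by simp
      qed
      show "X \<subseteq> (\<Union>w\<in>V. S w)"
      proof
        fix y assume y: "y \<in> X"
        obtain C where C: "C \<in> \<K>" "v \<in> C" "y \<in> convex hull C" using X_hull[OF y] by blast
        have "\<exists>w\<in>C-{v}. coord w y \<noteq> 0"
        proof (rule ccontr)
          assume "\<not> ?thesis"
          then have "y \<in> convex hull {v}" using hull_mono_coord[OF C(1,3), of "{v}"] C(2) by auto
          with y show False by (simp add: X_def)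
        qed
        then obtain w where w: "w \<in> C - {v}" "coord w y \<noteq> 0" by blast
        then have "0 < coord w y" using coord_hull(1)[OF C(1,3), of w] by simp
        then show "y \<in> (\<Union>w\<in>V. S w)" using w C y by (auto simp: V_def S_def)
      qed
      show "continuous_on (S w) (s w)" for w
        unfolding s_def
        by (intro continuous_intros continuous_on_subset[OF continuous_coord]) (use Ub in \<open>auto simp: S_def X_def\<close>)
      show "s w y \<noteq> 0" if "w \<in> V" "y \<in> S w" for w y using s_nz that .
      show "s w y = s w' y \<or> s w y = - s w' y" if w: "w \<in> V" "w' \<in> V" "y \<in> S w" "y \<in> S w'" for w w' y
      proof -
        obtain C where C: "C \<in> \<K>" "v \<in> C" "y \<in> convex hull C" using X_hull w unfolding S_def by blast
        have "coord w y \<noteq> 0" "coord w' y \<noteq> 0" using w by (auto simp: S_def)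
        then have "w \<in> C - {v}" "w' \<in> C - {v}" using coord_hull(4)[OF C(1,3)] w by (auto simp: V_def)
        from s_rel[OF C this] show ?thesis by (auto simp: sg_def)
      qed
    qed (rule that)
    define m where "m = 1 + (\<Sum>u\<in>V. norm (u - v))"
    have m: "1 \<le> m" by (simp add: m_def sum_nonneg)
    have mu: "norm (u - v) < m" if "u \<in> V" for u
      using member_le_sum[of u V "\<lambda>u. norm (u - v)"] fV that by (simp add: m_def)
    \<comment> \<open>\<open>m\<close> exceeds all distances from \<open>v\<close> to the vertices,
      so the link shrunk towards \<open>v\<close> by the factor \<open>\<delta>\<close> lies in the
      ball of radius \<open>r\<close>; \<open>\<delta> \<le> 1\<close> keeps the coordinate at
      \<open>v\<close> non-negative.\<close>
    define \<delta> where "\<delta> = min 1 (r / m)"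
    have \<delta>: "0 < \<delta>" "\<delta> \<le> 1" "\<delta> * m \<le> r"
    proof -
      show "0 < \<delta>" "\<delta> \<le> 1" using m U(7) by (auto simp: \<delta>_def)
      have "\<delta> * m \<le> r / m * m" using m by (intro mult_right_mono) (auto simp: \<delta>_def)
      then show "\<delta> * m \<le> r" using m by simp
    qed
    define p where "p = (\<lambda>u. v + \<delta> *\<^sub>R (u - v))"
    \<comment> \<open>\<open>f u\<close> records on which sheet, relative to \<open>s u\<close>, the
      section \<open>h\<close> lies over the copy \<open>p u\<close> of \<open>u\<close> in the
      shrunk link.\<close>
    define f where "f = (\<lambda>u. h (p u) = s u (p u))"
    have "c {u,w} = (f u \<noteq> f w)" if C: "C \<in> \<K>" "v \<in> C" and uw: "u \<in> C - {v}" "w \<in> C - {v}" "u \<noteq> w" for C u w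
    proof -
      have uV: "u \<in> V" "w \<in> V" using C uw by (auto simp: V_def)
      obtain d where d: "C = {v,u,w,d}" "d \<noteq> v" "d \<noteq> u" "d \<noteq> w" using card4_obtain[of C v u w] C uw by auto
      have CK: "{v,u,w,d} \<in> \<K>" using C d by simp
      define y where "y = (\<lambda>\<tau>::real. v + \<delta> *\<^sub>R ((1 - \<tau>) *\<^sub>R (u - v) + \<tau> *\<^sub>R (w - v)))"
      \<comment> \<open>The values of \<open>s u\<close> along the segment from \<open>p u\<close>
        to \<open>p w\<close>. The end \<open>p w\<close> is outside \<open>S u\<close>, so there
        \<open>R\<close> is compared with \<open>h\<close> by means of \<open>s w\<close>; hence the
        sign relating \<open>f u\<close> to \<open>f w\<close> is exactly
        \<open>sg u w\<close>.\<close>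
      define R where "R = (\<lambda>\<tau>::real. \<delta> *\<^sub>R ((1 - \<tau>) *\<^sub>R (u - v) + (sg u w * \<tau>) *\<^sub>R (w - v)))"
      have y: "y \<tau> \<in> convex hull C" "coord u (y \<tau>) = \<delta> * (1 - \<tau>)" "coord w (y \<tau>) = \<delta> * \<tau>" "coord d (y \<tau>) = 0"
        if \<tau>: "\<tau> \<in> {0..1}" for \<tau>
      proof -
        have nn: "0 \<le> 1 - \<delta>" "0 \<le> \<delta> * (1 - \<tau>)" "0 \<le> \<delta> * \<tau>" "1 - \<delta> + \<delta> * (1 - \<tau>) + \<delta> * \<tau> + 0 = 1"
          using \<delta> \<tau> by (auto simp: algebra_simps)
        have eq: "y \<tau> = (1 - \<delta>) *\<^sub>R v + (\<delta> * (1 - \<tau>)) *\<^sub>R u + (\<delta> * \<tau>) *\<^sub>R w + 0 *\<^sub>R d"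
          by (simp add: y_def algebra_simps)
        show "y \<tau> \<in> convex hull C" "coord u (y \<tau>) = \<delta> * (1 - \<tau>)" "coord w (y \<tau>) = \<delta> * \<tau>" "coord d (y \<tau>) = 0"
          using coord_4(1,3-5)[OF CK _ _ _ _ _ _ nn(1-3) order_refl nn(4) eq] d uw by auto
      qed
      have yX: "y \<tau> \<in> X" if \<tau>: "\<tau> \<in> {0..1}" for \<tau>
      proof -
        have "dist v (y \<tau>) = norm (\<delta> *\<^sub>R ((1 - \<tau>) *\<^sub>R (u - v) + \<tau> *\<^sub>R (w - v)))"
          unfolding dist_commute[of v] by (simp add: y_def dist_norm)
        also have "\<dots> = \<delta> * norm ((1 - \<tau>) *\<^sub>R (u - v) + \<tau> *\<^sub>R (w - v))" using \<delta> by simp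
        also have "\<dots> \<le> \<delta> * (norm ((1 - \<tau>) *\<^sub>R (u - v)) + norm (\<tau> *\<^sub>R (w - v)))"
          using \<delta> by (intro mult_left_mono norm_triangle_ineq) auto
        also have "\<dots> = \<delta> * ((1 - \<tau>) * norm (u - v) + \<tau> * norm (w - v))" using \<tau> by simp
        also have "\<dots> < \<delta> * m"
          using \<delta>(1) convex_bound_lt[OF mu[OF uV(1)] mu[OF uV(2)], of "1 - \<tau>" \<tau>] \<tau>
          by (intro mult_strict_left_mono) auto
        finally have "y \<tau> \<in> ball v r" using \<delta>(3) by simp
        moreover have "y \<tau> \<in> body" by (rule subsetD[OF hull_body y(1)]) (use C \<tau> in auto)
        moreover have "y \<tau> \<noteq> v"
        proof
          assume yv: "y \<tau> = v"
          have "coord v v = 1" using coord_vertex C by blast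
          moreover have "coord u v = 0" "coord w v = 0"
          proof -
            have v_hull: "v \<in> convex hull C" using C by (simp add: hull_inc)
            have "coord z v = 0" if "z \<in> C - {v}" for z
            proof -
              have "(\<Sum>c\<in>C. coord c v) = coord v v + (\<Sum>c\<in>C-{v}. coord c v)"
                using finite_C C by (simp add: sum.remove)
              then have "(\<Sum>c\<in>C-{v}. coord c v) = 0"
                using coord_hull(2)[OF C(1) v_hull] \<open>coord v v = 1\<close> by simp
              then show ?thesis
                using sum_nonneg_eq_0_iff[of "C-{v}" "\<lambda>c. coord c v"] coord_hull(1)[OF C(1) v_hull]
                  finite_C[OF C(1)] that by simp
            qed
            then show "coord u v = 0" "coord w v = 0" using uw by auto
          qed
          ultimately have "\<delta> * (1 - \<tau>) = 0" "\<delta> * \<tau> = 0" using y(2,3)[OF \<tau>] yv by auto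
          then show False using \<delta>(1) by auto
        qed
        ultimately show ?thesis using U(8) by (auto simp: X_def)
      qed
      have su: "s u (y \<tau>) = R \<tau>" if \<tau>: "\<tau> \<in> {0..1}" for \<tau>
      proof -
        have "s u (y \<tau>) = (\<Sum>z\<in>{u,w,d}. (sg u z * coord z (y \<tau>)) *\<^sub>R (z - v))"
        proof -
          have "C - {v} = {u,w,d}" using d uw by auto
          then show ?thesis using s_eq[OF C(1) y(1)[OF \<tau>], of u] by simp
        qed
        also have "\<dots> = R \<tau>"
          using d uw y(2-4)[OF \<tau>] by (simp add: R_def sg_def scaleR_add_right)
        finally show ?thesis .
      qed
      have sw: "s w (y \<tau>) = sg u w *\<^sub>R R \<tau>" if \<tau>: "\<tau> \<in> {0..1}" for \<tau>
        using s_rel[OF C y(1)[OF \<tau>] uw(1,2)] su[OF \<tau>] by simp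
      have R0: "R \<tau> \<noteq> 0 \<and> (h (y \<tau>) = R \<tau> \<or> h (y \<tau>) = - R \<tau>)" if \<tau>: "\<tau> \<in> {0..1}" for \<tau>
      proof (cases "\<tau> < 1")
        case True
        then have "y \<tau> \<in> S u" using yX[OF \<tau>] y(2)[OF \<tau>] \<delta>(1) by (simp add: S_def)
        then show ?thesis using s_nz[OF uV(1)] h(2)[OF uV(1)] su[OF \<tau>] by metis
      next
        case False
        then have "y \<tau> \<in> S w" using yX[OF \<tau>] y(3)[OF \<tau>] \<delta>(1) \<tau> by (simp add: S_def)
        then have "s w (y \<tau>) \<noteq> 0" "h (y \<tau>) = s w (y \<tau>) \<or> h (y \<tau>) = - s w (y \<tau>)"
          using s_nz[OF uV(2)] h(2)[OF uV(2)] by blast+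
        then show ?thesis using sw[OF \<tau>] by (auto simp: sg_def split: if_splits)
      qed
      have cR: "continuous_on {0..1} R" unfolding R_def by (intro continuous_intros)
      have "continuous_on {0..1} y" unfolding y_def by (intro continuous_intros)
      then have chy: "continuous_on {0..1} (\<lambda>\<tau>. h (y \<tau>))"
        using yX by (intro continuous_on_compose2[OF h(1)]) auto
      have same: "h (y 1) = R 1 \<longleftrightarrow> h (y 0) = R 0"
        using constant_sign[OF _ cR chy, of 0 1] constant_sign[OF _ cR chy, of 1 0] R0 by auto
      have yp: "y 0 = p u" "y 1 = p w" by (simp_all add: y_def p_def)
      have fu: "f u \<longleftrightarrow> h (y 0) = R 0" using su[of 0] yp by (simp add: f_def)
      have fw: "f w \<longleftrightarrow> h (y 1) = sg u w *\<^sub>R R 1" using sw[of 1] yp by (simp add: f_def)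
      show ?thesis
      proof (cases "c {u,w}")
        case True
        then have "f w \<longleftrightarrow> h (y 1) = - R 1" using fw uw by (simp add: sg_def)
        moreover have "R 1 \<noteq> - R 1" using R0[of 1] by (simp add: eq_neg_iff_add_eq_0 flip: scaleR_2)
        ultimately show ?thesis using True fu same R0[of 1] by auto
      next
        case False
        then show ?thesis using fw fu same uw by (simp add: sg_def)
      qed
    qed
    then show ?thesis by (intro exI[of _ f]) (auto simp: vertex_link_def)
  qed
qed

lemma linked_link:
  assumes "linked 3 A" "\<And>C. C \<in> A \<Longrightarrow> v \<in> C" "\<And>C. C \<in> A \<Longrightarrow> finite C"
  shows "linked 2 ((\<lambda>C. C - {v}) ` A)"
  unfolding linked_def
proof (intro allI impI)
  fix B assume B: "B \<subseteq> (\<lambda>C. C - {v}) ` A" "B \<noteq> {}"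
    and cl: "\<forall>s\<in>B. \<forall>t\<in>(\<lambda>C. C - {v}) ` A. card (s \<inter> t) = 2 \<longrightarrow> t \<in> B"
  obtain b where b: "b \<in> A" "b - {v} \<in> B" using B by blast
  have "{C\<in>A. C - {v} \<in> B} = A"
  proof (rule linkedD[OF assms(1)])
    fix s t assume st: "s \<in> {C\<in>A. C - {v} \<in> B}" "t \<in> A" "card (s \<inter> t) = 3"
    have "(s - {v}) \<inter> (t - {v}) = s \<inter> t - {v}" by blast
    then have "card ((s - {v}) \<inter> (t - {v})) = 2" using st assms by simp
    then show "t \<in> {C\<in>A. C - {v} \<in> B}" using cl st by blast
  qed (use b in auto)
  then show "B = (\<lambda>C. C - {v}) ` A" using B by blast
qed

lemma vertex_link_surface:
  assumes v: "v \<in> body"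
  shows "simply_connected_surface (vertex_link v)"
proof
  show "finite (vertex_link v)" using finite_K by (simp add: vertex_link_def)
  show "card t = 3" if "t \<in> vertex_link v" for t
    using that card4 finite_C by (auto simp: vertex_link_def)
  show "linked 2 (vertex_link v)"
    unfolding vertex_link_def by (rule linked_link[OF vertex_star_linked]) (use finite_C in auto)
  show "linked 2 (star (vertex_link v) w)" for w
  proof (cases "w = v")
    case True
    then have "star (vertex_link v) w = {}" by (auto simp: star_def vertex_link_def)
    then show ?thesis by (simp add: linked_def)
  next
    case False
    then have "star (vertex_link v) w = (\<lambda>C. C - {v}) ` {C\<in>\<K>. v \<in> C \<and> w \<in> C}"
      by (auto simp: star_def vertex_link_def)
    moreover have "linked 2 ((\<lambda>C. C - {v}) ` {C\<in>\<K>. v \<in> C \<and> w \<in> C})"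
      by (rule linked_link[OF edge_star_linked]) (use False finite_C in auto)
    ultimately show ?thesis by simp
  qed
  show "card {t\<in>vertex_link v. e \<subseteq> t} \<le> 2" if e: "card e = 2" for e
  proof (rule ccontr)
    assume "\<not> ?thesis"
    then have "3 \<le> card {t\<in>vertex_link v. e \<subseteq> t}" by simp
    then obtain T where T: "T \<subseteq> {t\<in>vertex_link v. e \<subseteq> t}" "card T = 3"
      by (rule obtain_subset_with_card_n) (rule that)
    then obtain r s t where rst: "T = {r,s,t}" "r \<noteq> s" "s \<noteq> t" "r \<noteq> t" by (metis card_3_iff)
    \<comment> \<open>Link triangles on the edge \<open>e\<close> come from tetrahedra on the
      triangle \<open>insert v e\<close>, of which there are at most two.\<close>
    have lift: "\<exists>C\<in>\<K>. v \<in> C \<and> x = C - {v} \<and> insert v e \<subseteq> C \<and> v \<notin> e" if "x \<in> T" for x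
      using subsetD[OF T(1) that] unfolding vertex_link_def by blast
    obtain C1 where C1: "C1 \<in> \<K>" "r = C1 - {v}" "insert v e \<subseteq> C1" "v \<notin> e" using lift[of r] rst(1) by blast
    obtain C2 where C2: "C2 \<in> \<K>" "s = C2 - {v}" "insert v e \<subseteq> C2" using lift[of s] rst(1) by blast
    obtain C3 where C3: "C3 \<in> \<K>" "t = C3 - {v}" "insert v e \<subseteq> C3" using lift[of t] rst(1) by blast
    have "finite e" using e card.infinite by fastforce
    then have "card (insert v e) = 3" using e C1(4) by simp
    then have "C1 = C2 \<or> C1 = C3 \<or> C2 = C3" using triangle_le_2 C1 C2 C3 by blast
    then show False using rst C1 C2 C3 by auto
  qed
  show "\<exists>f::'a \<Rightarrow> bool. \<forall>t\<in>vertex_link v. \<forall>x\<in>t. \<forall>y\<in>t. x \<noteq> y \<longrightarrow> c {x,y} = (f x \<noteq> f y)"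
    if "even_cochain (vertex_link v) c" for c using link_cohomology[OF v that] .
qed

end

subsection \<open>Unions of facets of a simplex\<close>

lemma homeomorphic_space_if_homeomorphism:
  assumes "homeomorphism S T f g"
  shows "top_of_set S homeomorphic_space top_of_set T"
  unfolding homeomorphic_space_def homeomorphic_maps_def
  by (intro exI[of _ f] exI[of _ g])
    (use assms in \<open>auto simp: homeomorphism_def continuous_map_subtopology_eu\<close>)

lemma second_countable_euclidean: "second_countable (euclidean :: 'a::second_countable_topology topology)"
proof -
  obtain B :: "'a set set" where B: "countable B" "topological_basis B"
    using ex_countable_basis by blast
  show ?thesis unfolding second_countable_def
  proof (intro exI[of _ B] conjI allI impI ballI)
    show "openin euclidean V" if "V \<in> B" for V using topological_basis_open[OF B(2) that] by simp
    fix U :: "'a set" and x assume "openin euclidean U \<and> x \<in> U"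
    then show "\<exists>V\<in>B. x \<in> V \<and> V \<subseteq> U" using topological_basisE[OF B(2)] by (metis open_openin)
  qed (rule B(1))
qed

lemma manifold_with_boundaryI:
  fixes S :: "'a::euclidean_space set"
  assumes "\<And>x. x \<in> S \<Longrightarrow> \<exists>U V. openin (top_of_set S) U \<and> x \<in> U \<and>
        openin (subtopology (Euclidean_space n) {y. 0 \<le> y 0}) V \<and>
        top_of_set U homeomorphic_space subtopology (Euclidean_space n) V"
  shows "manifold_with_boundary n (top_of_set S)"
  unfolding manifold_with_boundary_def
proof (intro conjI ballI)
  show "Hausdorff_space (top_of_set S)" by (simp add: Hausdorff_space_subtopology)
  show "second_countable (top_of_set S)"
    by (rule second_countable_subtopology[OF second_countable_euclidean])
  fix x assume "x \<in> topspace (top_of_set S)"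
  then obtain U V where UV: "openin (top_of_set S) U" "x \<in> U"
    "openin (subtopology (Euclidean_space n) {y. 0 \<le> y 0}) V"
    "top_of_set U homeomorphic_space subtopology (Euclidean_space n) V"
    using assms[of x] by auto
  have "subtopology (top_of_set S) U = top_of_set U"
    using openin_imp_subset[OF UV(1)] by (simp add: subtopology_subtopology Int_absorb1)
  then show "\<exists>U V. openin (top_of_set S) U \<and> x \<in> U \<and>
        openin (subtopology (Euclidean_space n) {y. 0 \<le> y 0}) V \<and>
        subtopology (top_of_set S) U homeomorphic_space subtopology (Euclidean_space n) V"
    using UV by metis
qed

lemma manifold_homeomorphic:
  fixes S :: "'a::euclidean_space set" and T :: "'b::euclidean_space set"
  assumes hom: "S homeomorphic T" and T: "manifold_with_boundary n (top_of_set T)"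
  shows "manifold_with_boundary n (top_of_set S)"
proof (rule manifold_with_boundaryI)
  obtain f g where fg: "homeomorphism S T f g" using hom unfolding homeomorphic_def by blast
  fix x assume x: "x \<in> S"
  then have "f x \<in> T" using fg by (auto simp: homeomorphism_def)
  then obtain U V where UV: "openin (top_of_set T) U" "f x \<in> U"
    "openin (subtopology (Euclidean_space n) {y. 0 \<le> y 0}) V"
    "subtopology (top_of_set T) U homeomorphic_space subtopology (Euclidean_space n) V"
    using T unfolding manifold_with_boundary_def by (metis topspace_euclidean_subtopology)
  have UT: "U \<subseteq> T" using UV(1) by (rule openin_imp_subset)
  then have "subtopology (top_of_set T) U = top_of_set U"
    by (simp add: subtopology_subtopology Int_absorb1)
  then have hU: "top_of_set U homeomorphic_space subtopology (Euclidean_space n) V" using UV(4) by simp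
  define U' where "U' = S \<inter> f -` U"
  have "continuous_on S f" "f \<in> S \<rightarrow> T" using fg by (auto simp: homeomorphism_def)
  then have "openin (top_of_set S) U'" unfolding U'_def using UV(1) by (rule continuous_openin_preimage)
  moreover have "x \<in> U'" using x UV by (simp add: U'_def)
  moreover have "homeomorphism U' U f g"
  proof (rule homeomorphism_of_subsets[OF fg _ subset_refl])
    show "f ` U' = U"
    proof
      show "U \<subseteq> f ` U'"
      proof
        fix y assume y: "y \<in> U"
        then have "g y \<in> S" "f (g y) = y" using UT fg by (auto simp: homeomorphism_def)
        with y show "y \<in> f ` U'" by (auto simp: U'_def intro!: image_eqI[of _ _ "g y"])
      qed
    qed (auto simp: U'_def)
  qed (auto simp: U'_def)
  then have "top_of_set U' homeomorphic_space subtopology (Euclidean_space n) V"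
    using homeomorphic_space_if_homeomorphism hU homeomorphic_space_trans by blast
  ultimately show "\<exists>U V. openin (top_of_set S) U \<and> x \<in> U \<and>
        openin (subtopology (Euclidean_space n) {y. 0 \<le> y 0}) V \<and>
        top_of_set U homeomorphic_space subtopology (Euclidean_space n) V" using UV(3) by blast
qed

definition of_complex_fun :: "complex \<Rightarrow> nat \<Rightarrow> real" where
  "of_complex_fun z = (\<lambda>i. if i = 0 then Re z else if i = 1 then Im z else 0)"

text \<open>Lets planar charts be built with complex numbers; the half-plane
  \<open>0 \<le> Re z\<close> corresponds to the half-space of the model.\<close>

lemma half_plane_chart:
  fixes V :: "complex set"
  assumes V: "openin (top_of_set {z. 0 \<le> Re z}) V" and UV: "homeomorphism U V f g"
  shows "\<exists>V'. openin (subtopology (Euclidean_space 2) {y. 0 \<le> y 0}) V' \<and>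
           top_of_set U homeomorphic_space subtopology (Euclidean_space 2) V'"
proof -
  let ?E = "{y::nat \<Rightarrow> real. \<forall>i\<ge>2. y i = 0}"
  define d where "d = (\<lambda>y::nat \<Rightarrow> real. Complex (y 0) (y 1))"
  have cd: "continuous_on S d" for S
    unfolding d_def by (intro continuous_on_Complex continuous_on_subset[OF continuous_on_product_coordinates]) auto
  have ce: "continuous_on S of_complex_fun" for S
  proof (rule continuous_on_coordinatewise_then_product)
    fix i :: nat
    show "continuous_on S (\<lambda>z. of_complex_fun z i)"
      unfolding of_complex_fun_def by (cases "i = 0"; cases "i = 1") (auto intro!: continuous_intros)
  qed
  have de: "d (of_complex_fun z) = z" for z by (simp add: d_def of_complex_fun_def complex_eq_iff)
  have ed: "of_complex_fun (d y) = y" if "y \<in> ?E" for y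
  proof
    fix i show "of_complex_fun (d y) i = y i"
      using that by (cases "i < 2") (auto simp: of_complex_fun_def d_def less_2_cases_iff)
  qed
  have eE: "of_complex_fun z \<in> ?E" for z by (auto simp: of_complex_fun_def)
  obtain T where T: "open T" "V = {z. 0 \<le> Re z} \<inter> T" using V by (auto simp: openin_open)
  let ?V = "of_complex_fun ` V"
  have img: "?V = ?E \<inter> {y. 0 \<le> y 0} \<inter> d -` T"
  proof
    show "?V \<subseteq> ?E \<inter> {y. 0 \<le> y 0} \<inter> d -` T"
      using de eE by (auto simp: T(2)) (simp_all add: of_complex_fun_def)
    show "?E \<inter> {y. 0 \<le> y 0} \<inter> d -` T \<subseteq> ?V"
    proof
      fix y assume y: "y \<in> ?E \<inter> {y. 0 \<le> y 0} \<inter> d -` T"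
      then have "d y \<in> V" by (simp add: T(2) d_def)
      moreover have "of_complex_fun (d y) = y" by (rule ed) (use y in blast)
      ultimately show "y \<in> ?V" by (intro image_eqI[of _ _ "d y"]) simp_all
    qed
  qed
  have "open (d -` T)" using T(1) cd[of UNIV] by (simp add: open_vimage)
  then have "openin (subtopology (Euclidean_space 2) {y. 0 \<le> y 0}) ?V"
    unfolding img Euclidean_space_top_of_set subtopology_subtopology by (rule openin_open_Int)
  moreover have "homeomorphism V ?V of_complex_fun d"
  proof (rule homeomorphismI)
    show "of_complex_fun (d y) = y" if "y \<in> ?V" for y using ed[of y] that unfolding img by blast
  qed (use ce cd de in auto)
  then have "homeomorphism U ?V (of_complex_fun \<circ> f) (g \<circ> d)" by (rule homeomorphism_compose[OF UV])
  then have "top_of_set U homeomorphic_space top_of_set ?V" by (rule homeomorphic_space_if_homeomorphism)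
  moreover have "subtopology (Euclidean_space 2) ?V = top_of_set ?V"
    unfolding Euclidean_space_top_of_set subtopology_subtopology
    by (rule arg_cong[where f = top_of_set]) (use img in blast)
  ultimately show ?thesis by metis
qed

text \<open>Near a boundary point p the disc lies under the graph of a square root; rotating p to 1 and
  subtracting the real part from that square root straightens the boundary.\<close>

lemma manifold_disc: "manifold_with_boundary 2 (top_of_set (cball (0::complex) 1))"
proof (rule manifold_with_boundaryI)
  fix p :: complex assume p: "p \<in> cball 0 1"
  have "\<exists>U V f g. openin (top_of_set (cball 0 1)) U \<and> p \<in> U \<and> openin (top_of_set {z. 0 \<le> Re z}) V \<and>
      homeomorphism U V f g"
  proof (cases "norm p < 1")
    case True
    \<comment> \<open>Translation by 2 moves the open disc into the half-plane.\<close>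
    let ?U = "ball (0::complex) 1" and ?V = "ball (2::complex) 1"
    have "openin (top_of_set (cball 0 1)) ?U" by (simp add: openin_open_eq ball_subset_cball openin_open) (metis ball_subset_cball inf.absorb_iff2 open_ball)
    moreover have "?V \<subseteq> {z. 0 \<le> Re z}"
    proof
      fix z assume "z \<in> ?V"
      then have "\<bar>Re (2 - z)\<bar> < 1" using abs_Re_le_cmod[of "2 - z"] by (simp add: dist_norm)
      then show "z \<in> {z. 0 \<le> Re z}" by simp
    qed
    then have "openin (top_of_set {z. 0 \<le> Re z}) ?V" by (metis inf.absorb_iff2 open_ball openin_open)
    moreover have "homeomorphism ?U ?V (\<lambda>z. z + 2) (\<lambda>z. z - 2)"
      by (rule homeomorphismI) (auto simp: dist_norm norm_minus_commute intro!: continuous_intros)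
    ultimately show ?thesis using True by (intro exI[of _ ?U] exI[of _ ?V]) auto
  next
    case False
    then have np: "norm p = 1" using p by simp
    have pp: "p * cnj p = 1" using np by (simp add: complex_norm_square flip: complex_norm_square)
    define U where "U = {z\<in>cball 0 1. 0 < Re (z * cnj p)}"
    define V where "V = {u. 0 \<le> Re u} \<inter> {u. Re u < sqrt (1 - (Im u)\<^sup>2)}"
    \<comment> \<open>An involution, as it leaves the imaginary part alone; up to the rotation it is
      both the chart and its inverse. It exchanges the boundary arc with the line
      \<open>Re u = 0\<close>.\<close>
    define fl where "fl = (\<lambda>w. Complex (sqrt (1 - (Im w)\<^sup>2) - Re w) (Im w))"
    have flfl: "fl (fl w) = w" for w by (simp add: fl_def complex_eq_iff)
    have cfl: "continuous_on S fl" for S unfolding fl_def by (intro continuous_intros)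
    have fU: "fl (z * cnj p) \<in> V" if "z \<in> U" for z
    proof -
      let ?w = "z * cnj p"
      have w: "norm ?w \<le> 1" "0 < Re ?w" using that np by (auto simp: U_def norm_mult)
      then have "(Re ?w)\<^sup>2 + (Im ?w)\<^sup>2 \<le> 1" by (simp add: cmod_def)
      then have "Re ?w \<le> sqrt (1 - (Im ?w)\<^sup>2)" by (intro real_le_rsqrt) simp
      with w show ?thesis by (simp add: fl_def V_def)
    qed
    have gV: "fl u * p \<in> U" if "u \<in> V" for u
    proof -
      have u: "0 \<le> Re u" "Re u < sqrt (1 - (Im u)\<^sup>2)" using that by (auto simp: V_def)
      then have pos: "0 < 1 - (Im u)\<^sup>2" by (metis le_less_trans real_sqrt_gt_0_iff)
      have "(sqrt (1 - (Im u)\<^sup>2) - Re u)\<^sup>2 \<le> (sqrt (1 - (Im u)\<^sup>2))\<^sup>2" using u by (intro power_mono) auto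
      then have "(sqrt (1 - (Im u)\<^sup>2) - Re u)\<^sup>2 + (Im u)\<^sup>2 \<le> 1" using pos by simp
      then have "norm (fl u) \<le> 1" by (simp add: fl_def cmod_def)
      moreover have "fl u * p * cnj p = fl u" using pp by (simp add: mult.assoc)
      moreover have "0 < Re (fl u)" using u by (simp add: fl_def)
      ultimately have "norm (fl u * p) \<le> 1" "0 < Re (fl u * p * cnj p)" using np by (simp_all only: norm_mult mult_1_right)
      then show ?thesis unfolding U_def by simp
    qed
    have "openin (top_of_set (cball 0 1)) U"
    proof -
      have "open {z. 0 < Re (z * cnj p)}" by (intro open_Collect_less continuous_intros)
      moreover have "U = cball 0 1 \<inter> {z. 0 < Re (z * cnj p)}" by (auto simp: U_def)
      ultimately show ?thesis by (auto simp: openin_open)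
    qed
    moreover have "p \<in> U" unfolding U_def mem_Collect_eq pp using p by simp
    moreover have "openin (top_of_set {z. 0 \<le> Re z}) V"
    proof -
      have "open {u. Re u < sqrt (1 - (Im u)\<^sup>2)}" by (intro open_Collect_less continuous_intros)
      then show ?thesis unfolding V_def by (auto simp: openin_open)
    qed
    moreover have "homeomorphism U V (\<lambda>z. fl (z * cnj p)) (\<lambda>u. fl u * p)"
    proof (rule homeomorphismI)
      show "continuous_on U (\<lambda>z. fl (z * cnj p))"
        by (rule continuous_on_compose2[OF cfl[of UNIV]]) (auto intro!: continuous_intros)
      show "continuous_on V (\<lambda>u. fl u * p)" using cfl by (intro continuous_intros)
      show "(\<lambda>z. fl (z * cnj p)) ` U \<subseteq> V" using fU by blast
      show "(\<lambda>u. fl u * p) ` V \<subseteq> U" using gV by blast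
      show "fl (fl (z * cnj p)) * p = z" for z using pp by (simp add: flfl mult.assoc mult.commute)
      show "fl (fl u * p * cnj p) = u" for u using pp by (simp add: flfl mult.assoc)
    qed
    ultimately show ?thesis by blast
  qed
  then obtain U V f g where "openin (top_of_set (cball 0 1)) U" "p \<in> U"
    "openin (top_of_set {z. 0 \<le> Re z}) V" "homeomorphism U V f g" by blast
  then show "\<exists>U V. openin (top_of_set (cball 0 1)) U \<and> p \<in> U \<and>
        openin (subtopology (Euclidean_space 2) {y. 0 \<le> y 0}) V \<and>
        top_of_set U homeomorphic_space subtopology (Euclidean_space 2) V"
    using half_plane_chart by metis
qed

text \<open>Compact convex sets of equal affine dimension are homeomorphic, so the disc settles the
  triangle.\<close>

lemma manifold_triangle:
  fixes G :: "'a::euclidean_space set"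
  assumes "\<not> affine_dependent G" "card G = 3"
  shows "manifold_with_boundary 2 (top_of_set (convex hull G))"
proof (rule manifold_homeomorphic[OF _ manifold_disc])
  have "finite G" using assms(1) aff_independent_finite by blast
  then have "compact (convex hull G)" by (rule finite_imp_compact_convex_hull)
  moreover have "aff_dim (convex hull G) = aff_dim (cball (0::complex) 1)"
    using aff_dim_affine_independent[OF assms(1)] assms(2) by (simp add: aff_dim_convex_hull aff_dim_cball)
  ultimately show "convex hull G homeomorphic cball (0::complex) 1"
    by (intro homeomorphic_convex_compact_sets) auto
qed

text \<open>Projecting v to the barycentre m of H maps the facets opposite to the vertices in H onto the facet
  opposite to v; the coordinate at v is recovered as the least coordinate in H, times the size of H.\<close>

lemma homeomorphic_facets:
  fixes C :: "'a::euclidean_space set"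
  assumes C: "\<not> affine_dependent C" and v: "v \<in> C" and H: "H \<subseteq> C - {v}" "H \<noteq> {}"
  shows "(\<Union>g\<in>H. convex hull (C - {g})) homeomorphic convex hull (C - {v})"
proof -
  interpret simplicial_family "{C}" by unfold_locales (use C in auto)
  have fC: "finite C" using finite_C by simp
  have fH: "finite H" using H fC finite_subset by blast
  define n where "n = real (card H)"
  have n: "0 < n" using H fH by (simp add: n_def card_gt_0_iff)
  define m where "m = (1/n) *\<^sub>R (\<Sum>h\<in>H. h)"
  define P where "P = (\<lambda>y. y + coord v y *\<^sub>R (m - v))"
  define \<kappa> where "\<kappa> = (\<lambda>y c. coord c y + (if c \<in> H then coord v y / n else 0))"
  let ?S = "\<Union>g\<in>H. convex hull (C - {g})"
  have CC: "C \<in> {C}" by simp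
  have body_C: "body = convex hull C" by (simp add: body_def)
  have SC: "?S \<subseteq> convex hull C" by (auto dest: subsetD[OF hull_mono, rotated])
  have split: "(\<Sum>c\<in>C-{v}. if c \<in> H then a c else 0) = (\<Sum>c\<in>H. a c)" for a :: "'a \<Rightarrow> 'b::comm_monoid_add"
    using H fC by (simp add: sum.If_cases Int_absorb1)
  have P_sum: "P y = (\<Sum>c\<in>C-{v}. \<kappa> y c *\<^sub>R c)" if y: "y \<in> convex hull C" for y
  proof -
    have "(\<Sum>c\<in>C-{v}. \<kappa> y c *\<^sub>R c) =
        (\<Sum>c\<in>C-{v}. coord c y *\<^sub>R c) + (\<Sum>c\<in>C-{v}. if c \<in> H then (coord v y / n) *\<^sub>R c else 0)"
      by (simp add: \<kappa>_def scaleR_add_left sum.distrib if_distrib[of "\<lambda>x. x *\<^sub>R _"] cong: if_cong)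
    also have "(\<Sum>c\<in>C-{v}. coord c y *\<^sub>R c) = y - coord v y *\<^sub>R v"
      using coord_hull(3)[OF CC y] sum.remove[OF fC v, of "\<lambda>c. coord c y *\<^sub>R c"] by (simp add: algebra_simps)
    also have "(\<Sum>c\<in>C-{v}. if c \<in> H then (coord v y / n) *\<^sub>R c else 0) = coord v y *\<^sub>R m"
      unfolding split by (simp add: m_def scaleR_sum_right)
    finally show ?thesis by (simp add: P_def algebra_simps)
  qed
  have \<kappa>: "0 \<le> \<kappa> y c" "sum (\<kappa> y) (C - {v}) = 1" if y: "y \<in> convex hull C" for y c
  proof -
    show "0 \<le> \<kappa> y c" using coord_hull(1)[OF CC y] n by (simp add: \<kappa>_def)
    have "sum (\<kappa> y) (C - {v}) = (\<Sum>c\<in>C-{v}. coord c y) + (\<Sum>c\<in>C-{v}. if c \<in> H then coord v y / n else 0)"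
      by (simp add: \<kappa>_def sum.distrib)
    also have "(\<Sum>c\<in>C-{v}. if c \<in> H then coord v y / n else 0) = coord v y"
      unfolding split using n by (simp add: n_def)
    also have "(\<Sum>c\<in>C-{v}. coord c y) + coord v y = 1"
      using coord_hull(2)[OF CC y] sum.remove[OF fC v, of "\<lambda>c. coord c y"] by simp
    finally show "sum (\<kappa> y) (C - {v}) = 1" .
  qed
  have P_hull: "P y \<in> convex hull (C - {v})" if y: "y \<in> convex hull C" for y
    unfolding P_sum[OF y] by (rule convex_sum) (use fC \<kappa>[OF y] in \<open>auto intro: hull_inc\<close>)
  have P_coord: "coord c (P y) = \<kappa> y c" if y: "y \<in> convex hull C" and c: "c \<in> C - {v}" for y c
  proof -
    define u where "u = (\<lambda>c. if c = v then 0 else \<kappa> y c)"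
    have "sum u C = sum u (C - {v})" "(\<Sum>c\<in>C. u c *\<^sub>R c) = (\<Sum>c\<in>C-{v}. u c *\<^sub>R c)"
      using fC v by (simp_all add: sum.remove u_def)
    moreover have "sum u (C - {v}) = sum (\<kappa> y) (C - {v})" "(\<Sum>c\<in>C-{v}. u c *\<^sub>R c) = (\<Sum>c\<in>C-{v}. \<kappa> y c *\<^sub>R c)"
      by (auto simp: u_def intro!: sum.cong)
    ultimately have "sum u C = 1" "(\<Sum>c\<in>C. u c *\<^sub>R c) = P y" using \<kappa>(2)[OF y] P_sum[OF y] by simp_all
    then show ?thesis using coord_eq[OF CC, of u c] \<kappa>(1)[OF y] c by (auto simp: u_def)
  qed
  \<comment> \<open>With \<open>attained\<close>: on a facet opposite to \<open>g\<close> the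
    coordinate at \<open>g\<close> vanishes, so \<open>coord v y / n\<close> is the least value of
    \<open>\<kappa> y\<close> on \<open>H\<close>. The image \<open>P y\<close> determines it, which
    gives injectivity.\<close>
  have min: "coord v y / n \<le> \<kappa> y h" if "h \<in> H" "y \<in> convex hull C" for y h
    using that coord_hull(1)[OF CC that(2)] by (simp add: \<kappa>_def)
  have attained: "\<exists>g\<in>H. \<kappa> y g = coord v y / n" if yS: "y \<in> ?S" for y
  proof -
    obtain g where g: "g \<in> H" "y \<in> convex hull (C - {g})" using yS by blast
    have gC: "g \<in> C" using g H by blast
    have "coord g y = 0"
    proof -
      obtain u where u: "\<forall>c\<in>C-{g}. 0 \<le> u c" "sum u (C - {g}) = 1" "(\<Sum>c\<in>C-{g}. u c *\<^sub>R c) = y"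
        using g(2) fC by (auto simp: convex_hull_finite)
      define u' where "u' = (\<lambda>c. if c = g then 0 else u c)"
      have "sum u' (C - {g}) = sum u (C - {g})" "(\<Sum>c\<in>C-{g}. u' c *\<^sub>R c) = (\<Sum>c\<in>C-{g}. u c *\<^sub>R c)"
        by (auto simp: u'_def intro!: sum.cong)
      moreover have "sum u' C = sum u' (C - {g})" "(\<Sum>c\<in>C. u' c *\<^sub>R c) = (\<Sum>c\<in>C-{g}. u' c *\<^sub>R c)"
        using fC gC by (simp_all add: sum.remove u'_def)
      ultimately show ?thesis using coord_eq[OF CC, of u' g] u by (auto simp: u'_def)
    qed
    then show ?thesis using g by (auto simp: \<kappa>_def)
  qed
  have "inj_on P ?S"
  proof (rule inj_onI)
    fix y y' assume y: "y \<in> ?S" "y' \<in> ?S" "P y = P y'"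
    have yC: "y \<in> convex hull C" "y' \<in> convex hull C" using y SC by blast+
    have eq: "\<kappa> y c = \<kappa> y' c" if "c \<in> C - {v}" for c using P_coord[OF yC(1) that] P_coord[OF yC(2) that] y by simp
    have "coord v y / n = coord v y' / n"
    proof (rule antisym)
      obtain g where g: "g \<in> H" "\<kappa> y' g = coord v y' / n" using attained[OF y(2)] by blast
      then show "coord v y / n \<le> coord v y' / n" using min[OF g(1) yC(1)] eq[OF subsetD[OF H(1) g(1)]] by simp
      obtain g where g: "g \<in> H" "\<kappa> y g = coord v y / n" using attained[OF y(1)] by blast
      then show "coord v y' / n \<le> coord v y / n" using min[OF g(1) yC(2)] eq[OF subsetD[OF H(1) g(1)]] by simp
    qed
    then have "coord c y = coord c y'" if "c \<in> C" for c
      using eq[of c] n that by (cases "c = v") (auto simp: \<kappa>_def split: if_splits)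
    then have "(\<Sum>c\<in>C. coord c y *\<^sub>R c) = (\<Sum>c\<in>C. coord c y' *\<^sub>R c)" by simp
    then show "y = y'" using coord_hull(3)[OF CC yC(1)] coord_hull(3)[OF CC yC(2)] by simp
  qed
  moreover have "P ` ?S = convex hull (C - {v})"
  proof
    show "P ` ?S \<subseteq> convex hull (C - {v})" using P_hull SC by blast
    show "convex hull (C - {v}) \<subseteq> P ` ?S"
    proof
      fix z assume z: "z \<in> convex hull (C - {v})"
      then obtain \<mu> where \<mu>: "\<forall>c\<in>C-{v}. 0 \<le> \<mu> c" "sum \<mu> (C - {v}) = 1" "(\<Sum>c\<in>C-{v}. \<mu> c *\<^sub>R c) = z"
        using fC by (auto simp: convex_hull_finite)
      have "Min (\<mu> ` H) \<in> \<mu> ` H" using fH H(2) by (intro Min_in) auto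
      then obtain g where gm: "g \<in> H" "\<mu> g = Min (\<mu> ` H)" by auto
      then have g: "g \<in> H" "\<And>h. h \<in> H \<Longrightarrow> \<mu> g \<le> \<mu> h" using fH by auto
      \<comment> \<open>The inverse of \<open>P\<close>: the least value on \<open>H\<close> is
        subtracted from all coordinates in \<open>H\<close>, and the total removed is given to
        \<open>v\<close>. The coordinate at \<open>g\<close> becomes 0, which places the point on
        the facet opposite to \<open>g\<close>.\<close>
      define u where "u = (\<lambda>c. if c = v then n * \<mu> g else \<mu> c - (if c \<in> H then \<mu> g else 0))"
      define y where "y = (\<Sum>c\<in>C. u c *\<^sub>R c)"
      have gC: "g \<in> C - {v}" using g H by blast
      have u0: "0 \<le> u c" if "c \<in> C" for c using that \<mu>(1) g n gC by (auto simp: u_def)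
      have "sum u C = u v + sum u (C - {v})" using fC v by (simp add: sum.remove)
      also have "sum u (C - {v}) = (\<Sum>c\<in>C-{v}. \<mu> c - (if c \<in> H then \<mu> g else 0))"
        by (rule sum.cong) (auto simp: u_def)
      also have "\<dots> = 1 - n * \<mu> g" unfolding sum_subtractf split using \<mu>(2) by (simp add: n_def)
      finally have u1: "sum u C = 1" by (simp add: u_def)
      have yC: "y \<in> convex hull C" unfolding y_def using u0 u1 fC by (auto simp: convex_hull_finite)
      have cy: "coord c y = u c" if "c \<in> C" for c
        using coord_eq[OF CC u0 u1, of c] that by (simp add: y_def)
      have "y \<in> convex hull (C - {g})"
      proof (rule hull_mono_coord[OF CC yC])
        fix w assume "w \<in> C - (C - {g})"
        then have "w = g" by blast
        then show "coord w y = 0" using cy[of g] gC g by (simp add: u_def)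
      qed blast
      then have "y \<in> ?S" using g by blast
      moreover have "P y = z"
      proof -
        have "\<kappa> y c = \<mu> c" if "c \<in> C - {v}" for c
          using that cy[of c] cy[OF v] n by (simp add: \<kappa>_def u_def)
        then show ?thesis unfolding P_sum[OF yC] \<mu>(3)[symmetric] by (intro sum.cong) auto
      qed
      ultimately show "z \<in> P ` ?S" by blast
    qed
  qed
  moreover have "continuous_on ?S P"
    unfolding P_def using SC
    by (intro continuous_intros continuous_on_subset[OF continuous_coord]) (simp add: body_C)
  moreover have "compact ?S"
    using fH fC by (intro compact_UN) (auto intro!: finite_imp_compact_convex_hull)
  ultimately show ?thesis
    unfolding homeomorphic_def using homeomorphism_compact[of ?S P "convex hull (C - {v})"] by metis
qed

subsection \<open>Shelling orders of local stars\<close>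

lemma hull_independent_inj:
  fixes C D :: "'a::euclidean_space set"
  assumes "\<not> affine_dependent C" "\<not> affine_dependent D" "convex hull C = convex hull D"
  shows "C = D"
  using extreme_point_of_convex_hull_affine_independent[OF assms(1)]
    extreme_point_of_convex_hull_affine_independent[OF assms(2)] assms(3) by auto

lemma independent_hull_subset_face:
  fixes C P :: "'a::euclidean_space set"
  assumes "\<not> affine_dependent C" "\<not> affine_dependent P" "convex hull P face_of convex hull C"
  shows "P \<subseteq> C"
proof -
  obtain D where D: "D \<subseteq> C" "convex hull P = convex hull D"
    using assms(3) face_of_convex_hull_affine_independent[OF assms(1)] by blast
  then have "P = D" using hull_independent_inj[OF assms(2)] affine_independent_subset[OF assms(1)] by blast
  with D show ?thesis by blast
qed

lemma simplicial_subcomplex: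
  assumes "simplicial_complex \<T>" "\<K> \<subseteq> \<T>" "\<And>F S. S \<in> \<K> \<Longrightarrow> F face_of S \<Longrightarrow> F \<in> \<K>"
  shows "simplicial_complex \<K>"
  using assms unfolding simplicial_complex_def by (meson finite_subset subsetD)

text \<open>Since \<open>v\<close> is not in \<open>H\<close>, all these facets contain
  \<open>v\<close>, and \<open>homeomorphic_facets\<close> flattens their union onto the triangle
  opposite to \<open>v\<close>.\<close>

lemma manifold_triangulation_facets:
  fixes C :: "'a::euclidean_space set"
  assumes \<T>: "simplicial_complex \<T>" "convex hull C \<in> \<T>"
    and C: "\<not> affine_dependent C" "card C = 4" and v: "v \<in> C" and H: "H \<subseteq> C - {v}" "H \<noteq> {}"
  shows "manifold_triangulation 2 {F. \<exists>g\<in>H. F face_of convex hull (C - {g})}" (is "manifold_triangulation 2 ?K")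
    and "\<Union>{F. \<exists>g\<in>H. F face_of convex hull (C - {g})} = (\<Union>g\<in>H. convex hull (C - {g}))"
proof -
  have fC: "finite C" using C(1) aff_independent_finite by blast
  have facet: "convex hull (C - {g}) face_of convex hull C" for g
    using face_of_convex_hull_affine_independent[OF C(1)] by blast
  have refl: "convex hull (C - {g}) face_of convex hull (C - {g})" for g by (simp add: face_of_refl)
  have simplex: "int 2 simplex convex hull (C - {g})" if "g \<in> H" for g
    unfolding simplex_def
    using that H C fC affine_independent_subset[OF C(1), of "C - {g}"] by (intro exI[of _ "C - {g}"]) auto
  show U: "\<Union>?K = (\<Union>g\<in>H. convex hull (C - {g}))"
    using refl face_of_imp_subset by blast
  have "simplicial_complex ?K"
  proof (rule simplicial_subcomplex[OF \<T>(1)])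
    show "?K \<subseteq> \<T>" using \<T> face_of_trans[OF _ facet] unfolding simplicial_complex_def by blast
    show "F \<in> ?K" if "S \<in> ?K" "F face_of S" for F S using that face_of_trans by blast
  qed
  moreover have "\<exists>T\<in>?K. int 2 simplex T \<and> S \<subseteq> T" if "S \<in> ?K" for S
    using that simplex refl face_of_imp_subset by blast
  ultimately have "dimensional_complex 2 ?K" unfolding dimensional_complex_def by blast
  moreover have "manifold_with_boundary 2 (top_of_set (\<Union>?K))"
    unfolding U
  proof (rule manifold_homeomorphic[OF homeomorphic_facets[OF C(1) v H]])
    show "manifold_with_boundary 2 (top_of_set (convex hull (C - {v})))"
      by (rule manifold_triangle) (use C v fC affine_independent_subset[OF C(1), of "C - {v}"] in auto)
  qed
  ultimately show "manifold_triangulation 2 ?K" unfolding manifold_triangulation_def by blast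
qed

text \<open>Coning from \<open>v\<close> adds exactly one vertex to every intersection, so an order
  for the link of \<open>v\<close> becomes one for its star.\<close>

lemma attachable_insert:
  assumes "attachable k A t" "\<And>s. s \<in> insert t A \<Longrightarrow> v \<notin> s \<and> finite s"
  shows "attachable (Suc k) (insert v ` A) (insert v t)"
proof -
  have c: "card (insert v s \<inter> insert v t) = Suc (card (s \<inter> t))" if "s \<in> A" for s
  proof -
    have "insert v s \<inter> insert v t = insert v (s \<inter> t)" by blast
    then show ?thesis using assms(2)[of s] that by simp
  qed
  show ?thesis unfolding attachable_def
  proof (intro conjI ballI)
    obtain s where "s \<in> A" "card (s \<inter> t) = k" using assms(1) unfolding attachable_def by blast
    then show "\<exists>s\<in>insert v ` A. card (s \<inter> insert v t) = Suc k" using c by blast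
    fix s assume "s \<in> insert v ` A"
    then obtain r where r: "r \<in> A" "s = insert v r" by blast
    obtain s' where s': "s' \<in> A" "card (s' \<inter> t) = k" "r \<inter> t \<subseteq> s' \<inter> t"
      using assms(1) r(1) unfolding attachable_def by blast
    have "s \<inter> insert v t \<subseteq> insert v s' \<inter> insert v t" using r(2) s'(3) by blast
    then show "\<exists>s'\<in>insert v ` A. card (s' \<inter> insert v t) = Suc k \<and> s \<inter> insert v t \<subseteq> s' \<inter> insert v t"
      using c[OF s'(1)] s'(1,2) by (intro bexI[of _ "insert v s'"]) auto
  qed
qed

lemma attaching_order_insert:
  assumes "attaching_order k ts" "\<And>s. s \<in> set ts \<Longrightarrow> v \<notin> s \<and> finite s"
  shows "attaching_order (Suc k) (map (insert v) ts)"
  unfolding attaching_order_def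
proof (intro conjI allI impI)
  have "inj_on (insert v) (set ts)" using assms(2) by (intro inj_onI) (metis Diff_insert_absorb)
  then show "distinct (map (insert v) ts)" using assms(1) by (simp add: distinct_map attaching_order_def)
  fix m assume m: "1 \<le> m \<and> m < length (map (insert v) ts)"
  have "attachable (Suc k) (insert v ` set (take m ts)) (insert v (ts ! m))"
  proof (rule attachable_insert)
    show "attachable k (set (take m ts)) (ts ! m)" using assms(1) m by (simp add: attaching_order_def)
    show "v \<notin> s \<and> finite s" if "s \<in> insert (ts ! m) (set (take m ts))" for s
      using that m assms(2) set_take_subset[of m ts] by (auto intro: nth_mem)
  qed
  then show "attachable (Suc k) (set (take m (map (insert v) ts))) (map (insert v) ts ! m)"
    using m by (simp add: take_map)
qed

text \<open>Greedy choice: connectedness supplies a next simplex with a facet in common, and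
  intersections that are not facets equal \<open>P\<close>, which lies in every facet used.\<close>

lemma linked_attaching_order:
  assumes A: "finite A" "linked k A" and P: "\<And>s t. s \<in> A \<Longrightarrow> t \<in> A \<Longrightarrow> s \<noteq> t \<Longrightarrow> card (s \<inter> t) = k \<or> s \<inter> t = P"
    and PA: "\<And>s. s \<in> A \<Longrightarrow> P \<subseteq> s"
  shows "\<exists>ts. set ts = A \<and> attaching_order k ts"
proof -
  have "\<exists>ts. set ts \<subseteq> A \<and> attaching_order k ts \<and> length ts = n" if "n \<le> card A" for n
    using that
  proof (induction n)
    case 0
    show ?case by (intro exI[of _ "[]"]) (simp add: attaching_order_def)
  next
    case (Suc n)
    then obtain ts where ts: "set ts \<subseteq> A" "attaching_order k ts" "length ts = n" by auto
    have "card (set ts) = n" using ts by (simp add: attaching_order_def distinct_card)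
    then have ne: "set ts \<noteq> A" using Suc.prems by auto
    obtain t where t: "t \<in> A" "t \<notin> set ts" "ts \<noteq> [] \<Longrightarrow> attachable k (set ts) t"
    proof (cases "ts = []")
      case True
      then show thesis using that ne by auto
    next
      case False
      then obtain b where b: "b \<in> set ts" by (cases ts) auto
      obtain y where y: "y \<in> A" "y \<notin> set ts" using ne ts(1) by blast
      obtain s t where st: "s \<in> set ts" "t \<in> A" "t \<notin> set ts" "card (s \<inter> t) = k"
        by (rule linked_cross[OF A(2) ts(1) b y])
      have "\<exists>s'\<in>set ts. card (s' \<inter> t) = k \<and> r \<inter> t \<subseteq> s' \<inter> t" if r: "r \<in> set ts" for r
      proof (cases "card (r \<inter> t) = k")
        case True then show ?thesis using r by blast
      next
        case False
        then have "r \<inter> t = P" using P[of r t] r st ts(1) by blast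
        then have "r \<inter> t \<subseteq> s \<inter> t" using PA[of s] PA[of t] st ts(1) by blast
        then show ?thesis using st by blast
      qed
      then have "attachable k (set ts) t" unfolding attachable_def using st by blast
      then show thesis using that st by blast
    qed
    then have "attaching_order k (ts @ [t])" using attaching_order_snoc ts(2) by blast
    then show ?case using ts t by (intro exI[of _ "ts @ [t]"]) auto
  qed
  then obtain ts where ts: "set ts \<subseteq> A" "attaching_order k ts" "length ts = card A" by blast
  then have "card (set ts) = card A" by (simp add: attaching_order_def distinct_card)
  then have "set ts = A" using ts(1) A(1) card_subset_eq by blast
  with ts show ?thesis by blast
qed

context tetrahedral_manifold
begin

text \<open>Distinct tetrahedra share at most three vertices. If \<open>P\<close> is an edge, they
  meet in a triangle or in \<open>P\<close>; if \<open>P\<close> has three or more vertices, they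
  meet in a triangle, so the star is trivially linked.\<close>

lemma star_attaching_order:
  assumes P: "P \<noteq> {}" and C0: "C0 \<in> \<K>" "P \<subseteq> C0"
  shows "\<exists>Cs. set Cs = {C\<in>\<K>. P \<subseteq> C} \<and> attaching_order 3 Cs"
proof -
  let ?A = "{C\<in>\<K>. P \<subseteq> C}"
  have finP: "finite P" using C0 finite_C finite_subset by blast
  have fA: "finite ?A" using finite_K by simp
  have Int_le: "card (s \<inter> t) \<le> 3" if "s \<in> \<K>" "t \<in> \<K>" "s \<noteq> t" for s t
  proof (rule ccontr)
    assume "\<not> card (s \<inter> t) \<le> 3"
    moreover have "card (s \<inter> t) \<le> 4" using that card4[of s] finite_C by (metis card_mono inf_le1)
    ultimately have c: "card (s \<inter> t) = 4" by simp
    have "s \<inter> t = s" by (rule card_subset_eq) (use c card4 finite_C that in auto)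
    moreover have "s \<inter> t = t" by (rule card_subset_eq) (use c card4 finite_C that in auto)
    ultimately show False using that by simp
  qed
  have P_le: "card P \<le> card (s \<inter> t)" if "s \<in> ?A" "t \<in> ?A" for s t
    by (rule card_mono) (use that finite_C in auto)
  have Int_P: "s \<inter> t = P" if "s \<in> ?A" "t \<in> ?A" "card (s \<inter> t) = card P" for s t
    using card_subset_eq[of "s \<inter> t" P] that finite_C by auto
  have "card P \<le> 4" using C0 card4 finite_C by (metis card_mono)
  moreover have "card P \<noteq> 0" using P finP by simp
  ultimately consider "card P = 1" | "card P = 2" | "card P \<ge> 3" by linarith
  then show ?thesis
  proof cases
    case 1
    then obtain v where v: "P = {v}" by (meson card_1_singletonE)
    then have vb: "v \<in> body" using C0 hull_body hull_inc by (metis insert_subset subsetD)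
    obtain ts where ts: "set ts = vertex_link v" "attaching_order 2 ts"
      using surface_attaching_order[OF vertex_link_surface[OF vb]] by blast
    have "attaching_order (Suc 2) (map (insert v) ts)"
      by (rule attaching_order_insert[OF ts(2)]) (use ts(1) finite_C in \<open>auto simp: vertex_link_def\<close>)
    moreover have "insert v ` vertex_link v = ?A"
      unfolding vertex_link_def image_image v by (auto simp: insert_absorb image_iff)
    then have "set (map (insert v) ts) = ?A" using ts(1) by simp
    ultimately show ?thesis by (intro exI[of _ "map (insert v) ts"]) simp
  next
    case 2
    then obtain a b where ab: "P = {a,b}" "a \<noteq> b" by (meson card_2_iff)
    have "linked 3 ?A" using edge_star_linked[OF ab(2)] ab(1) by simp
    then show ?thesis
    proof (rule linked_attaching_order[OF fA])
      show "card (s \<inter> t) = 3 \<or> s \<inter> t = P" if "s \<in> ?A" "t \<in> ?A" "s \<noteq> t" for s t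
        using Int_le[of s t] P_le[OF that(1,2)] Int_P[OF that(1,2)] that 2 by fastforce
    qed auto
  next
    case 3
    have three: "card (s \<inter> t) = 3" if "s \<in> ?A" "t \<in> ?A" "s \<noteq> t" for s t
      using Int_le[of s t] P_le[OF that(1,2)] that 3 by force
    have "linked 3 ?A" unfolding linked_def
    proof (intro allI impI)
      fix B assume B: "B \<subseteq> ?A" "B \<noteq> {}" "\<forall>s\<in>B. \<forall>t\<in>?A. card (s \<inter> t) = 3 \<longrightarrow> t \<in> B"
      then obtain b where "b \<in> B" by blast
      then have "t \<in> B" if "t \<in> ?A" for t using three[of b t] that B by (cases "b = t") blast+
      then show "B = ?A" using B(1) by blast
    qed
    then show ?thesis
      by (rule linked_attaching_order[OF fA, where P = P]) (use three in auto)
  qed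
qed

end

theorem lemma7p13:
  fixes \<T> :: "'a::euclidean_space set set" and S :: "'a set"
  assumes "manifold_triangulation 3 \<T>"
    and "S \<in> \<T>" and "S \<noteq> {}"
  shows "shellable 3 (local_star 3 \<T> S)"
proof -
  have dim: "simplicial_complex \<T>" "\<And>S. S \<in> \<T> \<Longrightarrow> \<exists>T\<in>\<T>. int 3 simplex T \<and> S \<subseteq> T"
    and mani: "manifold_with_boundary 3 (top_of_set (\<Union>\<T>))"
    using assms(1) unfolding manifold_triangulation_def dimensional_complex_def by blast+
  have faces: "F \<in> \<T>" if "T \<in> \<T>" "F face_of T" for F T using dim(1) that unfolding simplicial_complex_def by blast
  have Int_face: "T \<inter> T' face_of T" if "T \<in> \<T>" "T' \<in> \<T>" for T T'
    using dim(1) that unfolding simplicial_complex_def by blast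
  have fT: "finite \<T>" using dim(1) unfolding simplicial_complex_def by blast
  define \<K> where "\<K> = {C. \<not> affine_dependent C \<and> card C = 4 \<and> convex hull C \<in> \<T>}"
  have simplex3: "T \<in> \<T> \<and> int 3 simplex T \<longleftrightarrow> (\<exists>C\<in>\<K>. T = convex hull C)" for T
    unfolding simplex_def \<K>_def by auto
  have inj: "inj_on (\<lambda>C. convex hull C) \<K>"
    by (rule inj_onI, rule hull_independent_inj) (simp_all add: \<K>_def)
  interpret simplicial_family \<K>
  proof
    show "finite \<K>"
      by (rule finite_imageD[OF finite_subset[OF _ fT] inj]) (auto simp: \<K>_def)
    show "\<not> affine_dependent C" if "C \<in> \<K>" for C using that by (simp add: \<K>_def)
    fix C C' assume C: "C \<in> \<K>" "C' \<in> \<K>"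
    let ?I = "convex hull C \<inter> convex hull C'"
    have f: "?I face_of convex hull C" "?I face_of convex hull C'"
      using Int_face[of "convex hull C" "convex hull C'"] Int_face[of "convex hull C'" "convex hull C"] C
      by (auto simp: \<K>_def Int_commute)
    \<comment> \<open>The intersection is a face of the first simplex, spanned by some
      \<open>E\<close>; being a face of the second as well, it has its vertices \<open>E\<close>
      there too.\<close>
    obtain E where E: "E \<subseteq> C" "?I = convex hull E"
      using f(1) face_of_convex_hull_affine_independent[of C] C by (auto simp: \<K>_def)
    have "\<not> affine_dependent E" using affine_independent_subset E(1) C(1) by (auto simp: \<K>_def)
    then have "E \<subseteq> C'" using independent_hull_subset_face[of C' E] f(2) C E(2) by (simp add: \<K>_def)
    with E have "?I \<subseteq> convex hull (C \<inter> C')" by (metis hull_mono le_inf_iff)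
    moreover have "convex hull (C \<inter> C') \<subseteq> ?I" by (simp add: hull_mono)
    ultimately show "?I = convex hull (C \<inter> C')" by blast
  qed
  have body: "body = \<Union>\<T>"
  proof
    show "body \<subseteq> \<Union>\<T>" unfolding body_def by (auto simp: \<K>_def)
    show "\<Union>\<T> \<subseteq> body" unfolding body_def using dim(2) simplex3 by blast
  qed
  interpret tetrahedral_manifold \<K>
  proof
    show "card C = 4" if "C \<in> \<K>" for C using that by (simp add: \<K>_def)
    show "manifold_with_boundary 3 (top_of_set body)" using mani by (simp add: body)
  qed
  obtain n P where "n simplex S" and P: "\<not> affine_dependent P" "S = convex hull P"
    using dim(1) assms(2) unfolding simplicial_complex_def simplex_def by blast
  have P0: "P \<noteq> {}" using P(2) assms(3) by auto
  have P_sub: "S \<subseteq> convex hull C \<longleftrightarrow> P \<subseteq> C" if C: "C \<in> \<K>" for C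
  proof
    assume "S \<subseteq> convex hull C"
    then have "convex hull C \<inter> S = S" by blast
    then have "convex hull P face_of convex hull C"
      using Int_face[of "convex hull C" S] assms(2) C P by (simp add: \<K>_def)
    then show "P \<subseteq> C" using independent_hull_subset_face[OF independent[OF C] P(1)] by blast
  next
    assume "P \<subseteq> C" then show "S \<subseteq> convex hull C" unfolding P(2) by (rule hull_mono)
  qed
  have star_eq: "local_star 3 \<T> S = {F. \<exists>C\<in>\<K>. P \<subseteq> C \<and> F face_of convex hull C}"
    unfolding local_star_def
  proof (intro Collect_cong iffI)
    fix F
    assume "\<exists>T\<in>\<T>. int 3 simplex T \<and> S \<subseteq> T \<and> F face_of T"
    then obtain T where T: "T \<in> \<T> \<and> int 3 simplex T" "S \<subseteq> T" "F face_of T" by blast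
    then obtain C where C: "C \<in> \<K>" "T = convex hull C" using simplex3 by blast
    then show "\<exists>C\<in>\<K>. P \<subseteq> C \<and> F face_of convex hull C" using T(2,3) P_sub[OF C(1)] by blast
  next
    fix F
    assume "\<exists>C\<in>\<K>. P \<subseteq> C \<and> F face_of convex hull C"
    then obtain C where C: "C \<in> \<K>" "P \<subseteq> C" "F face_of convex hull C" by blast
    then have "convex hull C \<in> \<T> \<and> int 3 simplex convex hull C" using simplex3 by blast
    then show "\<exists>T\<in>\<T>. int 3 simplex T \<and> S \<subseteq> T \<and> F face_of T" using C P_sub[OF C(1)] by blast
  qed
  have star_T: "local_star 3 \<T> S \<subseteq> \<T>" unfolding star_eq using faces by (auto simp: \<K>_def)
  have hull_star: "convex hull C \<in> local_star 3 \<T> S" if "C \<in> \<K>" "P \<subseteq> C" for C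
    unfolding star_eq using that face_of_refl[OF convex_convex_hull[of C]] by blast
  have star_simplices: "{T \<in> local_star 3 \<T> S. int 3 simplex T} = (\<lambda>C. convex hull C) ` {C\<in>\<K>. P \<subseteq> C}"
  proof
    show "(\<lambda>C. convex hull C) ` {C\<in>\<K>. P \<subseteq> C} \<subseteq> {T \<in> local_star 3 \<T> S. int 3 simplex T}"
      using hull_star simplex3 by blast
    show "{T \<in> local_star 3 \<T> S. int 3 simplex T} \<subseteq> (\<lambda>C. convex hull C) ` {C\<in>\<K>. P \<subseteq> C}"
    proof
      fix T assume T: "T \<in> {T \<in> local_star 3 \<T> S. int 3 simplex T}"
      obtain C where C: "C \<in> \<K>" "P \<subseteq> C" "T face_of convex hull C" using T unfolding star_eq by blast
      obtain E where E: "E \<in> \<K>" "T = convex hull E" using T star_T simplex3 by blast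
      \<comment> \<open>A tetrahedron that is a face of another one has the same four vertices, so
        taking faces adds no tetrahedra to the star.\<close>
      have "E \<subseteq> C" using independent_hull_subset_face[OF independent[OF C(1)] independent[OF E(1)]] C(3) E(2) by simp
      then have "E = C" using card_subset_eq[OF finite_C[OF C(1)]] card4[OF C(1)] card4[OF E(1)] by simp
      then show "T \<in> (\<lambda>C. convex hull C) ` {C\<in>\<K>. P \<subseteq> C}" using C E by blast
    qed
  qed
  have "dimensional_complex 3 (local_star 3 \<T> S)"
    unfolding dimensional_complex_def
  proof (intro conjI ballI)
    show "simplicial_complex (local_star 3 \<T> S)"
      by (rule simplicial_subcomplex[OF dim(1) star_T]) (use face_of_trans in \<open>auto simp: star_eq\<close>)
    fix F assume "F \<in> local_star 3 \<T> S"
    then obtain C where C: "C \<in> \<K>" "P \<subseteq> C" "F face_of convex hull C" unfolding star_eq by blast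
    then show "\<exists>T\<in>local_star 3 \<T> S. int 3 simplex T \<and> F \<subseteq> T"
      using hull_star[OF C(1,2)] simplex3 face_of_imp_subset[OF C(3)] by blast
  qed
  moreover have "\<exists>Ts. shelling 3 (local_star 3 \<T> S) Ts"
  proof -
    obtain T where T: "T \<in> \<T> \<and> int 3 simplex T" "S \<subseteq> T" using dim(2) assms(2) by blast
    obtain C0 where C0: "C0 \<in> \<K>" "T = convex hull C0" using T(1) simplex3 by blast
    then have C0: "C0 \<in> \<K>" "P \<subseteq> C0" using P_sub T(2) by auto
    obtain Cs where Cs: "set Cs = {C\<in>\<K>. P \<subseteq> C}" "attaching_order 3 Cs"
      using star_attaching_order[OF P0 C0] by blast
    let ?Ts = "map (\<lambda>C. convex hull C) Cs"
    have "shelling 3 (local_star 3 \<T> S) ?Ts"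
      unfolding shelling_def
    proof (intro conjI allI impI)
      show "?Ts \<noteq> []" using Cs(1) C0 by auto
      show "distinct ?Ts"
        using Cs inj_on_subset[OF inj, of "set Cs"] by (auto simp: distinct_map attaching_order_def)
      show "set ?Ts = {T \<in> local_star 3 \<T> S. int 3 simplex T}" unfolding star_simplices by (simp add: Cs)
    next
      fix m assume m: "1 \<le> m \<and> m < length ?Ts"
      define t where "t = Cs ! m"
      define A where "A = set (take m Cs)"
      have t: "t \<in> \<K>" "P \<subseteq> t" using m Cs(1) nth_mem[of m Cs] by (auto simp: t_def)
      have A: "C \<in> \<K> \<and> P \<subseteq> C" if "C \<in> A" for C using that Cs(1) set_take_subset[of m Cs] by (auto simp: A_def)
      have att: "attachable 3 A t" using Cs(2) m by (simp add: attaching_order_def t_def A_def)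
      obtain v where v: "v \<in> P" using P0 by blast
      \<comment> \<open>The vertices of \<open>t\<close> opposite to the facets along which
        \<open>t\<close> is attached. No such vertex is \<open>v\<close>, because all earlier
        tetrahedra contain \<open>P\<close>.\<close>
      define H where "H = {g\<in>t. t - {g} \<in> (\<lambda>C. C \<inter> t) ` A}"
      have vt: "v \<in> t" using v t by blast
      have H: "H \<subseteq> t - {v}" using v A unfolding H_def by blast
      have G: "\<exists>g\<in>H. C \<inter> t = t - {g}" if C: "C \<in> A" "card (C \<inter> t) = 3" for C
      proof -
        have "card (t - C \<inter> t) = 1"
          using card4[OF t(1)] C finite_C[OF t(1)] by (subst card_Diff_subset) auto
        then obtain g where g: "t - C \<inter> t = {g}" by (meson card_1_singletonE)
        then have "g \<in> t" "C \<inter> t = t - {g}" by blast+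
        then show ?thesis using C by (auto simp: H_def image_iff)
      qed
      have H0: "H \<noteq> {}" using att G unfolding attachable_def by blast
      have iface: "interface_set ?Ts m = (\<Union>g\<in>H. convex hull (t - {g}))"
      proof -
        have "interface_set ?Ts m = (\<Union>C\<in>A. convex hull C \<inter> convex hull t)"
          using m by (auto simp: interface_set_def A_def t_def take_map)
        also have "\<dots> = (\<Union>C\<in>A. convex hull (C \<inter> t))" using A hull_Int[OF _ t(1)] by (intro SUP_cong) auto
        also have "\<dots> = (\<Union>g\<in>H. convex hull (t - {g}))"
        proof
          show "(\<Union>C\<in>A. convex hull (C \<inter> t)) \<subseteq> (\<Union>g\<in>H. convex hull (t - {g}))"
          proof
            fix x assume "x \<in> (\<Union>C\<in>A. convex hull (C \<inter> t))"
            then obtain C where C: "C \<in> A" "x \<in> convex hull (C \<inter> t)" by blast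
            \<comment> \<open>Smaller intersections are absorbed by facets, so the interface has no
              parts of lower dimension.\<close>
            obtain C' where C': "C' \<in> A" "card (C' \<inter> t) = 3" "C \<inter> t \<subseteq> C' \<inter> t"
              using att C(1) unfolding attachable_def by blast
            then obtain g where "g \<in> H" "C' \<inter> t = t - {g}" using G by blast
            then show "x \<in> (\<Union>g\<in>H. convex hull (t - {g}))" using C(2) hull_mono[OF C'(3), of convex] by auto
          qed
          show "(\<Union>g\<in>H. convex hull (t - {g})) \<subseteq> (\<Union>C\<in>A. convex hull (C \<inter> t))"
            by (force simp: H_def)
        qed
        finally show ?thesis .
      qed
      have tT: "convex hull t \<in> \<T>" using t by (simp add: \<K>_def)
      note facets = manifold_triangulation_facets[OF dim(1) tT independent[OF t(1)] card4[OF t(1)] vt H H0]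
      obtain g where g: "g \<in> H" using H0 by blast
      then have "v \<in> convex hull (t - {g})" using H vt by (intro hull_inc) auto
      then show "interface_set ?Ts m \<noteq> {}" unfolding iface using g by blast
      show "\<exists>\<K>\<subseteq>{F. F face_of ?Ts ! m}. manifold_triangulation (3 - 1) \<K> \<and> \<Union> \<K> = interface_set ?Ts m"
      proof (intro exI conjI)
        let ?K = "{F. \<exists>g\<in>H. F face_of convex hull (t - {g})}"
        have "convex hull (t - {g}) face_of convex hull t" for g
          using face_of_convex_hull_affine_independent[OF independent[OF t(1)]] by blast
        then show "?K \<subseteq> {F. F face_of ?Ts ! m}" using m face_of_trans by (auto simp: t_def)
        show "manifold_triangulation (3 - 1) ?K" using facets(1) by simp
        show "\<Union>?K = interface_set ?Ts m" unfolding iface by (rule facets(2))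
      qed
    qed
    then show ?thesis by blast
  qed
  ultimately show ?thesis unfolding shellable_def by blast
qed

end
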